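(* Let $q$ be a prime power and $\boldsymbol\lambda,\boldsymbol\mu,\boldsymbol\nu\in\mathscr P(\Phi_q)$. Suppose $\|\boldsymbol\lambda\|+\|\boldsymbol\mu\|=\|\boldsymbol\nu\|$. Then $$\mathfrak p_{(\boldsymbol\lambda,0),(\boldsymbol\mu,0)}^{(\boldsymbol\nu,0)}=a_{\boldsymbol\lambda\boldsymbol\mu}^{\boldsymbol\nu}.$$
   Context: Let $q$ be a prime power; vectors in $\mathbb F_q^n$ are columns. $\Phi_q$ is the set of monic irreducible polynomials in $\mathbb F_q[t]$ other than $t$. $\mathscr P(\Phi_q)$ is the set of maps $\boldsymbol\lambda$ from $\Phi_q$ to partitions with $\boldsymbol\lambda(f)$ nonempty for only finitely many $f$; $\|\boldsymbol\lambda\|=\sum_{f}\deg(f)\,|\boldsymbol\lambda(f)|$; $\mathscr P_n(\Phi_q)=\{\boldsymbol\lambda:\|\boldsymbol\lambda\|=n\}$. Type in $GL_n(q)$: $g\in GL_n(q)$ has type $\boldsymbol\lambda\in\mathscr P_n(\Phi_q)$ if $\mathbb F_q^n$, with $t$ acting as $g$, is isomorphic to $\bigoplus_{f,i}\mathbb F_q[t]/(f)^{\boldsymbol\lambda_i(f)}$ as an $\mathbb F_q[t]$-module, where $\boldsymbol\lambda(f)=(\boldsymbol\lambda_1(f),\boldsymbol\lambda_2(f),\dots)$. The modified type of $g$ is $\mathring{\boldsymbol\lambda}\in\mathscr P(\Phi_q)$, where $\mathring{\boldsymbol\lambda}(f)=\boldsymbol\lambda(f)$ for $f\ne t-1$ and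 $\mathring{\boldsymbol\lambda}(t-1)$ is obtained from $\boldsymbol\lambda(t-1)$ by subtracting $1$ from every (positive) part. Constants $a$: $K_{\boldsymbol\lambda}(n)\in\mathbb Z[GL_n(q)]$ is the sum of all elements of $GL_n(q)$ of modified type $\boldsymbol\lambda$ (zero if there are none, a conjugacy class sum otherwise). For $n$ with $K_{\boldsymbol\lambda}(n),K_{\boldsymbol\mu}(n),K_{\boldsymbol\nu}(n)$ all nonzero, $a_{\boldsymbol\lambda\boldsymbol\mu}^{\boldsymbol\nu}(n)$ is the coefficient of $K_{\boldsymbol\nu}(n)$ in $K_{\boldsymbol\lambda}(n)K_{\boldsymbol\mu}(n)$. If $\|\boldsymbol\nu\|=\|\boldsymbol\lambda\|+\|\boldsymbol\mu\|$ it is known (a theorem of Wan and Wang) that this is independent of $n$; the common value is $a_{\boldsymbol\lambda\boldsymbol\mu}^{\boldsymbol\nu}$. $GA_n(q)$ is the subgroup of $GL_n(q)$ of matrices $\begin{bmatrix}1&0\\ \alpha&g\end{bmatrix}$ with $g\in GL_{n-1}(q)$, $\alpha\in\mathbb F_q^{n-1}$. Canonical forms. For $f=t^d-\sum_{i=1}^d a_it^{i-1}\in\Phi_q$, $J(f)$ is the companion matrix with $1$'s on the superdiagonal, last row $(a_1,\dots,a_d)$, and other entries $0$; $J_m(f)$ is the $dm\times dm$ block matrix with $m$ diagonal blocks $J(f)$, blocks $I_d$ on the block superdiagonal, and zeros elsewhere. For $\boldsymbol\lambda\in\mathscr P_{n-1}(\Phi_q)$ with $\boldsymbol\lambda(t-1)=(1^{m_1}2^{m_2}\cdots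 r^{m_r})$, $J_{\boldsymbol\lambda}=\mathrm{diag}(E^{(1)}_{\boldsymbol\lambda},\dots,E^{(r)}_{\boldsymbol\lambda},J^-_{\boldsymbol\lambda})$, where $E^{(i)}_{\boldsymbol\lambda}$ is the diagonal sum of $m_i$ copies of $J_i(t-1)$ and $J_{\boldsymbol\lambda}^-$ is the diagonal sum of the $J_{\boldsymbol\lambda_i(f)}(f)$ over $f\ne t-1$ and $i\geq 1$ (in a fixed order). For $k=0$ or $k$ a part of $\boldsymbol\lambda(t-1)$, put $J_{(\boldsymbol\lambda,k)}=\begin{bmatrix}1&0\\ \epsilon_k&J_{\boldsymbol\lambda}\end{bmatrix}\in GA_n(q)$, where $\epsilon_0=0$ and, for $k\ge1$, $\epsilon_k\in\mathbb F_q^{n-1}$ has entry $1$ in the last coordinate of the rows of $E^{(k)}_{\boldsymbol\lambda}$ (position $m_1+2m_2+\cdots+km_k$) and zeros elsewhere. Every $A\in GA_n(q)$ is conjugate in $GA_n(q)$ to exactly one $J_{(\boldsymbol\lambda,k)}$ with $\boldsymbol\lambda\in\mathscr P_{n-1}(\Phi_q)$ and $k=0$ or $k$ a part of $\boldsymbol\lambda(t-1)$; then $A$ is said to have type $(\boldsymbol\lambda,k)$ and modified type $(\mathring{\boldsymbol\lambda},k)$. $P_{(\boldsymbol\lambda,k)}(n)$ is the sum in $\mathbb Z[GA_n(q)]$ of all elements of $GA_n(q)$ of modified type $(\boldsymbol\lambda,k)$ (zero if there are none, a conjugacy class sum otherwise). Constants $\mathfrak p$: for $n$ with $P_{(\boldsymbol\lambda,0)}(n),P_{(\boldsymbol\mu,0)}(n),P_{(\boldsymbol\nu,0)}(n)$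 all nonzero, $\mathfrak p_{(\boldsymbol\lambda,0),(\boldsymbol\mu,0)}^{(\boldsymbol\nu,0)}(n)$ is the coefficient of $P_{(\boldsymbol\nu,0)}(n)$ in $P_{(\boldsymbol\lambda,0)}(n)P_{(\boldsymbol\mu,0)}(n)$. When $\|\boldsymbol\nu\|=\|\boldsymbol\lambda\|+\|\boldsymbol\mu\|$ this is independent of $n$, and the common value is $\mathfrak p_{(\boldsymbol\lambda,0),(\boldsymbol\mu,0)}^{(\boldsymbol\nu,0)}$. *)

theory Defs
  imports "Jordan_Normal_Form.Matrix" "HOL-Algebra.QuotRing" "HOL-Library.FuncSet"
    "HOL-Computational_Algebra.Polynomial"
begin

text \<open>
  The field \<open>F_q\<close> is a type of sort \<open>{finite, field}\<close>, so that \<open>q\<close> is its cardinality.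
  Matrices are indexed from 0, and the vectors of type \<open>'q vec\<close> are columns.
\<close>

section \<open>Partition-valued maps on monic irreducible polynomials\<close>

definition Phi :: "'q::field poly set" where
  "Phi = {f. irreducible f \<and> lead_coeff f = 1 \<and> f \<noteq> [:0, 1:]}"

abbreviation t_minus_1 :: "'q::field poly" where
  "t_minus_1 \<equiv> [:-1, 1:]"

text \<open>A partition is the weakly decreasing list of its positive parts; the part
  \<open>lam\<^sub>i\<close> of the literature is \<open>lam ! (i - 1)\<close>.\<close>

definition is_partition :: "nat list \<Rightarrow> bool" where
  "is_partition xs \<longleftrightarrow> sorted_wrt (\<ge>) xs \<and> 0 \<notin> set xs"

definition PPhi :: "('q::field poly \<Rightarrow> nat list) set" where
  "PPhi = {lam. (\<forall>f. is_partition (lam f)) \<and> (\<forall>f. f \<notin> Phi \<longrightarrow> lam f = [])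
                \<and> finite {f. lam f \<noteq> []}}"

definition pnorm :: "('q::field poly \<Rightarrow> nat list) \<Rightarrow> nat" where
  "pnorm lam = (\<Sum>f | lam f \<noteq> []. degree f * sum_list (lam f))"

definition PPhi_of_size :: "nat \<Rightarrow> ('q::field poly \<Rightarrow> nat list) set" where
  "PPhi_of_size n = {lam \<in> PPhi. pnorm lam = n}"

definition modify :: "('q::field poly \<Rightarrow> nat list) \<Rightarrow> 'q poly \<Rightarrow> nat list" where
  "modify lam = lam(t_minus_1 := filter (\<lambda>k. k > 0) (map (\<lambda>k. k - 1) (lam t_minus_1)))"

section \<open>Modules over the polynomial ring\<close>

definition poly_ring :: "'q::field poly ring" where
  "poly_ring = \<lparr>carrier = UNIV, mult = (*), one = 1, zero = 0, add = (+)\<rparr>"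

text \<open>Modules are records of type \<open>module\<close>; their (inherited) fields \<open>mult\<close> and
  \<open>one\<close> play no role and are left undefined.\<close>

definition module_isomorphic ::
    "('r, 's) ring_scheme \<Rightarrow> ('r, 'b, 'c) module_scheme \<Rightarrow> ('r, 'd, 'e) module_scheme \<Rightarrow> bool" where
  "module_isomorphic R M N \<longleftrightarrow>
     (\<exists>\<phi>. bij_betw \<phi> (carrier M) (carrier N)
        \<and> (\<forall>x\<in>carrier M. \<forall>y\<in>carrier M. \<phi> (x \<oplus>\<^bsub>M\<^esub> y) = \<phi> x \<oplus>\<^bsub>N\<^esub> \<phi> y)
        \<and> (\<forall>r\<in>carrier R. \<forall>x\<in>carrier M. \<phi> (r \<odot>\<^bsub>M\<^esub> x) = r \<odot>\<^bsub>N\<^esub> \<phi> x))"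

text \<open>The vector \<open>p(g) v\<close>, computed by the Horner scheme.\<close>

definition poly_act :: "nat \<Rightarrow> 'q::field mat \<Rightarrow> 'q poly \<Rightarrow> 'q vec \<Rightarrow> 'q vec" where
  "poly_act n g p v = fold_coeffs (\<lambda>a w. a \<cdot>\<^sub>v v + g *\<^sub>v w) p (0\<^sub>v n)"

definition mat_module :: "nat \<Rightarrow> 'q::field mat \<Rightarrow> ('q poly, 'q vec) module" where
  "mat_module n g =
     \<lparr>carrier = carrier_vec n, mult = undefined, one = undefined,
      zero = 0\<^sub>v n, add = (+), module.smult = poly_act n g\<rparr>"

text \<open>The quotient of \<open>F_q[t]\<close> by the \<open>m\<close>-th power of the ideal \<open>(f)\<close>.\<close>

definition cyclic_module :: "'q::field poly \<Rightarrow> nat \<Rightarrow> ('q poly, 'q poly set) module" where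
  "cyclic_module f m =
     (let I = PIdl\<^bsub>poly_ring\<^esub> (f ^ m); Q = poly_ring Quot I
      in \<lparr>carrier = carrier Q, mult = undefined, one = undefined,
          zero = \<zero>\<^bsub>Q\<^esub>, add = add Q, module.smult = (\<lambda>p X. (I +>\<^bsub>poly_ring\<^esub> p) \<otimes>\<^bsub>Q\<^esub> X)\<rparr>)"

definition direct_sum ::
    "'i set \<Rightarrow> ('i \<Rightarrow> ('r, 'b) module) \<Rightarrow> ('r, 'i \<Rightarrow> 'b) module" where
  "direct_sum I M =
     \<lparr>carrier = {u \<in> (\<Pi>\<^sub>E i\<in>I. carrier (M i)). finite {i \<in> I. u i \<noteq> \<zero>\<^bsub>M i\<^esub>}},
      mult = undefined, one = undefined,
      zero = (\<lambda>i\<in>I. \<zero>\<^bsub>M i\<^esub>), add = (\<lambda>u v. \<lambda>i\<in>I. u i \<oplus>\<^bsub>M i\<^esub> v i),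
      module.smult = (\<lambda>r u. \<lambda>i\<in>I. r \<odot>\<^bsub>M i\<^esub> u i)\<rparr>"

definition type_module ::
    "('q::field poly \<Rightarrow> nat list) \<Rightarrow> ('q poly, 'q poly \<times> nat \<Rightarrow> 'q poly set) module" where
  "type_module lam =
     direct_sum {(f, i). f \<in> Phi \<and> i < length (lam f)} (\<lambda>(f, i). cyclic_module f (lam f ! i))"

section \<open>Integral group rings of finite groups\<close>

text \<open>Elements of \<open>Z[G]\<close> are represented by their coefficient functions, which vanish
  outside \<open>carrier G\<close>.\<close>

definition grp_ring_mult ::
    "('g, 'm) monoid_scheme \<Rightarrow> ('g \<Rightarrow> int) \<Rightarrow> ('g \<Rightarrow> int) \<Rightarrow> 'g \<Rightarrow> int" where
  "grp_ring_mult G x y =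
     (\<lambda>g. \<Sum>(a, b) | a \<in> carrier G \<and> b \<in> carrier G \<and> a \<otimes>\<^bsub>G\<^esub> b = g. x a * y b)"

definition set_sum :: "'g set \<Rightarrow> 'g \<Rightarrow> int" where
  "set_sum S = (\<lambda>g. if g \<in> S then 1 else 0)"

definition conj_class :: "('g, 'm) monoid_scheme \<Rightarrow> 'g \<Rightarrow> 'g set" where
  "conj_class G a = {h \<otimes>\<^bsub>G\<^esub> a \<otimes>\<^bsub>G\<^esub> inv\<^bsub>G\<^esub> h | h. h \<in> carrier G}"

definition class_sums :: "('g, 'm) monoid_scheme \<Rightarrow> ('g \<Rightarrow> int) set" where
  "class_sums G = (\<lambda>a. set_sum (conj_class G a)) ` carrier G"

text \<open>The coefficient of the class sum \<open>z\<close> in the expansion of the central element \<open>x\<close>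
  in the basis of class sums of the centre of \<open>Z[G]\<close>.\<close>

definition class_coeff ::
    "('g, 'm) monoid_scheme \<Rightarrow> ('g \<Rightarrow> int) \<Rightarrow> ('g \<Rightarrow> int) \<Rightarrow> int" where
  "class_coeff G x z = (THE c. \<exists>k. x = (\<lambda>g. \<Sum>b\<in>class_sums G. k b * b g) \<and> k z = c)"

section \<open>The general linear groups\<close>

definition GL :: "nat \<Rightarrow> 'q::field mat monoid" where
  "GL n = units_of (ring_mat TYPE('q) n ())"

definition GL_type :: "nat \<Rightarrow> 'q::field mat \<Rightarrow> ('q poly \<Rightarrow> nat list) \<Rightarrow> bool" where
  "GL_type n g lam \<longleftrightarrow> g \<in> carrier (GL n) \<and> lam \<in> PPhi_of_size n
     \<and> module_isomorphic poly_ring (mat_module n g) (type_module lam)"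

definition GL_modified_type :: "nat \<Rightarrow> 'q::field mat \<Rightarrow> ('q poly \<Rightarrow> nat list) \<Rightarrow> bool" where
  "GL_modified_type n g lam \<longleftrightarrow> (\<exists>rho. GL_type n g rho \<and> lam = modify rho)"

definition K_sum :: "('q::field poly \<Rightarrow> nat list) \<Rightarrow> nat \<Rightarrow> 'q mat \<Rightarrow> int" where
  "K_sum lam n = set_sum {g \<in> carrier (GL n). GL_modified_type n g lam}"

definition a_coeff ::
    "('q::field poly \<Rightarrow> nat list) \<Rightarrow> ('q poly \<Rightarrow> nat list) \<Rightarrow> ('q poly \<Rightarrow> nat list) \<Rightarrow> nat \<Rightarrow> int"
where
  "a_coeff lam mu nu n =
     class_coeff (GL n) (grp_ring_mult (GL n) (K_sum lam n) (K_sum mu n)) (K_sum nu n)"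

text \<open>Meaningful when \<open>pnorm nu = pnorm lam + pnorm mu\<close>, as then the values
  \<open>a_coeff lam mu nu n\<close> do not depend on \<open>n\<close>. The three elements
  are nonzero for every large \<open>n\<close>. The same applies to \<open>p_const\<close> below.\<close>

definition a_const ::
    "('q::field poly \<Rightarrow> nat list) \<Rightarrow> ('q poly \<Rightarrow> nat list) \<Rightarrow> ('q poly \<Rightarrow> nat list) \<Rightarrow> int" where
  "a_const lam mu nu =
     (THE c. \<forall>n. K_sum lam n \<noteq> (\<lambda>_. 0) \<and> K_sum mu n \<noteq> (\<lambda>_. 0) \<and> K_sum nu n \<noteq> (\<lambda>_. 0)
                 \<longrightarrow> a_coeff lam mu nu n = c)"

section \<open>Canonical forms\<close>

text \<open>If \<open>f = t^d - (\<Sum>i=1..d. a\<^sub>i t^(i-1))\<close>, then \<open>a\<^sub>i = - coeff f (i - 1)\<close>.\<close>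

definition companion :: "'q::field poly \<Rightarrow> 'q mat" where
  "companion f = (let d = degree f in
     mat d d (\<lambda>(i, j). if i = d - 1 then - coeff f j else if j = i + 1 then 1 else 0))"

definition gen_jordan_block :: "'q::field poly \<Rightarrow> nat \<Rightarrow> 'q mat" where
  "gen_jordan_block f m = (let d = degree f in
     mat (d * m) (d * m) (\<lambda>(i, j).
       if i div d = j div d then companion f $$ (i mod d, j mod d)
       else if j div d = i div d + 1 then 1\<^sub>m d $$ (i mod d, j mod d)
       else 0))"

text \<open>The fixed order of the polynomials in the following block matrix is an arbitrary one.\<close>

definition J_minus_support :: "('q::field poly \<Rightarrow> nat list) \<Rightarrow> 'q poly list" where
  "J_minus_support lam =
     (SOME fs. distinct fs \<and> set fs = {f. lam f \<noteq> [] \<and> f \<noteq> t_minus_1})"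

definition J_minus :: "('q::field poly \<Rightarrow> nat list) \<Rightarrow> 'q mat" where
  "J_minus lam = diag_block_mat
     (concat (map (\<lambda>f. map (gen_jordan_block f) (lam f)) (J_minus_support lam)))"

definition E_block :: "('q::field poly \<Rightarrow> nat list) \<Rightarrow> nat \<Rightarrow> 'q mat" where
  "E_block lam i = diag_block_mat
     (replicate (count_list (lam t_minus_1) i) (gen_jordan_block t_minus_1 i))"

definition J_mat :: "('q::field poly \<Rightarrow> nat list) \<Rightarrow> 'q mat" where
  "J_mat lam = diag_block_mat
     (map (E_block lam) [1..<Suc (Max (insert 0 (set (lam t_minus_1))))] @ [J_minus lam])"

definition epsilon :: "('q::field poly \<Rightarrow> nat list) \<Rightarrow> nat \<Rightarrow> 'q mat" where
  "epsilon lam k = mat (pnorm lam) 1 (\<lambda>(i, _).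
     if k \<ge> 1 \<and> i + 1 = (\<Sum>j=1..k. j * count_list (lam t_minus_1) j) then 1 else 0)"

definition J_affine :: "('q::field poly \<Rightarrow> nat list) \<times> nat \<Rightarrow> 'q mat" where
  "J_affine = (\<lambda>(lam, k).
     four_block_mat (1\<^sub>m 1) (0\<^sub>m 1 (pnorm lam)) (epsilon lam k) (J_mat lam))"

section \<open>The affine groups\<close>

text \<open>The set \<open>carrier (GA n)\<close> is empty for \<open>n = 0\<close>.\<close>

definition GA :: "nat \<Rightarrow> 'q::field mat monoid" where
  "GA n = (GL n)\<lparr>carrier := {A \<in> carrier (GL n). \<exists>\<alpha> g.
     \<alpha> \<in> carrier_mat (n - 1) 1 \<and> g \<in> carrier (GL (n - 1))
     \<and> A = four_block_mat (1\<^sub>m 1) (0\<^sub>m 1 (n - 1)) \<alpha> g}\<rparr>"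

definition GA_type :: "nat \<Rightarrow> 'q::field mat \<Rightarrow> ('q poly \<Rightarrow> nat list) \<times> nat \<Rightarrow> bool" where
  "GA_type n A = (\<lambda>(lam, k). A \<in> carrier (GA n) \<and> lam \<in> PPhi_of_size (n - 1)
     \<and> (k = 0 \<or> k \<in> set (lam t_minus_1)) \<and> A \<in> conj_class (GA n) (J_affine (lam, k)))"

definition GA_modified_type ::
    "nat \<Rightarrow> 'q::field mat \<Rightarrow> ('q poly \<Rightarrow> nat list) \<times> nat \<Rightarrow> bool" where
  "GA_modified_type n A = (\<lambda>(lam, k). \<exists>rho. GA_type n A (rho, k) \<and> lam = modify rho)"

definition P_sum :: "('q::field poly \<Rightarrow> nat list) \<times> nat \<Rightarrow> nat \<Rightarrow> 'q mat \<Rightarrow> int" where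
  "P_sum x n = set_sum {A \<in> carrier (GA n). GA_modified_type n A x}"

definition p_coeff ::
    "('q::field poly \<Rightarrow> nat list) \<times> nat \<Rightarrow> ('q poly \<Rightarrow> nat list) \<times> nat
       \<Rightarrow> ('q poly \<Rightarrow> nat list) \<times> nat \<Rightarrow> nat \<Rightarrow> int" where
  "p_coeff x y z n = class_coeff (GA n) (grp_ring_mult (GA n) (P_sum x n) (P_sum y n)) (P_sum z n)"

definition p_const ::
    "('q::field poly \<Rightarrow> nat list) \<times> nat \<Rightarrow> ('q poly \<Rightarrow> nat list) \<times> nat
       \<Rightarrow> ('q poly \<Rightarrow> nat list) \<times> nat \<Rightarrow> int" where
  "p_const x y z =
     (THE c. \<forall>n. P_sum x n \<noteq> (\<lambda>_. 0) \<and> P_sum y n \<noteq> (\<lambda>_. 0) \<and> P_sum z n \<noteq> (\<lambda>_. 0)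
                 \<longrightarrow> p_coeff x y z n = c)"

end

theory Submission
  imports Defs "Jordan_Normal_Form.Determinant" "HOL-Computational_Algebra.Primes"
    "HOL-Combinatorics.Permutations"
begin

text \<open>
  An element of \<open>GA\<^sub>n\<^sub>+\<^sub>1\<close> of modified type \<open>(\<lambda>, 0)\<close> is a conjugate of \<open>diag(1, J)\<close>, where
  \<open>J\<close> is the canonical form in \<open>GL\<^sub>n\<close> of modified type \<open>\<lambda>\<close>. The two structure constants are
  compared at \<open>n + 1\<close> and \<open>n\<close>, respectively: with \<open>J\<close> now the canonical form of modified type
  \<open>\<nu>\<close>, the first one counts the pairs \<open>(A, B)\<close> of elements of
  modified types \<open>(\<lambda>, 0)\<close> and \<open>(\<mu>, 0)\<close> with \<open>A B = diag(1, J)\<close>, the second one the pairs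
  \<open>(g, h)\<close> of modified types \<open>\<lambda>\<close> and \<open>\<mu>\<close> with \<open>g h = J\<close>. The map
  \<open>(g, h) \<mapsto> (diag(1, g), diag(1, h))\<close> is a bijection between the two sets, and the only
  point that is not formal is its surjectivity.

  The size of a modified type is the codimension of the space of fixed vectors. Every
  vector fixed by \<open>A\<close> and \<open>B\<close> is fixed by \<open>A B\<close>, and the codimension of
  \<open>ker(A - 1) \<inter> ker(B - 1)\<close> is at most the sum of the two codimensions; when the sizes add up,
  the two spaces \<open>ker(A - 1) \<inter> ker(B - 1)\<close> and \<open>ker(A B - 1)\<close> therefore coincide
  (\<open>fixed_vecs_mult_subset\<close>). As \<open>diag(1, J)\<close> fixes the first unit vector, so do \<open>A\<close> and \<open>B\<close>,
  which means that they are themselves of the form \<open>diag(1, g)\<close>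
  (\<open>p_coeff_eq_a_coeff\<close>). Over a finite field, dimensions can be replaced by cardinalities.

  This argument needs that types are what they should be. Two matrices with isomorphic
  modules are conjugate (\<open>iso_modules_conjugate\<close>), the canonical form of a type has that
  type (\<open>J_mat_iso\<close>), and a modified type together with the size of the matrix determines the type
  (\<open>modify_inj\<close>); so the sums \<open>K\<close> and \<open>P\<close> are class sums, and they are nonzero for
  corresponding sizes. The substantial part is that the block matrix \<open>J\<^sub>m(f)\<close>, with identity
  matrices above the diagonal blocks, has a module isomorphic to \<open>F\<^sub>q[t]/(f\<^sup>m)\<close>. This uses that
  irreducible polynomials over a finite field are separable (\<open>jordan_block_iso\<close>).

  Both constants are defined as the unique common value of a family of coefficients. As the
  coefficient at \<open>n + 1\<close> of one family is the coefficient at \<open>n\<close> of the other, and as both are subject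
  to the same condition of being defined, the two descriptions agree.
\<close>

section \<open>Class sums in the group ring of a finite group\<close>

lemma (in group) conj_class_self:
  assumes "a \<in> carrier G"
  shows "a \<in> conj_class G a"
proof -
  have "a = \<one> \<otimes> a \<otimes> inv \<one>" using assms by simp
  then show ?thesis unfolding conj_class_def by blast
qed

lemma (in group) conj_class_closed:
  assumes "a \<in> carrier G"
  shows "conj_class G a \<subseteq> carrier G"
  using assms unfolding conj_class_def by auto

lemma (in group) conj_conj:
  assumes "a \<in> carrier G" "h \<in> carrier G" "k \<in> carrier G"
  shows "h \<otimes> (k \<otimes> a \<otimes> inv k) \<otimes> inv h = (h \<otimes> k) \<otimes> a \<otimes> inv (h \<otimes> k)"
  using assms by (simp add: inv_mult_group m_assoc)

lemma (in group) conj_mult: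
  assumes "a \<in> carrier G" "b \<in> carrier G" "h \<in> carrier G"
  shows "(h \<otimes> a \<otimes> inv h) \<otimes> (h \<otimes> b \<otimes> inv h) = h \<otimes> (a \<otimes> b) \<otimes> inv h"
proof -
  have "(h \<otimes> a \<otimes> inv h) \<otimes> (h \<otimes> b \<otimes> inv h) = h \<otimes> a \<otimes> (inv h \<otimes> h) \<otimes> b \<otimes> inv h"
    using assms by (simp only: m_assoc m_closed inv_closed)
  then show ?thesis using assms by (simp add: m_assoc)
qed

lemma (in group) conj_class_eq:
  assumes a: "a \<in> carrier G" and b: "b \<in> conj_class G a"
  shows "conj_class G b = conj_class G a"
proof -
  obtain k where k: "k \<in> carrier G" "b = k \<otimes> a \<otimes> inv k"
    using b unfolding conj_class_def by blast
  have unconj: "a = inv k \<otimes> b \<otimes> inv (inv k)"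
    using k a conj_conj[of a "inv k" k] by simp
  show ?thesis
  proof
    have "h \<otimes> b \<otimes> inv h = (h \<otimes> k) \<otimes> a \<otimes> inv (h \<otimes> k)" if "h \<in> carrier G" for h
      using that k(1) a unfolding k(2) by (intro conj_conj)
    then show "conj_class G b \<subseteq> conj_class G a"
      using k(1) unfolding conj_class_def by blast
    have "b \<in> carrier G" using k a by simp
    then have "h \<otimes> a \<otimes> inv h = (h \<otimes> inv k) \<otimes> b \<otimes> inv (h \<otimes> inv k)" if "h \<in> carrier G" for h
      using that k(1) conj_conj[of b h "inv k"] arg_cong[OF unconj, of "\<lambda>a. h \<otimes> a \<otimes> inv h"] by simp
    then show "conj_class G a \<subseteq> conj_class G b"
      using k(1) unfolding conj_class_def by blast
  qed
qed

text \<open>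
  Class sums have disjoint supports, so the coefficient of the class sum of \<open>a\<close> in any expansion of
  \<open>x\<close> is the value \<open>x a\<close>; conversely, a conjugation invariant function that vanishes outside the group
  has an expansion, with these coefficients.
\<close>

lemma (in group) class_coeff_eq_value:
  assumes fin: "finite (carrier G)" and a: "a \<in> carrier G"
    and inv: "\<And>g h. g \<in> carrier G \<Longrightarrow> h \<in> carrier G \<Longrightarrow> x (h \<otimes> g \<otimes> inv h) = x g"
    and supp: "\<And>g. g \<notin> carrier G \<Longrightarrow> x g = 0"
  shows "class_coeff G x (set_sum (conj_class G a)) = x a"
proof -
  have finC: "finite (class_sums G)" using fin by (simp add: class_sums_def)
  have eval: "(\<Sum>b\<in>class_sums G. k b * b g) =
      (if g \<in> carrier G then k (set_sum (conj_class G g)) else 0)" for k g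
  proof -
    have val: "b g = (if g \<in> carrier G \<and> b = set_sum (conj_class G g) then 1 else 0)"
      if b: "b \<in> class_sums G" for b
    proof -
      obtain c where c: "c \<in> carrier G" "b = set_sum (conj_class G c)"
        using b unfolding class_sums_def by blast
      show ?thesis
      proof (cases "g \<in> conj_class G c")
        case True
        then have "g \<in> carrier G" "conj_class G g = conj_class G c"
          using conj_class_closed[OF c(1)] conj_class_eq[OF c(1)] by auto
        then show ?thesis using True c by (simp add: set_sum_def)
      next
        case False
        then have "b g = 0" using c by (simp add: set_sum_def)
        moreover have "b \<noteq> set_sum (conj_class G g)" if "g \<in> carrier G"
          using conj_class_self[OF that] \<open>b g = 0\<close> by (auto simp: set_sum_def)
        ultimately show ?thesis by auto
      qed
    qed
    show ?thesis
    proof (cases "g \<in> carrier G")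
      case True
      then have mem: "set_sum (conj_class G g) \<in> class_sums G" by (simp add: class_sums_def)
      have "(\<Sum>b\<in>class_sums G. k b * b g) =
          (\<Sum>b\<in>class_sums G. if b = set_sum (conj_class G g) then k b else 0)"
        by (rule sum.cong[OF refl], subst val) (use True in auto)
      then show ?thesis using True mem finC by (simp add: sum.delta)
    next
      case False
      then show ?thesis using val by (intro trans[OF sum.neutral]) simp_all
    qed
  qed
  \<comment> \<open>A coefficient is read off at an arbitrary representative of the class.\<close>
  define k where "k = (\<lambda>b. x (SOME g. g \<in> carrier G \<and> b = set_sum (conj_class G g)))"
  have k: "k (set_sum (conj_class G g)) = x g" if g: "g \<in> carrier G" for g
  proof -
    define g' where "g' = (SOME g'. g' \<in> carrier G \<and> set_sum (conj_class G g) = set_sum (conj_class G g'))"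
    have g': "g' \<in> carrier G" "set_sum (conj_class G g) = set_sum (conj_class G g')"
      using someI_ex[of "\<lambda>g'. g' \<in> carrier G \<and> set_sum (conj_class G g) = set_sum (conj_class G g')"]
        g unfolding g'_def by blast+
    have "set_sum (conj_class G g') g' = 1"
      using conj_class_self[OF g'(1)] by (simp add: set_sum_def)
    then have "g' \<in> conj_class G g"
      using g'(2) by (metis set_sum_def zero_neq_one)
    then obtain h where "h \<in> carrier G" "g' = h \<otimes> g \<otimes> inv h"
      unfolding conj_class_def by blast
    then show ?thesis using inv[OF g, of h] unfolding k_def g'_def[symmetric] by simp
  qed
  have "x = (\<lambda>g. \<Sum>b\<in>class_sums G. k b * b g)"
    using k supp by (auto simp: eval fun_eq_iff)
  moreover have "k' (set_sum (conj_class G a)) = x a"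
    if "x = (\<lambda>g. \<Sum>b\<in>class_sums G. k' b * b g)" for k'
    using fun_cong[OF that, of a] a by (simp add: eval)
  ultimately show ?thesis
    unfolding class_coeff_def using k[OF a] by (intro the_equality exI[of _ k] conjI) blast+
qed

lemma (in group) grp_ring_mult_conj_invariant:
  assumes g: "g \<in> carrier G" and h: "h \<in> carrier G"
    and x: "\<And>g h. g \<in> carrier G \<Longrightarrow> h \<in> carrier G \<Longrightarrow> x (h \<otimes> g \<otimes> inv h) = x g"
    and y: "\<And>g h. g \<in> carrier G \<Longrightarrow> h \<in> carrier G \<Longrightarrow> y (h \<otimes> g \<otimes> inv h) = y g"
  shows "grp_ring_mult G x y (h \<otimes> g \<otimes> inv h) = grp_ring_mult G x y g"
proof -
  have undo: "inv h \<otimes> (h \<otimes> a \<otimes> inv h) \<otimes> inv (inv h) = a"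
       "h \<otimes> (inv h \<otimes> a \<otimes> inv (inv h)) \<otimes> inv h = a" if "a \<in> carrier G" for a
    using that h by (simp_all only: conj_conj inv_closed) simp_all
  have moved: "x (inv h \<otimes> a \<otimes> h) = x a" "y (inv h \<otimes> a \<otimes> h) = y a" if "a \<in> carrier G" for a
    using x[OF that, of "inv h"] y[OF that, of "inv h"] h by simp_all
  have to: "inv h \<otimes> a \<otimes> h \<otimes> (inv h \<otimes> b \<otimes> h) = g"
    if "a \<in> carrier G" "b \<in> carrier G" "a \<otimes> b = h \<otimes> g \<otimes> inv h" for a b
    using that h g conj_mult[of a b "inv h"] undo(1)[of g] by simp
  show ?thesis unfolding grp_ring_mult_def
    by (rule sum.reindex_bij_witness[where
          i = "\<lambda>(a, b). (h \<otimes> a \<otimes> inv h, h \<otimes> b \<otimes> inv h)"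
          and j = "\<lambda>(a, b). (inv h \<otimes> a \<otimes> h, inv h \<otimes> b \<otimes> h)"])
      (use h g undo in \<open>auto simp: conj_mult x y to moved\<close>)
qed

text \<open>
  The form in which structure constants are used below: they count factorisations of a representative.
\<close>

lemma (in group) class_coeff_mult_eq_card:
  assumes fin: "finite (carrier G)" and S: "S \<subseteq> carrier G" and T: "T \<subseteq> carrier G" and a: "a \<in> carrier G"
    and S_conj: "\<And>g h. g \<in> S \<Longrightarrow> h \<in> carrier G \<Longrightarrow> h \<otimes> g \<otimes> inv h \<in> S"
    and T_conj: "\<And>g h. g \<in> T \<Longrightarrow> h \<in> carrier G \<Longrightarrow> h \<otimes> g \<otimes> inv h \<in> T"
  shows "class_coeff G (grp_ring_mult G (set_sum S) (set_sum T)) (set_sum (conj_class G a)) =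
         int (card {(g, h). g \<in> S \<and> h \<in> T \<and> g \<otimes> h = a})"
proof -
  have iff: "h \<otimes> g \<otimes> inv h \<in> U \<longleftrightarrow> g \<in> U"
    if "g \<in> carrier G" "h \<in> carrier G" and U: "\<And>g h. g \<in> U \<Longrightarrow> h \<in> carrier G \<Longrightarrow> h \<otimes> g \<otimes> inv h \<in> U"
    for U g h
  proof
    assume "h \<otimes> g \<otimes> inv h \<in> U"
    from U[OF this, of "inv h"] show "g \<in> U"
      using that(1,2) conj_conj[of g "inv h" h] by simp
  qed (use that in blast)
  have inv: "set_sum U (h \<otimes> g \<otimes> inv h) = set_sum U g"
    if "g \<in> carrier G" "h \<in> carrier G" "\<And>g h. g \<in> U \<Longrightarrow> h \<in> carrier G \<Longrightarrow> h \<otimes> g \<otimes> inv h \<in> U"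
    for U g h
    using iff[OF that] by (simp add: set_sum_def)
  have "class_coeff G (grp_ring_mult G (set_sum S) (set_sum T)) (set_sum (conj_class G a)) =
        grp_ring_mult G (set_sum S) (set_sum T) a"
  proof (rule class_coeff_eq_value[OF fin a])
    fix g h assume "g \<in> carrier G" "h \<in> carrier G"
    then show "grp_ring_mult G (set_sum S) (set_sum T) (h \<otimes> g \<otimes> inv h) =
        grp_ring_mult G (set_sum S) (set_sum T) g"
      using inv[OF _ _ S_conj] inv[OF _ _ T_conj] by (intro grp_ring_mult_conj_invariant) simp_all
  next
    fix g assume g: "g \<notin> carrier G"
    then have "{(a, b). a \<in> carrier G \<and> b \<in> carrier G \<and> a \<otimes> b = g} = {}" by auto
    then show "grp_ring_mult G (set_sum S) (set_sum T) g = 0"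
      unfolding grp_ring_mult_def by (simp only: sum.empty)
  qed
  also have "\<dots> = (\<Sum>p | fst p \<in> carrier G \<and> snd p \<in> carrier G \<and> fst p \<otimes> snd p = a.
      if fst p \<in> S \<and> snd p \<in> T then 1 else 0)"
    unfolding grp_ring_mult_def by (rule sum.cong) (auto simp: set_sum_def)
  also have "\<dots> = int (card ({p. fst p \<in> carrier G \<and> snd p \<in> carrier G \<and> fst p \<otimes> snd p = a}
       \<inter> {p. fst p \<in> S \<and> snd p \<in> T}))"
  proof -
    have "finite {p. fst p \<in> carrier G \<and> snd p \<in> carrier G \<and> fst p \<otimes> snd p = a}"
      by (rule finite_subset[of _ "carrier G \<times> carrier G"]) (use fin in auto)
    then show ?thesis by (simp add: sum.If_cases)
  qed
  also have "{p. fst p \<in> carrier G \<and> snd p \<in> carrier G \<and> fst p \<otimes> snd p = a}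
       \<inter> {p. fst p \<in> S \<and> snd p \<in> T} = {(g, h). g \<in> S \<and> h \<in> T \<and> g \<otimes> h = a}"
    using S T by auto
  finally show ?thesis .
qed

section \<open>Polynomials in a matrix acting on vectors\<close>

lemma mult_mat_zero_vec [simp]: "A \<in> carrier_mat m n \<Longrightarrow> A *\<^sub>v 0\<^sub>v n = 0\<^sub>v m"
  by (intro eq_vecI) auto

lemma zero_smult_vec [simp]: "v \<in> carrier_vec n \<Longrightarrow> (0::'a::semiring_1) \<cdot>\<^sub>v v = 0\<^sub>v n"
  by (intro eq_vecI) auto

lemma poly_act_0 [simp]: "poly_act n g 0 v = 0\<^sub>v n"
  by (simp add: poly_act_def)

lemma poly_act_pCons:
  assumes "g \<in> carrier_mat n n" "v \<in> carrier_vec n"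
  shows "poly_act n g (pCons a p) v = a \<cdot>\<^sub>v v + g *\<^sub>v poly_act n g p v"
proof (cases "a = 0 \<and> p = 0")
  case True
  then show ?thesis using assms by (simp add: poly_act_def)
next
  case False
  then show ?thesis by (auto simp: poly_act_def)
qed

lemma poly_act_closed [simp]:
  assumes "g \<in> carrier_mat n n" "v \<in> carrier_vec n"
  shows "poly_act n g p v \<in> carrier_vec n"
  by (induction p) (use assms in \<open>auto simp: poly_act_pCons\<close>)

lemma poly_act_add:
  assumes g: "g \<in> carrier_mat n n" and v: "v \<in> carrier_vec n"
  shows "poly_act n g (p + q) v = poly_act n g p v + poly_act n g q v"
proof (induction p arbitrary: q)
  case 0
  then show ?case using g v by simp
next
  case (pCons a p)
  obtain b r where q: "q = pCons b r" by (cases q)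
  have c [simp]: "poly_act n g p v \<in> carrier_vec n" "poly_act n g r v \<in> carrier_vec n"
    "g *\<^sub>v poly_act n g p v \<in> carrier_vec n" "g *\<^sub>v poly_act n g r v \<in> carrier_vec n"
    using g v by auto
  show ?case using g v unfolding q
    by (simp add: poly_act_pCons pCons.IH mult_add_distrib_mat_vec[OF g] add_smult_distrib_vec)
      (intro eq_vecI, auto)
qed

lemma poly_act_smult:
  assumes g: "g \<in> carrier_mat n n" and v: "v \<in> carrier_vec n"
  shows "poly_act n g (smult c p) v = c \<cdot>\<^sub>v poly_act n g p v"
  by (induction p) (use g v in \<open>auto simp: poly_act_pCons mult_mat_vec smult_add_distrib_vec smult_smult_assoc\<close>)

lemma poly_act_mult:
  assumes g: "g \<in> carrier_mat n n" and v: "v \<in> carrier_vec n"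
  shows "poly_act n g (p * q) v = poly_act n g p (poly_act n g q v)"
proof (induction p)
  case 0
  then show ?case by simp
next
  case (pCons a p)
  show ?case using g v
    by (simp add: poly_act_pCons poly_act_add poly_act_smult pCons.IH)
qed

lemma poly_act_const [simp]:
  assumes "g \<in> carrier_mat n n" "v \<in> carrier_vec n"
  shows "poly_act n g [:c:] v = c \<cdot>\<^sub>v v"
  using assms by (simp add: poly_act_pCons)

lemma poly_act_one [simp]:
  assumes "g \<in> carrier_mat n n" "v \<in> carrier_vec n"
  shows "poly_act n g 1 v = v"
  using assms by (simp add: one_pCons)

lemma poly_act_X [simp]:
  assumes "g \<in> carrier_mat n n" "v \<in> carrier_vec n"
  shows "poly_act n g [:0, 1:] v = g *\<^sub>v v"
  using assms by (simp add: poly_act_pCons)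

lemma poly_act_zero_vec [simp]:
  assumes "g \<in> carrier_mat n n"
  shows "poly_act n g p (0\<^sub>v n) = 0\<^sub>v n"
  by (induction p) (use assms in \<open>auto simp: poly_act_pCons\<close>)

lemma poly_act_minus:
  assumes g: "g \<in> carrier_mat n n" and v: "v \<in> carrier_vec n"
  shows "poly_act n g (p - q) v = poly_act n g p v - poly_act n g q v"
proof -
  have "poly_act n g (p - q) v = poly_act n g p v + poly_act n g (smult (-1) q) v"
    using poly_act_add[OF g v, of p "smult (-1) q"] by simp
  then show ?thesis using g v
    by (simp add: poly_act_smult[where c = "-1", simplified]) (intro eq_vecI, auto)
qed

text \<open>
  A matrix that intertwines \<open>g\<close> and \<open>h\<close> is linear over the polynomial ring.
\<close>

lemma poly_act_intertwine:
  assumes g: "g \<in> carrier_mat n n" and h: "h \<in> carrier_mat m m" and P: "P \<in> carrier_mat m n"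
    and comm: "P * g = h * P" and v: "v \<in> carrier_vec n"
  shows "P *\<^sub>v poly_act n g p v = poly_act m h p (P *\<^sub>v v)"
proof (induction p)
  case 0
  then show ?case using P by auto
next
  case (pCons a p)
  have Pv: "P *\<^sub>v v \<in> carrier_vec m" using P v by auto
  have "P *\<^sub>v (g *\<^sub>v poly_act n g p v) = h *\<^sub>v (P *\<^sub>v poly_act n g p v)"
    using g h P v comm assoc_mult_mat_vec[of P m n g n "poly_act n g p v"]
      assoc_mult_mat_vec[of h m m P n "poly_act n g p v"] by auto
  then show ?case
    using mult_add_distrib_mat_vec[OF P, of "a \<cdot>\<^sub>v v" "g *\<^sub>v poly_act n g p v"] g h P v Pv
    by (simp add: poly_act_pCons mult_mat_vec[OF P] pCons.IH)
qed

section \<open>Irreducible polynomials over finite fields\<close>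

text \<open>
  The ideal generated by \<open>u\<close> and \<open>f\<close> is generated by an element of least degree; this
  generator divides \<open>f\<close> but is not associated to it, hence is a unit.
\<close>

lemma irreducible_bezout:
  fixes f u :: "'a::field poly"
  assumes f: "irreducible f" and u: "\<not> f dvd u"
  obtains a b where "a * u + b * f = 1"
proof -
  define I where "I = {a * u + b * f | a b. True}"
  have f0: "f \<noteq> 0" using f by auto
  have fI: "f \<in> I" "u \<in> I"
    unfolding I_def by (auto intro: exI[of _ 0] exI[of _ 1])
  obtain g where g: "g \<in> I" "g \<noteq> 0" and min: "\<And>h. h \<in> I \<Longrightarrow> h \<noteq> 0 \<Longrightarrow> degree g \<le> degree h"
    using exists_least_lemma[of "\<lambda>n. \<exists>g. g \<in> I \<and> g \<noteq> 0 \<and> degree g = n"]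
    ex_has_least_nat[of "\<lambda>g. g \<in> I \<and> g \<noteq> 0" f degree] fI f0 by blast
  have dvd: "g dvd h" if h: "h \<in> I" for h
  proof -
    obtain a b a' b' where "g = a * u + b * f" "h = a' * u + b' * f"
      using g(1) h unfolding I_def by blast
    then have "h mod g = (a' - h div g * a) * u + (b' - h div g * b) * f"
      by (simp add: minus_div_mult_eq_mod[symmetric] algebra_simps)
    then have "h mod g \<in> I" unfolding I_def by blast
    then show ?thesis using min[of "h mod g"] degree_mod_less[OF g(2), of h]
      by (meson dvd_eq_mod_eq_0 leD)
  qed
  obtain k where k: "f = g * k" using dvd[OF fI(1)] by auto
  have "\<not> is_unit k"
  proof
    assume "is_unit k"
    then have "f dvd g" using k by (simp add: mult_unit_dvd_iff)
    then show False using dvd[OF fI(2)] u dvd_trans by blast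
  qed
  then have "is_unit g" using f k irreducibleD by blast
  then obtain l where "1 = g * l" by auto
  moreover obtain a b where "g = a * u + b * f" using g(1) unfolding I_def by blast
  ultimately have "(l * a) * u + (l * b) * f = 1" by (simp add: algebra_simps)
  then show ?thesis by (rule that)
qed

lemma irreducible_poly_prime_elem:
  fixes f :: "'a::field poly"
  assumes f: "irreducible f"
  shows "prime_elem f"
proof (rule prime_elemI)
  fix a b assume ab: "f dvd a * b"
  show "f dvd a \<or> f dvd b"
  proof (rule disjCI)
    assume "\<not> f dvd b"
    then obtain c d where "c * b + d * f = 1" using irreducible_bezout[OF f] by blast
    then have "a = c * (a * b) + a * d * f"
      by (metis (no_types, lifting) distrib_left mult.assoc mult.left_commute mult_1_right)
    then show "f dvd a" using ab by (metis dvd_add dvd_mult dvd_triv_right)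
  qed
qed (use f in \<open>auto simp: irreducible_def\<close>)

lemma irreducible_power_dvd_cancel:
  fixes f :: "'a::field poly"
  assumes f: "irreducible f" and r: "\<not> f dvd r" and dvd: "f ^ m dvd r * p"
  shows "f ^ m dvd p"
  using dvd
proof (induction m arbitrary: p)
  case 0
  then show ?case by simp
next
  case (Suc m)
  have "f dvd r * p" using Suc.prems by (metis dvd_mult_left power_Suc)
  then obtain p' where p: "p = f * p'"
    using irreducible_poly_prime_elem[OF f] r by (auto simp: prime_elem_dvd_mult_iff)
  have "f ^ m dvd r * p'"
  proof -
    have "f * f ^ m dvd f * (r * p')"
      using Suc.prems unfolding p by (simp add: mult.left_commute)
    moreover have "f \<noteq> 0" using f by auto
    ultimately show ?thesis by (simp only: dvd_mult_cancel_left) blast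
  qed
  then have "f ^ m dvd p'" by (rule Suc.IH)
  then show ?case unfolding p power_Suc by (rule mult_dvd_mono[OF dvd_refl])
qed

text \<open>
  Finite fields are perfect. For reasons of degree, \<open>f\<close> could only divide \<open>f'\<close> if \<open>f' = 0\<close>; then only
  exponents divisible by the characteristic \<open>p\<close> occur in \<open>f\<close>. As the Frobenius map is surjective,
  all coefficients are \<open>p\<close>-th powers, so that \<open>f\<close> is itself a \<open>p\<close>-th power.
\<close>

lemma irreducible_not_dvd_pderiv:
  fixes f :: "'q::{finite, field} poly"
  assumes f: "irreducible f"
  shows "\<not> f dvd pderiv f"
proof
  assume dvd: "f dvd pderiv f"
  define p where "p = CHAR('q)"
  have CHAR: "prime CHAR('q)"
    using prime_CHAR_semidom[where ?'a = 'q] finite_imp_CHAR_pos[where ?'a = 'q] by simp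
  have p: "prime p" "p > 1" using CHAR prime_gt_1_nat unfolding p_def by auto
  have deg: "degree f > 0"
    using f by (metis degree_0_id gr0I irreducible_def is_unit_iff_degree)
  have "degree (pderiv f) \<le> degree f - 1"
    by (rule degree_le) (auto simp: coeff_pderiv coeff_eq_0)
  then have "degree (pderiv f) < degree f" using deg by simp
  then have "pderiv f = 0"
    using dvd dvd_imp_degree_le not_le by blast
  then have zero: "coeff f i = 0" if "\<not> p dvd i" for i
  proof (cases i)
    case (Suc j)
    have "of_nat (Suc j) * coeff f (Suc j) = 0"
      using \<open>pderiv f = 0\<close> by (metis coeff_0 coeff_pderiv)
    moreover have "of_nat (Suc j) \<noteq> (0::'q)"
      using that Suc by (simp only: of_nat_eq_0_iff_char_dvd p_def not_False_eq_True)
    ultimately show ?thesis using Suc by simp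
  qed (use that in auto)
  have "inj (\<lambda>x::'q. x ^ p)"
  proof (rule injI)
    fix x y :: 'q assume "x ^ p = y ^ p"
    then have "(x - y) ^ p = 0"
      using freshmans_dream[OF CHAR p_def, of "x - y" y] by simp
    then show "x = y" by simp
  qed
  then have surj: "surj (\<lambda>x::'q. x ^ p)" by (simp add: finite_UNIV_inj_surj)
  \<comment> \<open>The polynomial whose \<open>p\<close>-th power is \<open>f\<close>; its coefficients are \<open>p\<close>-th roots.\<close>
  define h where "h = (\<Sum>i\<le>degree f. monom (inv_into UNIV (\<lambda>x::'q. x ^ p) (coeff f (p * i))) i)"
  have "h ^ p = (\<Sum>i\<le>degree f. monom (inv_into UNIV (\<lambda>x::'q. x ^ p) (coeff f (p * i))) i ^ p)"
    unfolding h_def using CHAR p_def by (intro freshmans_dream_sum) auto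
  also have "\<dots> = (\<Sum>i\<le>degree f. monom (coeff f (p * i)) (p * i))"
    using surj_f_inv_f[OF surj] by (simp add: monom_power mult.commute)
  also have "\<dots> = f"
  proof (rule poly_eqI)
    fix k
    show "coeff (\<Sum>i\<le>degree f. monom (coeff f (p * i)) (p * i)) k = coeff f k"
    proof (cases "p dvd k")
      case True
      then obtain i where i: "k = p * i" by auto
      have "coeff (\<Sum>i\<le>degree f. monom (coeff f (p * i)) (p * i)) k =
          (\<Sum>j\<le>degree f. if j = i then coeff f k else 0)"
        unfolding coeff_sum using p by (intro sum.cong) (auto simp: i)
      also have "\<dots> = coeff f k"
      proof (cases "i \<le> degree f")
        case False
        then have "k > degree f"
          using p unfolding i by (metis Suc_lessD le_less_trans less_imp_le_nat linorder_not_le mult_le_mono1 nat_mult_1)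
        then show ?thesis by (auto simp: coeff_eq_0)
      qed auto
      finally show ?thesis .
    next
      case False
      then have "coeff (\<Sum>i\<le>degree f. monom (coeff f (p * i)) (p * i)) k = 0"
        unfolding coeff_sum by (intro sum.neutral) (auto simp: coeff_monom)
      then show ?thesis using zero[OF False] by simp
    qed
  qed
  finally have "h ^ p = f" .
  then have "f = h * h ^ (p - 1)" using p(2) by (simp add: power_eq_if)
  then have "is_unit h \<or> is_unit (h ^ (p - 1))" using f irreducibleD by blast
  then have "is_unit h" using p(2) by (auto simp: is_unit_power_iff)
  then have "is_unit f" unfolding \<open>h ^ p = f\<close>[symmetric] by (simp add: is_unit_power_iff)
  then show False using f by (simp add: irreducible_def)
qed

section \<open>Cyclic modules\<close>

text \<open>
  The coset \<open>p + (g)\<close>. The elements of the quotient ring are handled as such cosets from here on, so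
  that everything about cyclic modules becomes a statement on divisibility.
\<close>

definition residue :: "'q::field poly \<Rightarrow> 'q poly \<Rightarrow> 'q poly set" where
  "residue g p = {h. g dvd h - p}"

lemma residue_eq_iff: "residue g p = residue g q \<longleftrightarrow> g dvd p - q"
proof
  assume "residue g p = residue g q"
  moreover have "p \<in> residue g p" by (simp add: residue_def)
  ultimately have "p \<in> residue g q" by simp
  then show "g dvd p - q" by (simp add: residue_def)
next
  assume g: "g dvd p - q"
  have "g dvd h - p \<longleftrightarrow> g dvd h - q" for h
    using dvd_add_left_iff[OF g, of "h - p"] by (simp only: add_diff_eq diff_add_cancel)
  then show "residue g p = residue g q" by (simp add: residue_def)
qed

lemma cring_poly_ring: "cring poly_ring"
proof -
  have "\<exists>y. x + y = 0" for x :: "'q::field poly" by (rule exI[of _ "- x"]) simp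
  then show ?thesis unfolding poly_ring_def
    by unfold_locales (auto simp: Units_def algebra_simps add.commute)
qed

lemma residue_coset: "PIdl\<^bsub>poly_ring\<^esub> g +>\<^bsub>poly_ring\<^esub> p = residue g p"
proof -
  have "h \<in> PIdl\<^bsub>poly_ring\<^esub> g +>\<^bsub>poly_ring\<^esub> p \<longleftrightarrow> (\<exists>x. h = x * g + p)" for h
    by (auto simp: a_r_coset_def' cgenideal_def poly_ring_def)
  also have "\<dots> h \<longleftrightarrow> g dvd h - p" for h
    by (auto simp: dvd_def algebra_simps)
  finally show ?thesis by (auto simp: residue_def)
qed

lemma cyclic_module_simps:
  "carrier (cyclic_module f m) = range (residue (f ^ m))"
  "\<zero>\<^bsub>cyclic_module f m\<^esub> = residue (f ^ m) 0"
  "residue (f ^ m) p \<oplus>\<^bsub>cyclic_module f m\<^esub> residue (f ^ m) q = residue (f ^ m) (p + q)"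
  "r \<odot>\<^bsub>cyclic_module f m\<^esub> residue (f ^ m) p = residue (f ^ m) (r * p)"
proof -
  interpret R: cring "poly_ring :: 'a poly ring" by (rule cring_poly_ring)
  have U: "x \<in> carrier poly_ring" for x :: "'a poly" by (simp add: poly_ring_def)
  interpret I: ideal "PIdl\<^bsub>poly_ring\<^esub> (f ^ m)" poly_ring
    by (rule R.cgenideal_ideal) (rule U)
  show "carrier (cyclic_module f m) = range (residue (f ^ m))"
    by (auto simp: cyclic_module_def Let_def FactRing_def A_RCOSETS_def' residue_coset U)
  have "PIdl\<^bsub>poly_ring\<^esub> (f ^ m) = residue (f ^ m) 0"
    by (auto simp: cgenideal_def poly_ring_def residue_def dvd_def mult.commute)
  then show "\<zero>\<^bsub>cyclic_module f m\<^esub> = residue (f ^ m) 0"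
    by (simp add: cyclic_module_def Let_def FactRing_def)
  show "residue (f ^ m) p \<oplus>\<^bsub>cyclic_module f m\<^esub> residue (f ^ m) q = residue (f ^ m) (p + q)"
    using I.a_rcos_sum[OF U U, of p q, unfolded residue_coset]
    by (simp add: cyclic_module_def Let_def FactRing_def poly_ring_def)
  show "r \<odot>\<^bsub>cyclic_module f m\<^esub> residue (f ^ m) p = residue (f ^ m) (r * p)"
    using I.rcoset_mult_add[OF U U, of r p]
    by (simp add: cyclic_module_def Let_def FactRing_def residue_coset) (simp add: poly_ring_def)
qed

lemma mat_module_simps [simp]:
  "carrier (mat_module n g) = carrier_vec n"
  "x \<oplus>\<^bsub>mat_module n g\<^esub> y = x + y"
  "p \<odot>\<^bsub>mat_module n g\<^esub> x = poly_act n g p x"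
  "\<zero>\<^bsub>mat_module n g\<^esub> = 0\<^sub>v n"
  by (simp_all add: mat_module_def)

lemma carrier_poly_ring [simp]: "carrier poly_ring = UNIV"
  by (simp add: poly_ring_def)

lemma bij_betw_vec_PiE:
  "bij_betw (\<lambda>v. \<lambda>i\<in>{..<n}. v $ i) (carrier_vec n) (\<Pi>\<^sub>E i\<in>{..<n}. (UNIV :: 'a set))"
  by (rule bij_betwI[where g = "vec n"]) (auto intro!: eq_vecI ext simp: PiE_def extensional_def)

lemma card_carrier_vec: "card (carrier_vec n :: 'a::finite vec set) = card (UNIV :: 'a set) ^ n"
  using bij_betw_same_card[OF bij_betw_vec_PiE[of n, where ?'a = 'a]] by (simp add: card_PiE)

lemma finite_carrier_vec: "finite (carrier_vec n :: 'a::finite vec set)"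
  using bij_betw_finite[OF bij_betw_vec_PiE[of n, where ?'a = 'a]] by (simp add: finite_PiE)

text \<open>
  A vector \<open>w\<close> whose annihilator is generated by \<open>f ^ m\<close>, of degree \<open>n\<close>, is a cyclic vector: the
  vectors \<open>p(A) w\<close> with \<open>degree p < n\<close> are pairwise distinct, so by counting they exhaust the space. The
  isomorphism maps a vector \<open>v\<close> to the set of all polynomials \<open>p\<close> with \<open>p(A) w = v\<close>, which is
  a coset.
\<close>

lemma cyclic_vector_iso:
  fixes A :: "'q::{finite, field} mat"
  assumes A: "A \<in> carrier_mat n n" and w: "w \<in> carrier_vec n"
    and deg: "degree (f ^ m) = n"
    and ann: "\<And>p. poly_act n A p w = 0\<^sub>v n \<longleftrightarrow> f ^ m dvd p"
  shows "module_isomorphic poly_ring (mat_module n A) (cyclic_module f m)"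
proof -
  let ?a = "\<lambda>p. poly_act n A p w"
  let ?\<phi> = "\<lambda>v. {p. ?a p = v}"
  have cl: "?a p \<in> carrier_vec n" for p using A w by simp
  have eq_iff: "?a p = ?a q \<longleftrightarrow> f ^ m dvd p - q" for p q
  proof -
    have "?a p = ?a q \<longleftrightarrow> ?a p - ?a q = 0\<^sub>v n"
      using cl[of p] cl[of q] by (auto simp: vec_eq_iff)
    also have "\<dots> \<longleftrightarrow> f ^ m dvd p - q"
      using ann[of "p - q"] by (simp add: poly_act_minus[OF A w])
    finally show ?thesis .
  qed
  have \<phi>_a: "?\<phi> (?a p) = residue (f ^ m) p" for p
    by (auto simp: residue_def eq_iff)
  have inj: "inj_on (\<lambda>u. ?a (\<Sum>i<n. monom (u $ i) i)) (carrier_vec n)"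
  proof (rule inj_onI)
    fix u v :: "'q vec" assume uv: "u \<in> carrier_vec n" "v \<in> carrier_vec n"
      "?a (\<Sum>i<n. monom (u $ i) i) = ?a (\<Sum>i<n. monom (v $ i) i)"
    let ?d = "\<Sum>i<n. monom (u $ i - v $ i) i"
    have coeff: "coeff ?d i = (if i < n then u $ i - v $ i else 0)" for i
      by (simp add: coeff_sum coeff_monom)
    have "f ^ m dvd ?d"
      using uv(3) unfolding eq_iff by (simp add: sum_subtractf[symmetric] diff_monom)
    moreover have "?d = 0 \<or> degree ?d < n"
    proof (cases "n = 0")
      case False
      then show ?thesis using degree_lessI[of ?d n] coeff by (simp add: degree_lessI)
    qed simp
    ultimately have "?d = 0" using deg dvd_imp_degree_le[of "f ^ m" ?d] by (meson leD)
    then have "\<And>i. i < n \<Longrightarrow> u $ i = v $ i" using coeff by (metis coeff_0 right_minus_eq)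
    then show "u = v" using uv by (intro eq_vecI) auto
  qed
  have onto: "\<exists>p. ?a p = v" if "v \<in> carrier_vec n" for v
  proof -
    have "(\<lambda>u. ?a (\<Sum>i<n. monom (u $ i) i)) ` carrier_vec n = carrier_vec n"
      using cl by (intro endo_inj_surj[OF finite_carrier_vec _ inj]) auto
    then show ?thesis using that by (metis (no_types, lifting) imageE)
  qed
  have "bij_betw ?\<phi> (carrier_vec n) (range (residue (f ^ m)))"
    unfolding bij_betw_def
  proof
    show "inj_on ?\<phi> (carrier_vec n)"
      using onto by (intro inj_onI) blast
    show "?\<phi> ` carrier_vec n = range (residue (f ^ m))"
    proof
      show "?\<phi> ` carrier_vec n \<subseteq> range (residue (f ^ m))"
        using onto by (auto simp: \<phi>_a[symmetric])
      show "range (residue (f ^ m)) \<subseteq> ?\<phi> ` carrier_vec n"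
        using cl by (auto simp: \<phi>_a[symmetric])
    qed
  qed
  moreover have "?\<phi> (x + y) = ?\<phi> x \<oplus>\<^bsub>cyclic_module f m\<^esub> ?\<phi> y"
    if "x \<in> carrier_vec n" "y \<in> carrier_vec n" for x y
  proof -
    obtain p q where "x = ?a p" "y = ?a q" using onto \<open>x \<in> _\<close> \<open>y \<in> _\<close> by metis
    then show ?thesis by (simp add: \<phi>_a cyclic_module_simps poly_act_add[OF A w, symmetric])
  qed
  moreover have "?\<phi> (poly_act n A r x) = r \<odot>\<^bsub>cyclic_module f m\<^esub> ?\<phi> x"
    if "x \<in> carrier_vec n" for r x
  proof -
    obtain p where "x = ?a p" using onto \<open>x \<in> _\<close> by metis
    then show ?thesis by (simp add: \<phi>_a cyclic_module_simps poly_act_mult[OF A w, symmetric])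
  qed
  ultimately show ?thesis
    unfolding module_isomorphic_def
    by (intro exI[of _ ?\<phi>]) (simp add: cyclic_module_simps)
qed

text \<open>
  The annihilator of \<open>w\<close> contains \<open>f ^ m\<close> but not \<open>f ^ (m - 1)\<close>, and the only such ideal is the one
  generated by \<open>f ^ m\<close>.
\<close>

lemma primary_cyclic_iso:
  fixes A :: "'q::{finite, field} mat"
  assumes A: "A \<in> carrier_mat n n" and f: "irreducible f" and deg: "degree f * m = n"
    and kill: "\<And>v. v \<in> carrier_vec n \<Longrightarrow> poly_act n A (f ^ m) v = 0\<^sub>v n"
    and w: "w \<in> carrier_vec n" "poly_act n A (f ^ (m - 1)) w \<noteq> 0\<^sub>v n"
  shows "module_isomorphic poly_ring (mat_module n A) (cyclic_module f m)"
proof (rule cyclic_vector_iso[OF A w(1)])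
  have "f \<noteq> 0" using f by auto
  then show "degree (f ^ m) = n" using deg by (simp add: degree_power_eq mult.commute)
  fix p
  show "poly_act n A p w = 0\<^sub>v n \<longleftrightarrow> f ^ m dvd p"
  proof
    assume "f ^ m dvd p"
    then obtain q where "p = q * f ^ m" by (metis dvd_def mult.commute)
    then show "poly_act n A p w = 0\<^sub>v n"
      using A w kill by (simp add: poly_act_mult)
  next
    assume p0: "poly_act n A p w = 0\<^sub>v n"
    show "f ^ m dvd p"
    proof (rule ccontr)
      assume not_dvd: "\<not> f ^ m dvd p"
      \<comment> \<open>The multiplicity of \<open>f\<close> in \<open>p\<close>. If it is less than \<open>m\<close>, then \<open>f ^ (m - 1) w\<close> is killed by \<open>f\<close> and by a polynomial that is coprime to \<open>f\<close>.\<close>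
      define k where "k = (GREATEST k. f ^ k dvd p)"
      have bound: "j \<le> m" if "f ^ j dvd p" for j
        using not_dvd that by (meson dvd_trans le_imp_power_dvd nat_le_linear)
      have k: "f ^ k dvd p" unfolding k_def
        by (rule GreatestI_nat[of _ 0 m]) (use bound in auto)
      have k_max: "\<not> f ^ Suc k dvd p"
        using Greatest_le_nat[of "\<lambda>k. f ^ k dvd p" "Suc k" m] bound unfolding k_def by fastforce
      have km: "k < m" using not_dvd k bound by (metis le_neq_implies_less)
      obtain u where u: "p = f ^ k * u" using k by auto
      have "\<not> f dvd u" using k_max u by (auto simp: mult.commute[of f])
      then obtain a b where ab: "a * u + b * f = 1" using irreducible_bezout[OF f] by blast
      define w' where "w' = poly_act n A (f ^ (m - 1)) w"
      have w': "w' \<in> carrier_vec n" using A w unfolding w'_def by simp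
      have "f ^ (m - 1 - k) * p = u * f ^ (m - 1)"
        using km unfolding u by (simp add: mult.assoc[symmetric] power_add[symmetric] mult.commute)
      then have "poly_act n A u w' = poly_act n A (f ^ (m - 1 - k)) (poly_act n A p w)"
        unfolding w'_def using A w by (simp only: poly_act_mult[symmetric])
      then have "poly_act n A u w' = 0\<^sub>v n" using p0 A by simp
      moreover have "poly_act n A f w' = 0\<^sub>v n"
        using kill[OF w(1)] km A w unfolding w'_def
        by (simp add: poly_act_mult[symmetric] power_eq_if)
      ultimately have "poly_act n A (a * u + b * f) w' = 0\<^sub>v n"
        using A w' by (simp add: poly_act_add poly_act_mult)
      then show False using ab A w' w unfolding w'_def by simp
    qed
  qed
qed

section \<open>The module of a generalised Jordan block\<close>

text \<open>
  The polynomial \<open>p(x + y)\<close> in \<open>F[x][y]\<close>, where \<open>x\<close> is \<open>[:[:0, 1:]:]\<close> and \<open>y\<close> is \<open>[:0, 1:]\<close>. On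
  row vectors, identified with \<open>F[x, y]/(f(x), y\<^sup>m)\<close>, the generalised Jordan block of \<open>f\<close> acts as
  multiplication by \<open>x + y\<close>: the companion matrix accounts for \<open>x\<close>, and the identity
  matrices above the diagonal for \<open>y\<close>.
\<close>

definition shift_poly :: "'a::comm_ring_1 poly \<Rightarrow> 'a poly poly" where
  "shift_poly p = fold_coeffs (\<lambda>a P. [:[:a:]:] + [:[:0, 1:], 1:] * P) p 0"

lemma shift_poly_pCons: "shift_poly (pCons a p) = [:[:a:]:] + [:[:0, 1:], 1:] * shift_poly p"
  by (cases "a = 0 \<and> p = 0") (auto simp: shift_poly_def)

lemma shift_poly_0 [simp]: "shift_poly 0 = 0"
  by (simp add: shift_poly_def)

text \<open>
  The beginning of the Taylor expansion \<open>p(x + y) = p(x) + y p'(x) + \<dots>\<close>.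
\<close>

lemma shift_poly_taylor:
  "\<exists>H. shift_poly p = [:p:] + [:0, 1:] * ([:pderiv p:] + [:0, 1:] * H)"
proof (induction p)
  case 0
  show ?case by (rule exI[of _ 0]) simp
next
  case (pCons a p)
  then obtain H where H: "shift_poly p = [:p:] + [:0, 1:] * ([:pderiv p:] + [:0, 1:] * H)" by blast
  have 1: "[:pCons a p:] = [:[:a:]:] + [:[:0, 1:]:] * [:p:]"
    by simp
  have 2: "[:pderiv (pCons a p):] = [:p:] + [:[:0, 1:]:] * [:pderiv p:]"
    by (simp add: pderiv_pCons)
  have 3: "[:[:0, 1:], 1:] = [:[:0, 1:]:] + ([:0, 1:] :: 'a poly poly)"
    by simp
  show ?case
    unfolding shift_poly_pCons H 1 2 3
    by (rule exI[of _ "[:pderiv p:] + [:[:0, 1:]:] * H + [:0, 1:] * H"]) (simp only: algebra_simps)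
qed

text \<open>
  Modulo \<open>p(x)\<close>, the polynomial \<open>p(x + y)\<close> is \<open>y G\<close>, where \<open>G\<close> has the constant term \<open>p'(x)\<close>. For a
  separable irreducible polynomial \<open>f\<close>, this shows at the same time that \<open>f(x + y)\<^sup>m\<close>
  vanishes in \<open>F[x, y]/(f(x), y\<^sup>m)\<close> and that the preceding power does not.
\<close>

lemma shift_poly_power:
  obtains Q G where "shift_poly p ^ k = [:p:] * Q + monom 1 k * G ^ k" "coeff G 0 = pderiv p"
proof -
  obtain H where H: "shift_poly p = [:p:] + [:0, 1:] * ([:pderiv p:] + [:0, 1:] * H)"
    using shift_poly_taylor by blast
  define G where "G = [:pderiv p:] + [:0, 1:] * H"
  have "\<exists>Q. shift_poly p ^ k = [:p:] * Q + ([:0, 1:] * G) ^ k"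
  proof (induction k)
    case 0
    show ?case by (rule exI[of _ 0]) simp
  next
    case (Suc k)
    then obtain Q where Q: "shift_poly p ^ k = [:p:] * Q + ([:0, 1:] * G) ^ k" by blast
    have "shift_poly p ^ Suc k = ([:p:] + [:0, 1:] * G) * ([:p:] * Q + ([:0, 1:] * G) ^ k)"
      unfolding power_Suc Q by (simp only: H G_def)
    then show ?case
      by (intro exI[of _ "[:p:] * Q + ([:0, 1:] * G) ^ k + [:0, 1:] * G * Q"])
        (simp only: algebra_simps power_Suc)
  qed
  moreover have "([:0, 1:] * G) ^ k = monom 1 k * G ^ k"
    unfolding power_mult_distrib by (simp add: monom_altdef)
  moreover have "coeff G 0 = pderiv p" by (simp add: G_def)
  ultimately show ?thesis using that by metis
qed

text \<open>
  The coordinates of the class of \<open>P\<close> in \<open>F[x, y]/(f(x), y\<^sup>m)\<close> with respect to the monomials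
  \<open>x\<^sup>i y\<^sup>j\<close>, where \<open>i < degree f\<close> and \<open>j < m\<close>; the exponent of \<open>y\<close> is the index of the block.
\<close>

definition block_coeffs :: "'q::field poly \<Rightarrow> nat \<Rightarrow> 'q poly poly \<Rightarrow> 'q vec" where
  "block_coeffs f m P = vec (degree f * m)
     (\<lambda>r. coeff (coeff P (r div degree f) mod f) (r mod degree f))"

lemma block_coeffs_carrier [simp]: "block_coeffs f m P \<in> carrier_vec (degree f * m)"
  by (simp add: block_coeffs_def)

lemma block_index_less:
  assumes "j < m" "i < (d::nat)"
  shows "j * d + i < d * m"
proof -
  have "(j + 1) * d \<le> m * d" using assms by (intro mult_le_mono1) simp
  then show ?thesis using assms by (simp add: mult.commute[of m])
qed

lemma index_block_coeffs:
  assumes "j < m" "i < degree f"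
  shows "block_coeffs f m P $ (j * degree f + i) = coeff (coeff P j mod f) i"
  using assms block_index_less[OF assms] by (simp add: block_coeffs_def)

lemma block_coeffs_add: "block_coeffs f m (P + Q) = block_coeffs f m P + block_coeffs f m Q"
  by (intro eq_vecI) (simp_all add: block_coeffs_def poly_mod_add_left)

lemma block_coeffs_smult: "block_coeffs f m ([:[:a:]:] * P) = a \<cdot>\<^sub>v block_coeffs f m P"
  by (intro eq_vecI) (simp_all add: block_coeffs_def mod_smult_left)

text \<open>
  Multiplication by \<open>x\<close> modulo \<open>f\<close> shifts the coefficients and replaces the leading monomial
  \<open>x ^ degree f\<close> by means of \<open>f\<close>; this is what the companion matrix describes.
\<close>

lemma coeff_X_mult_mod:
  fixes f p :: "'q::field poly"
  assumes f: "lead_coeff f = 1" "degree f > 0" and i: "i < degree f"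
  shows "coeff ([:0, 1:] * p mod f) i =
    (if i > 0 then coeff (p mod f) (i - 1) else 0) - coeff f i * coeff (p mod f) (degree f - 1)"
proof -
  let ?R = "p mod f" and ?d = "degree f"
  \<comment> \<open>The remainder of \<open>x p\<close>, as the degree drops below that of \<open>f\<close>.\<close>
  let ?S = "[:0, 1:] * ?R - smult (coeff ?R (?d - 1)) f"
  have f0: "f \<noteq> 0" using f by auto
  have R: "degree ?R < ?d \<or> ?R = 0" using degree_mod_less[OF f0, of p] by auto
  have top: "coeff ?S k = 0" if "k \<ge> ?d" for k
  proof (cases "k = ?d")
    case True
    then show ?thesis using f by (cases ?d) auto
  next
    case False
    then have "k > ?d" using that by simp
    then show ?thesis using R by (cases k) (auto simp: coeff_eq_0)
  qed
  have "?S = 0 \<or> degree ?S < ?d"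
    using top f(2) by (metis leading_coeff_0_iff not_le)
  then have "?S mod f = ?S" by (auto simp: mod_poly_less)
  moreover have "?S mod f = [:0, 1:] * p mod f"
  proof -
    have "[:0, 1:] * p - ?S = ([:0, 1:] * (p div f) + [:coeff ?R (?d - 1):]) * f"
      by (simp add: algebra_simps minus_mod_eq_mult_div[symmetric] )
    then have "f dvd [:0, 1:] * p - ?S" by (metis dvd_triv_right)
    then show ?thesis by (metis mod_eq_dvd_iff)
  qed
  ultimately have "[:0, 1:] * p mod f = ?S" by simp
  then show ?thesis by (cases i) (simp_all add: mult.commute)
qed

lemma gen_jordan_block_carrier [simp]:
  "gen_jordan_block f m \<in> carrier_mat (degree f * m) (degree f * m)"
  by (simp add: gen_jordan_block_def Let_def)

text \<open>
  The companion matrix reduces the multiples by \<open>x\<close> modulo \<open>f\<close> within each block, and the identity matrices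
  carry each block to the next one, as multiplication by \<open>y\<close> does.
\<close>

lemma transpose_jordan_block_coeffs:
  fixes f :: "'q::field poly"
  assumes f: "lead_coeff f = 1" "degree f > 0"
  shows "transpose_mat (gen_jordan_block f m) *\<^sub>v block_coeffs f m P =
         block_coeffs f m ([:[:0, 1:], 1:] * P)"
proof (rule eq_vecI)
  let ?d = "degree f" and ?k = "block_coeffs f m P"
  fix c assume "c < dim_vec (block_coeffs f m ([:[:0, 1:], 1:] * P))"
  then have c: "c < ?d * m" by (simp add: block_coeffs_def)
  let ?j = "c div ?d" and ?i = "c mod ?d"
  have c_eq: "c = ?j * ?d + ?i" by simp
  have i: "?i < ?d" using f by simp
  have j: "?j < m" using c f by (simp add: less_mult_imp_div_less mult.commute)
  \<comment> \<open>Column \<open>c\<close> has at most three nonzero entries: the one in the last row of the diagonal block, the one just above the diagonal within this block, and the one in the identity matrix above this block.\<close>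
  have entry: "gen_jordan_block f m $$ (r, c) =
      (if r = ?j * ?d + (?d - 1) then - coeff f ?i else 0)
      + (if r = c - 1 then if ?i > 0 then 1 else 0 else 0)
      + (if r = c - ?d then if ?j > 0 then 1 else 0 else 0)" if r: "r < ?d * m" for r
  proof -
    have r_eq: "r = (r div ?d) * ?d + r mod ?d" by simp
    have ri: "r mod ?d < ?d" using f by simp
    have decomp: "r = a * ?d + b \<longleftrightarrow> r div ?d = a \<and> r mod ?d = b" if "b < ?d" for a b
      using that r_eq by (metis add.commute add_cancel_right_right div_less div_mult_self3 less_nat_zero_code mod_less mod_mult_self3)
    have 1: "r = ?j * ?d + (?d - 1) \<longleftrightarrow> r div ?d = ?j \<and> r mod ?d = ?d - 1"
      by (rule decomp) (use f in simp)
    have 2: "r = c - 1 \<and> ?i > 0 \<longleftrightarrow> r div ?d = ?j \<and> ?i = r mod ?d + 1"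
    proof (cases "?i > 0")
      case True
      then have "c - 1 = ?j * ?d + (?i - 1)" using c_eq by linarith
      then show ?thesis using decomp[of "?i - 1" ?j] i True by auto
    qed auto
    have 3: "r = c - ?d \<and> ?j > 0 \<longleftrightarrow> ?j = r div ?d + 1 \<and> r mod ?d = ?i"
    proof (cases "?j > 0")
      case True
      then have "?j * ?d = (?j - 1) * ?d + ?d" by (cases ?j) auto
      then have "c - ?d = (?j - 1) * ?d + ?i" using c_eq by linarith
      then show ?thesis using decomp[of ?i "?j - 1"] i True by auto
    qed auto
    have "gen_jordan_block f m $$ (r, c) =
        (if r div ?d = ?j \<and> r mod ?d = ?d - 1 then - coeff f ?i else 0)
      + (if r div ?d = ?j \<and> ?i = r mod ?d + 1 then 1 else 0)
      + (if ?j = r div ?d + 1 \<and> r mod ?d = ?i then 1 else 0)"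
      using r c ri less_imp_neq[OF i] by (auto simp: gen_jordan_block_def companion_def Let_def)
    then show ?thesis unfolding 1[symmetric] 2[symmetric] 3[symmetric] by auto
  qed
  have "(transpose_mat (gen_jordan_block f m) *\<^sub>v ?k) $ c =
      (\<Sum>r<?d * m. gen_jordan_block f m $$ (r, c) * ?k $ r)"
    using c carrier_matD[OF gen_jordan_block_carrier[of f m]]
    by (simp add: scalar_prod_def lessThan_atLeast0 block_coeffs_def)
  also have "\<dots> = (\<Sum>r<?d * m. (if r = ?j * ?d + (?d - 1) then - coeff f ?i * ?k $ r else 0)
      + (if r = c - 1 then (if ?i > 0 then 1 else 0) * ?k $ r else 0)
      + (if r = c - ?d then (if ?j > 0 then 1 else 0) * ?k $ r else 0))"
    by (rule sum.cong[OF refl]) (simp add: entry ring_distribs if_distrib[of "\<lambda>x. x * _"] cong: if_cong)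
  also have "\<dots> = - coeff f ?i * ?k $ (?j * ?d + (?d - 1))
      + (if ?i > 0 then 1 else 0) * ?k $ (c - 1) + (if ?j > 0 then 1 else 0) * ?k $ (c - ?d)"
  proof -
    have "?j * ?d + (?d - 1) < ?d * m" using block_index_less[OF j, of "?d - 1" ?d] f(2) by simp
    moreover have "c - 1 < ?d * m" "c - ?d < ?d * m" using c by simp_all
    ultimately show ?thesis by (simp only: sum.distrib sum.delta finite_lessThan lessThan_iff if_True)
  qed
  also have "?k $ (?j * ?d + (?d - 1)) = coeff (coeff P ?j mod f) (?d - 1)"
    by (rule index_block_coeffs[OF j]) (use f in simp)
  also have "(if ?i > 0 then 1 else 0) * ?k $ (c - 1) =
      (if ?i > 0 then coeff (coeff P ?j mod f) (?i - 1) else 0)"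
  proof (cases "?i > 0")
    case True
    then have e: "c - 1 = ?j * ?d + (?i - 1)" using c_eq by linarith
    have "?i - 1 < ?d" using i by simp
    from index_block_coeffs[OF j this] show ?thesis
      unfolding e using True by simp
  qed simp
  also have "(if ?j > 0 then 1 else 0) * ?k $ (c - ?d) =
      (if ?j > 0 then coeff (coeff P (?j - 1) mod f) ?i else 0)"
  proof (cases "?j > 0")
    case True
    then have "?j * ?d = (?j - 1) * ?d + ?d" by (cases ?j) auto
    then have e: "c - ?d = (?j - 1) * ?d + ?i" using c_eq by linarith
    have "?j - 1 < m" using j by simp
    from index_block_coeffs[OF this i] show ?thesis
      unfolding e using True by simp
  qed simp
  also have "- coeff f ?i * coeff (coeff P ?j mod f) (?d - 1)
      + (if ?i > 0 then coeff (coeff P ?j mod f) (?i - 1) else 0)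
      + (if ?j > 0 then coeff (coeff P (?j - 1) mod f) ?i else 0) =
      coeff (coeff ([:[:0, 1:], 1:] * P) ?j mod f) ?i"
  proof -
    have "coeff ([:[:0, 1:], 1:] * P) ?j = [:0, 1:] * coeff P ?j + (if ?j > 0 then coeff P (?j - 1) else 0)"
      by (cases ?j) (simp_all)
    then show ?thesis using coeff_X_mult_mod[OF f i, of "coeff P ?j"]
      by (simp add: poly_mod_add_left)
  qed
  also have "\<dots> = block_coeffs f m ([:[:0, 1:], 1:] * P) $ c"
    using c by (simp add: block_coeffs_def)
  finally show "(transpose_mat (gen_jordan_block f m) *\<^sub>v ?k) $ c =
      block_coeffs f m ([:[:0, 1:], 1:] * P) $ c" .
qed (simp add: block_coeffs_def gen_jordan_block_def Let_def)

text \<open>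
  By duality, the action on column vectors is determined by multiplication in \<open>F[x, y]\<close>.
\<close>

lemma poly_act_jordan_pairing:
  fixes f :: "'q::field poly"
  assumes f: "lead_coeff f = 1" "degree f > 0" and v: "v \<in> carrier_vec (degree f * m)"
  shows "poly_act (degree f * m) (gen_jordan_block f m) p v \<bullet> block_coeffs f m P =
         v \<bullet> block_coeffs f m (shift_poly p * P)"
proof (induction p arbitrary: P)
  case 0
  have "block_coeffs f m 0 = 0\<^sub>v (degree f * m)"
    by (intro eq_vecI) (simp_all add: block_coeffs_def)
  then show ?case using v by simp
next
  case (pCons a p)
  let ?n = "degree f * m" and ?J = "gen_jordan_block f m" and ?k = "block_coeffs f m"
  let ?w = "poly_act ?n ?J p v"
  have w: "?w \<in> carrier_vec ?n" using v by simp
  have "poly_act ?n ?J (pCons a p) v \<bullet> ?k P = a * (v \<bullet> ?k P) + (?J *\<^sub>v ?w) \<bullet> ?k P"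
    using v w by (simp add: poly_act_pCons add_scalar_prod_distrib[of _ ?n] mult_mat_vec_carrier[of _ ?n ?n])
  also have "(?J *\<^sub>v ?w) \<bullet> ?k P = ?w \<bullet> (transpose_mat ?J *\<^sub>v ?k P)"
    using transpose_vec_mult_scalar[of ?J ?n ?n ?w "?k P"] w
    by (simp add: comm_scalar_prod[of _ ?n] mult_mat_vec_carrier[of _ ?n ?n])
  also have "\<dots> = v \<bullet> ?k (shift_poly p * ([:[:0, 1:], 1:] * P))"
    unfolding transpose_jordan_block_coeffs[OF f] by (rule pCons.IH)
  also have "a * (v \<bullet> ?k P) + \<dots> = v \<bullet> (?k ([:[:a:]:] * P) + ?k (shift_poly p * ([:[:0, 1:], 1:] * P)))"
    using v by (simp only: block_coeffs_smult scalar_prod_add_distrib[of _ ?n] block_coeffs_carrier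
      smult_carrier_vec scalar_prod_smult_right) simp
  also have "\<dots> = v \<bullet> ?k (shift_poly (pCons a p) * P)"
    by (simp only: block_coeffs_add[symmetric] shift_poly_pCons algebra_simps)
  finally show ?case .
qed

lemma block_coeffs_eq_0_iff:
  fixes f :: "'q::field poly"
  assumes f: "degree f > 0"
  shows "block_coeffs f m P = 0\<^sub>v (degree f * m) \<longleftrightarrow> (\<forall>j<m. f dvd coeff P j)"
proof
  assume z: "block_coeffs f m P = 0\<^sub>v (degree f * m)"
  show "\<forall>j<m. f dvd coeff P j"
  proof (intro allI impI)
    fix j assume j: "j < m"
    have f0: "f \<noteq> 0" using f by auto
    have "coeff (coeff P j mod f) i = 0" for i
    proof (cases "i < degree f")
      case True
      have "(j + 1) * degree f \<le> m * degree f" using j by (intro mult_le_mono1) simp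
      then have "j * degree f + i < degree f * m" using True by (simp add: mult.commute[of m])
      then have "block_coeffs f m P $ (j * degree f + i) = coeff (coeff P j mod f) i"
        using True by (simp add: block_coeffs_def)
      then show ?thesis using z \<open>j * degree f + i < _\<close> by simp
    next
      case False
      then show ?thesis using degree_mod_less[OF f0, of "coeff P j"] by (auto intro: coeff_eq_0)
    qed
    then show "f dvd coeff P j" by (simp add: dvd_eq_mod_eq_0 poly_eq_iff)
  qed
next
  assume "\<forall>j<m. f dvd coeff P j"
  then show "block_coeffs f m P = 0\<^sub>v (degree f * m)"
    using f by (intro eq_vecI) (auto simp: block_coeffs_def dvd_eq_mod_eq_0 less_mult_imp_div_less mult.commute)
qed

lemma block_coeffs_monom:
  fixes f :: "'q::field poly"
  assumes r: "r < degree f * m"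
  shows "block_coeffs f m (monom (monom 1 (r mod degree f)) (r div degree f)) = unit_vec (degree f * m) r"
proof (rule eq_vecI)
  let ?d = "degree f"
  have d: "?d > 0" using r by (cases "?d = 0") auto
  have "degree (monom (1::'q) (r mod ?d)) < ?d" using d by (simp add: degree_monom_eq)
  then have m: "monom 1 (r mod ?d) mod f = monom 1 (r mod ?d)" by (rule mod_poly_less)
  fix c assume "c < dim_vec (unit_vec (?d * m) r)"
  then have c: "c < ?d * m" by simp
  have "c = r \<longleftrightarrow> r div ?d = c div ?d \<and> r mod ?d = c mod ?d" by (metis div_mult_mod_eq)
  then show "block_coeffs f m (monom (monom 1 (r mod ?d)) (r div ?d)) $ c = unit_vec (?d * m) r $ c"
    using c r by (auto simp: block_coeffs_def m coeff_monom)
qed (simp add: block_coeffs_def)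

text \<open>
  By the pairing, \<open>f(J) ^ k\<close> is adjoint to multiplication by \<open>f(x + y) ^ k\<close>. The latter is zero for
  \<open>k = m\<close>, whereas the coefficient of \<open>y ^ (m - 1)\<close> in \<open>f(x + y) ^ (m - 1)\<close> is \<open>(f') ^ (m - 1)\<close>
  modulo \<open>f\<close>, which is nonzero by separability. A vector that pairs nontrivially with this element is
  a cyclic vector.
\<close>

lemma jordan_block_iso:
  fixes f :: "'q::{finite, field} poly"
  assumes f: "irreducible f" "lead_coeff f = 1" and m: "m > 0"
  shows "module_isomorphic poly_ring (mat_module (degree f * m) (gen_jordan_block f m)) (cyclic_module f m)"
proof -
  let ?n = "degree f * m" and ?J = "gen_jordan_block f m"
  have d: "degree f > 0"
    using f by (metis degree_0_id gr0I irreducible_def is_unit_iff_degree)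
  have act: "poly_act ?n ?J (f ^ k) v \<bullet> block_coeffs f m P = v \<bullet> block_coeffs f m (shift_poly f ^ k * P)"
    if v: "v \<in> carrier_vec ?n" for k v P
  proof (induction k arbitrary: P)
    case 0
    then show ?case using v by simp
  next
    case (Suc k)
    have "poly_act ?n ?J (f ^ Suc k) v = poly_act ?n ?J f (poly_act ?n ?J (f ^ k) v)"
      using v by (simp add: poly_act_mult)
    then have "poly_act ?n ?J (f ^ Suc k) v \<bullet> block_coeffs f m P =
        poly_act ?n ?J (f ^ k) v \<bullet> block_coeffs f m (shift_poly f * P)"
      using poly_act_jordan_pairing[OF f(2) d] v by simp
    also have "\<dots> = v \<bullet> block_coeffs f m (shift_poly f ^ k * (shift_poly f * P))"
      by (rule Suc.IH)
    finally show ?case by (simp only: power_Suc mult_ac)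
  qed
  obtain Q G where QG: "shift_poly f ^ (m - 1) = [:f:] * Q + monom 1 (m - 1) * G ^ (m - 1)"
    "coeff G 0 = pderiv f" using shift_poly_power by metis
  have "coeff (G ^ k) 0 = pderiv f ^ k" for k
    by (induction k) (simp_all add: coeff_mult_0 QG(2))
  then have "coeff (shift_poly f ^ (m - 1)) (m - 1) = f * coeff Q (m - 1) + pderiv f ^ (m - 1)"
    unfolding QG(1) by (simp add: coeff_monom_mult)
  moreover have "\<not> f dvd pderiv f ^ (m - 1)"
    using irreducible_not_dvd_pderiv[OF f(1)] prime_elem_dvd_power[OF irreducible_poly_prime_elem[OF f(1)]]
    by blast
  ultimately have "\<not> f dvd coeff (shift_poly f ^ (m - 1)) (m - 1)"
    using dvd_add_right_iff[of f "f * coeff Q (m - 1)"] by simp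
  then have "block_coeffs f m (shift_poly f ^ (m - 1)) \<noteq> 0\<^sub>v ?n"
    unfolding block_coeffs_eq_0_iff[OF d] using m by (intro notI) (drule spec[of _ "m - 1"], simp)
  then obtain r where r: "r < ?n" "block_coeffs f m (shift_poly f ^ (m - 1)) $ r \<noteq> 0"
    by (metis (no_types, lifting) block_coeffs_carrier carrier_vecD eq_vecI index_zero_vec)
  show ?thesis
  proof (rule primary_cyclic_iso[where w = "unit_vec ?n r"])
    fix v :: "'q vec" assume v: "v \<in> carrier_vec ?n"
    obtain Q G where QG: "shift_poly f ^ m = [:f:] * Q + monom 1 m * G ^ m"
      using shift_poly_power[of f m] by metis
    have kill: "block_coeffs f m (shift_poly f ^ m * P) = 0\<^sub>v ?n" for P
    proof -
      have "shift_poly f ^ m * P = [:f:] * (Q * P) + monom 1 m * (G ^ m * P)"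
        unfolding QG by (simp only: algebra_simps)
      then have "f dvd coeff (shift_poly f ^ m * P) j" if "j < m" for j
        using that by (simp add: coeff_monom_mult)
      then show ?thesis using block_coeffs_eq_0_iff[OF d] by blast
    qed
    show "poly_act ?n ?J (f ^ m) v = 0\<^sub>v ?n"
    proof (rule eq_vecI)
      fix r assume "r < dim_vec (0\<^sub>v ?n)"
      then have r: "r < ?n" by simp
      have "poly_act ?n ?J (f ^ m) v $ r = poly_act ?n ?J (f ^ m) v \<bullet> unit_vec ?n r"
        using r v by (simp add: scalar_prod_right_unit)
      also have "\<dots> = 0"
        unfolding block_coeffs_monom[OF r, symmetric] act[OF v] kill using v by simp
      finally show "poly_act ?n ?J (f ^ m) v $ r = 0\<^sub>v ?n $ r" using r by simp
    qed (use v carrier_vecD[OF poly_act_closed] in auto)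
  next
    show "unit_vec ?n r \<in> carrier_vec ?n" by simp
    show "poly_act ?n ?J (f ^ (m - 1)) (unit_vec ?n r) \<noteq> 0\<^sub>v ?n"
    proof
      assume "poly_act ?n ?J (f ^ (m - 1)) (unit_vec ?n r) = 0\<^sub>v ?n"
      then have "unit_vec ?n r \<bullet> block_coeffs f m (shift_poly f ^ (m - 1) * 1) = 0"
        using act[of "unit_vec ?n r" "m - 1" 1] by simp
      then show False using r by (simp add: scalar_prod_left_unit[of _ ?n])
    qed
  qed (use f in auto)
qed

section \<open>The module of a canonical form\<close>

lemma module_isomorphic_trans:
  assumes "module_isomorphic R L M" "module_isomorphic R M N"
  shows "module_isomorphic R L N"
proof -
  obtain \<phi> where \<phi>: "bij_betw \<phi> (carrier L) (carrier M)"
    "\<And>x y. x \<in> carrier L \<Longrightarrow> y \<in> carrier L \<Longrightarrow> \<phi> (x \<oplus>\<^bsub>L\<^esub> y) = \<phi> x \<oplus>\<^bsub>M\<^esub> \<phi> y"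
    "\<And>r x. r \<in> carrier R \<Longrightarrow> x \<in> carrier L \<Longrightarrow> \<phi> (r \<odot>\<^bsub>L\<^esub> x) = r \<odot>\<^bsub>M\<^esub> \<phi> x"
    using assms(1) unfolding module_isomorphic_def by blast
  obtain \<psi> where \<psi>: "bij_betw \<psi> (carrier M) (carrier N)"
    "\<And>x y. x \<in> carrier M \<Longrightarrow> y \<in> carrier M \<Longrightarrow> \<psi> (x \<oplus>\<^bsub>M\<^esub> y) = \<psi> x \<oplus>\<^bsub>N\<^esub> \<psi> y"
    "\<And>r x. r \<in> carrier R \<Longrightarrow> x \<in> carrier M \<Longrightarrow> \<psi> (r \<odot>\<^bsub>M\<^esub> x) = r \<odot>\<^bsub>N\<^esub> \<psi> x"
    using assms(2) unfolding module_isomorphic_def by blast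
  have "\<phi> x \<in> carrier M" if "x \<in> carrier L" for x using \<phi>(1) that bij_betwE by metis
  then show ?thesis unfolding module_isomorphic_def
    using bij_betw_trans[OF \<phi>(1) \<psi>(1)] \<phi>(2,3) \<psi>(2,3) by (intro exI[of _ "\<psi> \<circ> \<phi>"]) simp
qed

lemma direct_sum_simps:
  assumes "finite I"
  shows "carrier (direct_sum I M) = (\<Pi>\<^sub>E i\<in>I. carrier (M i))"
    and "u \<oplus>\<^bsub>direct_sum I M\<^esub> v = (\<lambda>i\<in>I. u i \<oplus>\<^bsub>M i\<^esub> v i)"
    and "r \<odot>\<^bsub>direct_sum I M\<^esub> u = (\<lambda>i\<in>I. r \<odot>\<^bsub>M i\<^esub> u i)"
  using assms by (auto simp: direct_sum_def)

lemma direct_sum_reindex: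
  assumes fin: "finite I" "finite J" and h: "bij_betw h I J" and M: "\<And>i. i \<in> I \<Longrightarrow> M i = N (h i)"
  shows "module_isomorphic R (direct_sum I M) (direct_sum J N)"
proof -
  let ?k = "inv_into I h"
  have k: "?k j \<in> I" "h (?k j) = j" "M (?k j) = N j" if "j \<in> J" for j
    using that h M by (auto simp: bij_betw_def inv_into_into f_inv_into_f)
  have hk: "h i \<in> J" "?k (h i) = i" if "i \<in> I" for i
    using that h by (auto simp: bij_betw_def)
  have bij: "bij_betw (\<lambda>u. \<lambda>j\<in>J. u (?k j)) (\<Pi>\<^sub>E i\<in>I. carrier (M i)) (\<Pi>\<^sub>E j\<in>J. carrier (N j))"
  proof (rule bij_betwI[where g = "\<lambda>u. \<lambda>i\<in>I. u (h i)"])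
    show "(\<lambda>u. \<lambda>j\<in>J. u (?k j)) \<in> (\<Pi>\<^sub>E i\<in>I. carrier (M i)) \<rightarrow> (\<Pi>\<^sub>E j\<in>J. carrier (N j))"
      using k by (fastforce simp: PiE_iff)
    show "(\<lambda>u. \<lambda>i\<in>I. u (h i)) \<in> (\<Pi>\<^sub>E j\<in>J. carrier (N j)) \<rightarrow> (\<Pi>\<^sub>E i\<in>I. carrier (M i))"
      using hk M by (fastforce simp: PiE_iff)
  qed (use k hk in \<open>auto simp: fun_eq_iff PiE_iff extensional_def\<close>)
  show ?thesis unfolding module_isomorphic_def
    by (rule exI[of _ "\<lambda>u. \<lambda>j\<in>J. u (?k j)"])
      (use bij k in \<open>auto simp: direct_sum_simps fin fun_eq_iff\<close>)
qed

lemma poly_act_block: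
  assumes A: "A \<in> carrier_mat d d" and B: "B \<in> carrier_mat n n"
    and v: "v \<in> carrier_vec d" and w: "w \<in> carrier_vec n"
  shows "poly_act (d + n) (four_block_mat A (0\<^sub>m d n) (0\<^sub>m n d) B) p (v @\<^sub>v w) =
         poly_act d A p v @\<^sub>v poly_act n B p w"
proof (induction p)
  case 0
  show ?case by (intro eq_vecI) auto
next
  case (pCons a p)
  let ?D = "four_block_mat A (0\<^sub>m d n) (0\<^sub>m n d) B"
  let ?x = "poly_act d A p v" and ?y = "poly_act n B p w"
  have D: "?D \<in> carrier_mat (d + n) (d + n)" using A B by simp
  have c: "?x \<in> carrier_vec d" "?y \<in> carrier_vec n" "A *\<^sub>v ?x \<in> carrier_vec d" "B *\<^sub>v ?y \<in> carrier_vec n"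
    using A B v w by auto
  have "?D *\<^sub>v (?x @\<^sub>v ?y) = (A *\<^sub>v ?x + 0\<^sub>m d n *\<^sub>v ?y) @\<^sub>v (0\<^sub>m n d *\<^sub>v ?x + B *\<^sub>v ?y)"
    using A B c by (intro four_block_mat_mult_vec) auto
  also have "0\<^sub>m d n *\<^sub>v ?y = 0\<^sub>v d" using c by (auto intro!: eq_vecI)
  also have "0\<^sub>m n d *\<^sub>v ?x = 0\<^sub>v n" using c by (auto intro!: eq_vecI)
  also have "A *\<^sub>v ?x + 0\<^sub>v d = A *\<^sub>v ?x" using c by simp
  also have "0\<^sub>v n + B *\<^sub>v ?y = B *\<^sub>v ?y" using c by simp
  finally have mult: "?D *\<^sub>v (?x @\<^sub>v ?y) = (A *\<^sub>v ?x) @\<^sub>v (B *\<^sub>v ?y)" .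
  have smult: "a \<cdot>\<^sub>v (v @\<^sub>v w) = (a \<cdot>\<^sub>v v) @\<^sub>v (a \<cdot>\<^sub>v w)"
    using v w by (intro eq_vecI) auto
  have "poly_act (d + n) ?D (pCons a p) (v @\<^sub>v w) = a \<cdot>\<^sub>v (v @\<^sub>v w) + ?D *\<^sub>v (?x @\<^sub>v ?y)"
    using D v w by (simp add: poly_act_pCons pCons.IH)
  also have "\<dots> = (a \<cdot>\<^sub>v v + A *\<^sub>v ?x) @\<^sub>v (a \<cdot>\<^sub>v w + B *\<^sub>v ?y)"
    unfolding mult smult by (rule append_vec_add) (use c v w in auto)
  finally show ?case using A B v w by (simp add: poly_act_pCons)
qed

text \<open>
  A block diagonal matrix has the direct sum of the two modules; the summand of the first block is put
  in front, at index 0, so that lists of blocks can be treated by induction.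
\<close>

lemma block_module_iso:
  fixes A B :: "'q::field mat"
  assumes A: "A \<in> carrier_mat d d" and B: "B \<in> carrier_mat n n"
    and iso1: "module_isomorphic poly_ring (mat_module d A) (M 0)"
    and iso2: "module_isomorphic poly_ring (mat_module n B) (direct_sum {..<k} (\<lambda>i. M (Suc i)))"
  shows "module_isomorphic poly_ring (mat_module (d + n) (four_block_mat A (0\<^sub>m d n) (0\<^sub>m n d) B))
           (direct_sum {..<Suc k} M)"
proof -
  let ?D = "four_block_mat A (0\<^sub>m d n) (0\<^sub>m n d) B"
  obtain \<phi> where \<phi>: "bij_betw \<phi> (carrier_vec d) (carrier (M 0))"
    "\<And>x y. x \<in> carrier_vec d \<Longrightarrow> y \<in> carrier_vec d \<Longrightarrow> \<phi> (x + y) = \<phi> x \<oplus>\<^bsub>M 0\<^esub> \<phi> y"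
    "\<And>r x. x \<in> carrier_vec d \<Longrightarrow> \<phi> (poly_act d A r x) = r \<odot>\<^bsub>M 0\<^esub> \<phi> x"
    using iso1 unfolding module_isomorphic_def by auto
  obtain \<psi> where \<psi>: "bij_betw \<psi> (carrier_vec n) (\<Pi>\<^sub>E i\<in>{..<k}. carrier (M (Suc i)))"
    "\<And>x y. x \<in> carrier_vec n \<Longrightarrow> y \<in> carrier_vec n \<Longrightarrow>
       \<psi> (x + y) = (\<lambda>i\<in>{..<k}. \<psi> x i \<oplus>\<^bsub>M (Suc i)\<^esub> \<psi> y i)"
    "\<And>r x. x \<in> carrier_vec n \<Longrightarrow> \<psi> (poly_act n B r x) = (\<lambda>i\<in>{..<k}. r \<odot>\<^bsub>M (Suc i)\<^esub> \<psi> x i)"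
    using iso2 unfolding module_isomorphic_def by (auto simp: direct_sum_simps)
  define \<theta> where "\<theta> = (\<lambda>u. \<lambda>i\<in>{..<Suc k}. case i of 0 \<Rightarrow> \<phi> (vec_first u d) | Suc j \<Rightarrow> \<psi> (vec_last u n) j)"
  have split: "vec_first u d \<in> carrier_vec d" "vec_last u n \<in> carrier_vec n"
    "vec_first u d @\<^sub>v vec_last u n = u" if "u \<in> carrier_vec (d + n)" for u :: "'q vec"
    using that by simp_all
  have first_last: "vec_first (v @\<^sub>v w) d = v" "vec_last (v @\<^sub>v w) n = w"
    if "v \<in> carrier_vec d" "w \<in> carrier_vec n" for v w :: "'q vec"
    using that by (auto simp: vec_first_def vec_last_def intro!: eq_vecI)
  have \<theta>: "\<theta> (v @\<^sub>v w) = (\<lambda>i\<in>{..<Suc k}. case i of 0 \<Rightarrow> \<phi> v | Suc j \<Rightarrow> \<psi> w j)"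
    if "v \<in> carrier_vec d" "w \<in> carrier_vec n" for v w
    unfolding \<theta>_def by (simp add: first_last that)
  have bij: "bij_betw \<theta> (carrier_vec (d + n)) (\<Pi>\<^sub>E i\<in>{..<Suc k}. carrier (M i))"
  proof (rule bij_betwI[where
        g = "\<lambda>u. inv_into (carrier_vec d) \<phi> (u 0) @\<^sub>v inv_into (carrier_vec n) \<psi> (\<lambda>i\<in>{..<k}. u (Suc i))"])
    show "\<theta> \<in> carrier_vec (d + n) \<rightarrow> (\<Pi>\<^sub>E i\<in>{..<Suc k}. carrier (M i))"
    proof
      fix u :: "'q vec" assume u: "u \<in> carrier_vec (d + n)"
      have "\<psi> (vec_last u n) \<in> (\<Pi>\<^sub>E i\<in>{..<k}. carrier (M (Suc i)))"
        "\<phi> (vec_first u d) \<in> carrier (M 0)"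
        using bij_betwE[OF \<psi>(1)] bij_betwE[OF \<phi>(1)] split[OF u] by blast+
      then show "\<theta> u \<in> (\<Pi>\<^sub>E i\<in>{..<Suc k}. carrier (M i))"
        unfolding \<theta>_def by (auto simp: PiE_iff split: nat.split)
    qed
    have inv: "inv_into (carrier_vec d) \<phi> (u 0) \<in> carrier_vec d"
         "\<phi> (inv_into (carrier_vec d) \<phi> (u 0)) = u 0"
         "inv_into (carrier_vec n) \<psi> (\<lambda>i\<in>{..<k}. u (Suc i)) \<in> carrier_vec n"
         "\<psi> (inv_into (carrier_vec n) \<psi> (\<lambda>i\<in>{..<k}. u (Suc i))) = (\<lambda>i\<in>{..<k}. u (Suc i))"
      if u: "u \<in> (\<Pi>\<^sub>E i\<in>{..<Suc k}. carrier (M i))" for u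
    proof -
      have a: "u 0 \<in> carrier (M 0)" using u by auto
      have b: "(\<lambda>i\<in>{..<k}. u (Suc i)) \<in> (\<Pi>\<^sub>E i\<in>{..<k}. carrier (M (Suc i)))"
        using u by (auto simp: PiE_iff)
      show "inv_into (carrier_vec d) \<phi> (u 0) \<in> carrier_vec d"
         "\<phi> (inv_into (carrier_vec d) \<phi> (u 0)) = u 0"
        using a \<phi>(1) by (auto simp: bij_betw_def intro: inv_into_into f_inv_into_f)
      show "inv_into (carrier_vec n) \<psi> (\<lambda>i\<in>{..<k}. u (Suc i)) \<in> carrier_vec n"
        using b \<psi>(1) by (metis bij_betw_imp_surj_on inv_into_into)
      show "\<psi> (inv_into (carrier_vec n) \<psi> (\<lambda>i\<in>{..<k}. u (Suc i))) = (\<lambda>i\<in>{..<k}. u (Suc i))"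
        using b \<psi>(1) by (metis bij_betw_imp_surj_on f_inv_into_f)
    qed
    then show "(\<lambda>u. inv_into (carrier_vec d) \<phi> (u 0) @\<^sub>v inv_into (carrier_vec n) \<psi> (\<lambda>i\<in>{..<k}. u (Suc i)))
        \<in> (\<Pi>\<^sub>E i\<in>{..<Suc k}. carrier (M i)) \<rightarrow> carrier_vec (d + n)"
      by blast
    show "\<theta> (inv_into (carrier_vec d) \<phi> (u 0) @\<^sub>v inv_into (carrier_vec n) \<psi> (\<lambda>i\<in>{..<k}. u (Suc i))) = u"
      if u: "u \<in> (\<Pi>\<^sub>E i\<in>{..<Suc k}. carrier (M i))" for u
    proof -
      have "(\<lambda>i\<in>{..<Suc k}. case i of 0 \<Rightarrow> u 0 | Suc j \<Rightarrow> (\<lambda>i\<in>{..<k}. u (Suc i)) j) = u"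
        using u by (auto simp: fun_eq_iff PiE_iff extensional_def split: nat.split)
      then show ?thesis using inv[OF u] by (simp only: \<theta>)
    qed
    show "inv_into (carrier_vec d) \<phi> (\<theta> u 0) @\<^sub>v inv_into (carrier_vec n) \<psi> (\<lambda>i\<in>{..<k}. \<theta> u (Suc i)) = u"
      if u: "u \<in> carrier_vec (d + n)" for u
    proof -
      have "\<psi> (vec_last u n) \<in> (\<Pi>\<^sub>E i\<in>{..<k}. carrier (M (Suc i)))"
        using bij_betwE[OF \<psi>(1)] split(2)[OF u] by blast
      then have "(\<lambda>i\<in>{..<k}. \<theta> u (Suc i)) = \<psi> (vec_last u n)"
        unfolding \<theta>_def by (auto simp: fun_eq_iff PiE_iff extensional_def)
      moreover have "\<theta> u 0 = \<phi> (vec_first u d)" by (simp add: \<theta>_def)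
      ultimately show ?thesis
        using \<phi>(1) \<psi>(1) split[OF u] by (simp add: bij_betw_def)
    qed
  qed
  have add: "\<theta> (x + y) = (\<lambda>i\<in>{..<Suc k}. \<theta> x i \<oplus>\<^bsub>M i\<^esub> \<theta> y i)"
    if x: "x \<in> carrier_vec (d + n)" and y: "y \<in> carrier_vec (d + n)" for x y
  proof -
    let ?x1 = "vec_first x d" and ?x2 = "vec_last x n" and ?y1 = "vec_first y d" and ?y2 = "vec_last y n"
    have e: "x = ?x1 @\<^sub>v ?x2" "y = ?y1 @\<^sub>v ?y2" using split[OF x] split[OF y] by simp_all
    have "x + y = (?x1 + ?y1) @\<^sub>v (?x2 + ?y2)"
      using append_vec_add[OF split(1)[OF x] split(1)[OF y] split(2)[OF x] split(2)[OF y]] e by simp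
    then have "\<theta> (x + y) = (\<lambda>i\<in>{..<Suc k}. case i of 0 \<Rightarrow> \<phi> (?x1 + ?y1) | Suc j \<Rightarrow> \<psi> (?x2 + ?y2) j)"
      using \<theta>[of "?x1 + ?y1" "?x2 + ?y2"] split[OF x] split[OF y] by simp
    then show ?thesis unfolding \<theta>_def using split[OF x] split[OF y]
      by (auto simp: \<phi>(2) \<psi>(2) fun_eq_iff split: nat.split)
  qed
  have act: "\<theta> (poly_act (d + n) ?D r x) = (\<lambda>i\<in>{..<Suc k}. r \<odot>\<^bsub>M i\<^esub> \<theta> x i)"
    if x: "x \<in> carrier_vec (d + n)" for r x
  proof -
    let ?x1 = "vec_first x d" and ?x2 = "vec_last x n"
    have "poly_act (d + n) ?D r x = poly_act d A r ?x1 @\<^sub>v poly_act n B r ?x2"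
      using poly_act_block[OF A B split(1,2)[OF x], of r] split(3)[OF x] by simp
    then have "\<theta> (poly_act (d + n) ?D r x) =
        (\<lambda>i\<in>{..<Suc k}. case i of 0 \<Rightarrow> \<phi> (poly_act d A r ?x1) | Suc j \<Rightarrow> \<psi> (poly_act n B r ?x2) j)"
      using \<theta>[of "poly_act d A r ?x1" "poly_act n B r ?x2"] split[OF x] A B by simp
    then show ?thesis unfolding \<theta>_def using split[OF x]
      by (auto simp: \<phi>(3) \<psi>(3) fun_eq_iff split: nat.split)
  qed
  show ?thesis unfolding module_isomorphic_def
    by (rule exI[of _ \<theta>]) (use bij add act in \<open>auto simp: direct_sum_simps\<close>)
qed

definition jordan_blocks :: "('q::field poly \<times> nat) list \<Rightarrow> 'q mat" where
  "jordan_blocks xs = diag_block_mat (map (\<lambda>(f, m). gen_jordan_block f m) xs)"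

lemma jordan_blocks_carrier:
  "jordan_blocks xs \<in> carrier_mat (\<Sum>(f, m)\<leftarrow>xs. degree f * m) (\<Sum>(f, m)\<leftarrow>xs. degree f * m)"
proof (induction xs)
  case (Cons x xs)
  obtain f m where x: "x = (f, m)" by (cases x)
  have "dim_row (gen_jordan_block f m) = degree f * m" "dim_col (gen_jordan_block f m) = degree f * m"
    using gen_jordan_block_carrier[of f m] by (auto simp del: gen_jordan_block_carrier)
  then show ?case using Cons by (auto simp: jordan_blocks_def x Let_def)
qed (simp add: jordan_blocks_def)

lemma jordan_blocks_iso:
  fixes xs :: "('q::{finite, field} poly \<times> nat) list"
  assumes "\<And>f m. (f, m) \<in> set xs \<Longrightarrow> irreducible f \<and> lead_coeff f = 1 \<and> m > 0"
  shows "module_isomorphic poly_ring (mat_module (\<Sum>(f, m)\<leftarrow>xs. degree f * m) (jordan_blocks xs))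
    (direct_sum {..<length xs} (\<lambda>i. cyclic_module (fst (xs ! i)) (snd (xs ! i))))"
  using assms
proof (induction xs)
  case Nil
  have "bij_betw (\<lambda>u i. undefined :: 'q poly set) (carrier_vec 0 :: 'q vec set) {\<lambda>i::nat. undefined}"
    by (rule bij_betwI[where g = "\<lambda>_. 0\<^sub>v 0"]) (auto intro!: eq_vecI)
  then show ?case unfolding module_isomorphic_def
    by (intro exI[of _ "\<lambda>u i. undefined"]) (simp add: direct_sum_simps fun_eq_iff)
next
  case (Cons x xs)
  obtain f m where x: "x = (f, m)" by (cases x)
  let ?d = "degree f * m" and ?n = "\<Sum>(f, m)\<leftarrow>xs. degree f * m"
  have f: "irreducible f" "lead_coeff f = 1" "m > 0" using Cons.prems x by auto
  have "jordan_blocks (x # xs) =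
      four_block_mat (gen_jordan_block f m) (0\<^sub>m ?d ?n) (0\<^sub>m ?n ?d) (jordan_blocks xs)"
    using jordan_blocks_carrier[of xs] carrier_matD[OF gen_jordan_block_carrier[of f m]]
    by (auto simp: jordan_blocks_def x Let_def)
  moreover have "module_isomorphic poly_ring (mat_module ?d (gen_jordan_block f m))
      (cyclic_module (fst ((x # xs) ! 0)) (snd ((x # xs) ! 0)))"
    using jordan_block_iso[OF f] x by simp
  moreover have "module_isomorphic poly_ring (mat_module ?n (jordan_blocks xs))
      (direct_sum {..<length xs} (\<lambda>i. cyclic_module (fst ((x # xs) ! Suc i)) (snd ((x # xs) ! Suc i))))"
    unfolding nth_Cons_Suc by (rule Cons.IH) (rule Cons.prems, simp)
  ultimately show ?case
    using block_module_iso[OF gen_jordan_block_carrier jordan_blocks_carrier,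
        where M = "\<lambda>i. cyclic_module (fst ((x # xs) ! i)) (snd ((x # xs) ! i))"]
    by (simp only: x list.map list.size add_Suc_right add_0_right sum_list.Cons prod.case)
qed

lemma diag_block_mat_concat:
  "diag_block_mat (map diag_block_mat Ass) = diag_block_mat (concat Ass)"
  by (induction Ass) (simp_all add: diag_block_mat_append Let_def)

text \<open>
  The sizes of the blocks of the canonical form, in the order in which they occur there. Up to the order,
  these are the pairs \<open>(f, rho f ! i)\<close> that index the summands of the module of type \<open>rho\<close>.
\<close>

definition type_blocks :: "('q::field poly \<Rightarrow> nat list) \<Rightarrow> ('q poly \<times> nat) list" where
  "type_blocks rho =
     concat (map (\<lambda>i. replicate (count_list (rho t_minus_1) i) (t_minus_1, i))
       [1..<Suc (Max (insert 0 (set (rho t_minus_1))))])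
     @ concat (map (\<lambda>f. map (Pair f) (rho f)) (J_minus_support rho))"

lemma J_mat_eq_jordan_blocks: "J_mat rho = jordan_blocks (type_blocks rho)"
proof -
  let ?l = "[1..<Suc (Max (insert 0 (set (rho t_minus_1))))]"
  let ?gj = "\<lambda>(f, m). gen_jordan_block f m"
  have "J_mat rho = diag_block_mat (map diag_block_mat
      (map (\<lambda>i. replicate (count_list (rho t_minus_1) i) (gen_jordan_block t_minus_1 i)) ?l
       @ [concat (map (\<lambda>f. map (gen_jordan_block f) (rho f)) (J_minus_support rho))]))"
    unfolding J_mat_def J_minus_def by (simp add: E_block_def o_def del: upt_Suc cong: map_cong)
  also have "\<dots> = jordan_blocks (type_blocks rho)"
    unfolding diag_block_mat_concat jordan_blocks_def type_blocks_def
    by (simp add: map_concat o_def map_replicate del: upt_Suc)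
  finally show ?thesis .
qed

lemma mset_concat_replicate_count:
  fixes xs :: "nat list"
  assumes "0 \<notin> set xs" "\<And>x. x \<in> set xs \<Longrightarrow> x \<le> M"
  shows "mset (concat (map (\<lambda>i. replicate (count_list xs i) i) [1..<Suc M])) = mset xs"
proof (rule multiset_eqI)
  fix x
  have "count (mset (concat (map (\<lambda>i. replicate (count_list xs i) i) l))) x =
      (if x \<in> set l then count_list xs x else 0)" if "distinct l" for l
    using that by (induction l) auto
  from this[of "[1..<Suc M]"]
  have "count (mset (concat (map (\<lambda>i. replicate (count_list xs i) i) [1..<Suc M]))) x =
      (if x \<in> {1..M} then count_list xs x else 0)"
    by (simp add: atLeastLessThanSuc_atLeastAtMost del: upt_Suc)
  also have "\<dots> = count_list xs x"
    using assms by (metis (no_types, lifting) One_nat_def Suc_leI atLeastAtMost_iff count_list_0_iff gr0I)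
  finally show "count (mset (concat (map (\<lambda>i. replicate (count_list xs i) i) [1..<Suc M]))) x = count (mset xs) x"
    by (simp add: count_mset)
qed

lemma J_minus_support:
  assumes "rho \<in> PPhi"
  shows "distinct (J_minus_support rho)" "set (J_minus_support rho) = {f. rho f \<noteq> [] \<and> f \<noteq> t_minus_1}"
proof -
  have "finite {f. rho f \<noteq> [] \<and> f \<noteq> t_minus_1}"
    by (rule finite_subset[of _ "{f. rho f \<noteq> []}"]) (use assms in \<open>auto simp: PPhi_def\<close>)
  then have "\<exists>fs. distinct fs \<and> set fs = {f. rho f \<noteq> [] \<and> f \<noteq> t_minus_1}"
    using finite_distinct_list by metis
  from someI_ex[OF this] show "distinct (J_minus_support rho)"
    "set (J_minus_support rho) = {f. rho f \<noteq> [] \<and> f \<noteq> t_minus_1}"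
    unfolding J_minus_support_def by blast+
qed

lemma mset_type_blocks:
  assumes rho: "rho \<in> PPhi"
  shows "mset (type_blocks rho) =
    mset (concat (map (\<lambda>f. map (Pair f) (rho f)) (t_minus_1 # J_minus_support rho)))"
proof -
  let ?l = "[1..<Suc (Max (insert 0 (set (rho t_minus_1))))]"
  have "mset (concat (map (\<lambda>i. replicate (count_list (rho t_minus_1) i) i) ?l)) = mset (rho t_minus_1)"
    by (rule mset_concat_replicate_count) (use rho in \<open>auto simp: PPhi_def is_partition_def\<close>)
  then have "image_mset (Pair t_minus_1) (mset (concat (map (\<lambda>i. replicate (count_list (rho t_minus_1) i) i) ?l)))
      = image_mset (Pair t_minus_1) (mset (rho t_minus_1))" by (simp only:)
  then have "mset (concat (map (\<lambda>i. replicate (count_list (rho t_minus_1) i) (t_minus_1, i)) ?l))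
      = mset (map (Pair t_minus_1) (rho t_minus_1))"
    by (simp only: mset_map[symmetric] map_concat map_map o_def map_replicate)
  then show ?thesis by (simp add: type_blocks_def del: upt_Suc)
qed

lemma type_blocks_size:
  assumes rho: "rho \<in> PPhi"
  shows "(\<Sum>(f, m)\<leftarrow>type_blocks rho. degree f * m) = pnorm rho"
proof -
  let ?fs = "t_minus_1 # J_minus_support rho" and ?g = "\<lambda>(f, m). degree f * m"
  have dist: "distinct ?fs" using J_minus_support[OF rho] by simp
  have "sum_list (map ?g (type_blocks rho)) = sum_mset (image_mset ?g (mset (type_blocks rho)))"
    by (simp only: mset_map[symmetric] sum_mset_sum_list)
  also have "\<dots> = sum_list (map ?g (concat (map (\<lambda>f. map (Pair f) (rho f)) ?fs)))"
    unfolding mset_type_blocks[OF rho] by (simp only: mset_map[symmetric] sum_mset_sum_list)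
  also have "\<dots> = (\<Sum>f\<leftarrow>?fs. degree f * sum_list (rho f))"
  proof -
    have "sum_list (map ?g (concat (map (\<lambda>f. map (Pair f) (rho f)) fs))) = (\<Sum>f\<leftarrow>fs. degree f * sum_list (rho f))" for fs
      by (induction fs) (auto simp: o_def sum_list_const_mult)
    then show ?thesis by blast
  qed
  also have "\<dots> = (\<Sum>f\<in>set ?fs. degree f * sum_list (rho f))"
    using dist by (rule sum_list_distinct_conv_sum_set)
  also have "\<dots> = pnorm rho" unfolding pnorm_def
    by (rule sum.mono_neutral_right) (auto simp: J_minus_support[OF rho] List.finite_set[of "J_minus_support rho", unfolded J_minus_support(2)[OF rho]])
  finally show ?thesis .
qed

lemma finite_type_index: "rho \<in> PPhi \<Longrightarrow> finite {(f, i). f \<in> Phi \<and> i < length (rho f)}"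
proof -
  assume "rho \<in> PPhi"
  then have "finite (SIGMA f:{f. rho f \<noteq> []}. {..<length (rho f)})" by (auto simp: PPhi_def)
  then show ?thesis by (rule rev_finite_subset) auto
qed

lemma J_mat_carrier: "rho \<in> PPhi \<Longrightarrow> J_mat rho \<in> carrier_mat (pnorm rho) (pnorm rho)"
  using jordan_blocks_carrier[of "type_blocks rho"] by (simp add: J_mat_eq_jordan_blocks type_blocks_size)

text \<open>
  The blocks of the canonical form and the summands of the module are the same up to a permutation,
  which is turned into a bijection of the index sets.
\<close>

lemma J_mat_iso:
  fixes rho :: "'q::{finite, field} poly \<Rightarrow> nat list"
  assumes rho: "rho \<in> PPhi"
  shows "module_isomorphic poly_ring (mat_module (pnorm rho) (J_mat rho)) (type_module rho)"
proof -
  let ?fs = "t_minus_1 # J_minus_support rho" and ?S = "{(f, i). f \<in> Phi \<and> i < length (rho f)}"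
  let ?F = "\<lambda>(f, i). (f, rho f ! i)"
  \<comment> \<open>An enumeration of the index set of the module, ordered by polynomials as the blocks are.\<close>
  define ss where "ss = concat (map (\<lambda>f. map (Pair f) [0..<length (rho f)]) ?fs)"
  have "distinct (concat (map (\<lambda>f. map (Pair f) [0..<length (rho f)]) fs))" if "distinct fs" for fs
    using that by (induction fs) (auto simp: distinct_map inj_on_def)
  moreover have "distinct ?fs" using J_minus_support[OF rho] by simp
  ultimately have dist: "distinct ss" unfolding ss_def by blast
  have "f \<in> Phi \<and> i < length (rho f) \<longleftrightarrow> f \<in> set ?fs \<and> i < length (rho f)" for f i
    using rho by (auto simp: PPhi_def J_minus_support[OF rho])
  then have set_ss: "set ss = ?S" unfolding ss_def by auto
  have "map ?F (map (Pair f) [0..<length (rho f)]) = map (Pair f) (rho f)" for f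
    by (rule nth_equalityI) auto
  then have "map ?F ss = concat (map (\<lambda>f. map (Pair f) (rho f)) ?fs)"
    unfolding ss_def by (simp only: map_concat map_map o_def cong: map_cong)
  then have ms: "mset (type_blocks rho) = mset (map ?F ss)"
    using mset_type_blocks[OF rho] by simp
  then obtain p where p: "p permutes {..<length (map ?F ss)}" "permute_list p (map ?F ss) = type_blocks rho"
    by (rule mset_eq_permutation)
  let ?xs = "type_blocks rho"
  have len: "length ?xs = length ss" using arg_cong[OF p(2), of length] by simp
  define h where "h = (\<lambda>i. ss ! p i)"
  have pb: "bij_betw p {..<length ss} {..<length ss}" using p(1) permutes_imp_bij by simp
  have h: "bij_betw h {..<length ?xs} ?S"
    using bij_betw_trans[OF pb bij_betw_nth[OF dist refl refl]] by (simp add: h_def o_def len set_ss)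
  have xs: "?xs ! i = ?F (h i)" if "i < length ?xs" for i
  proof -
    have "p i < length ss" using bij_betwE[OF pb] that len by auto
    then show ?thesis using permute_list_nth[OF p(1)] that len p(2) unfolding h_def by simp
  qed
  have "module_isomorphic poly_ring
      (direct_sum {..<length ?xs} (\<lambda>i. cyclic_module (fst (?xs ! i)) (snd (?xs ! i)))) (type_module rho)"
    unfolding type_module_def
    by (rule direct_sum_reindex[OF finite_lessThan finite_type_index[OF rho] h])
      (auto simp: xs split: prod.split)
  moreover have "module_isomorphic poly_ring (mat_module (pnorm rho) (J_mat rho))
      (direct_sum {..<length ?xs} (\<lambda>i. cyclic_module (fst (?xs ! i)) (snd (?xs ! i))))"
  proof -
    have valid: "irreducible f \<and> lead_coeff f = 1 \<and> m > 0" if fm: "(f, m) \<in> set ?xs" for f m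
    proof -
      have "(f, m) \<in> ?F ` ?S" using fm mset_eq_setD[OF ms] set_ss by simp
      then obtain i where "f \<in> Phi" "i < length (rho f)" "m = rho f ! i" by auto
      moreover from this have "m \<noteq> 0" using rho unfolding PPhi_def is_partition_def by (metis (mono_tags, lifting) mem_Collect_eq nth_mem)
      ultimately show ?thesis by (simp add: Phi_def)
    qed
    show ?thesis using jordan_blocks_iso[of ?xs, OF valid]
      by (simp only: J_mat_eq_jordan_blocks type_blocks_size[OF rho])
  qed
  ultimately show ?thesis using module_isomorphic_trans by blast
qed

section \<open>Isomorphic modules and conjugate matrices\<close>

lemma carrier_GL: "A \<in> carrier (GL n) \<longleftrightarrow>
   A \<in> carrier_mat n n \<and> (\<exists>B\<in>carrier_mat n n. B * A = 1\<^sub>m n \<and> A * B = 1\<^sub>m n)"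
  by (auto simp: GL_def units_of_def Units_def ring_mat_simps)

lemma GL_simps [simp]:
  "A \<otimes>\<^bsub>GL n\<^esub> B = A * B" "\<one>\<^bsub>GL n\<^esub> = 1\<^sub>m n"
  by (simp_all add: GL_def units_of_def ring_mat_simps)

lemma GL_carrier_mat: "A \<in> carrier (GL n) \<Longrightarrow> A \<in> carrier_mat n n"
  by (simp add: carrier_GL)

lemma group_GL: "group (GL n :: 'q::field mat monoid)"
proof -
  interpret R: ring "ring_mat TYPE('q) n ()" by (rule ring_mat)
  show ?thesis unfolding GL_def by (rule R.units_group)
qed

lemma finite_carrier_GL: "finite (carrier (GL n :: 'q::{finite, field} mat monoid))"
proof -
  have "carrier_mat n n \<subseteq> (\<lambda>f. mat n n f) ` (\<Pi>\<^sub>E ij\<in>{..<n} \<times> {..<n}. (UNIV :: 'q set))"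
  proof
    fix A :: "'q mat" assume A: "A \<in> carrier_mat n n"
    have "A = mat n n (restrict (\<lambda>ij. A $$ ij) ({..<n} \<times> {..<n}))" using A by (intro eq_matI) auto
    moreover have "restrict (\<lambda>ij. A $$ ij) ({..<n} \<times> {..<n}) \<in> (\<Pi>\<^sub>E ij\<in>{..<n} \<times> {..<n}. (UNIV :: 'q set))"
      by (simp only: restrict_PiE_iff) blast
    ultimately show "A \<in> (\<lambda>f. mat n n f) ` (\<Pi>\<^sub>E ij\<in>{..<n} \<times> {..<n}. (UNIV :: 'q set))"
      by (rule image_eqI)
  qed
  then have "finite (carrier_mat n n :: 'q mat set)"
    by (rule finite_subset) (simp add: finite_PiE)
  then show ?thesis by (rule rev_finite_subset) (auto dest: GL_carrier_mat)
qed

text \<open>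
  Injectivity is what can be read off from the module: it says that \<open>t\<close> acts without kernel.
\<close>

lemma carrier_GL_iff_inj:
  "A \<in> carrier (GL n) \<longleftrightarrow>
   A \<in> carrier_mat n n \<and> (\<forall>v\<in>carrier_vec n. A *\<^sub>v v = 0\<^sub>v n \<longrightarrow> v = 0\<^sub>v n)"
proof
  assume A: "A \<in> carrier (GL n)"
  then obtain B where B: "A \<in> carrier_mat n n" "B \<in> carrier_mat n n" "B * A = 1\<^sub>m n"
    by (auto simp: carrier_GL)
  have "v = 0\<^sub>v n" if v: "v \<in> carrier_vec n" "A *\<^sub>v v = 0\<^sub>v n" for v
  proof -
    have "v = (B * A) *\<^sub>v v" using B v by simp
    also have "\<dots> = B *\<^sub>v (A *\<^sub>v v)" by (rule assoc_mult_mat_vec) (use B v in auto)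
    finally show ?thesis using B v by simp
  qed
  then show "A \<in> carrier_mat n n \<and> (\<forall>v\<in>carrier_vec n. A *\<^sub>v v = 0\<^sub>v n \<longrightarrow> v = 0\<^sub>v n)"
    using B by blast
next
  assume A: "A \<in> carrier_mat n n \<and> (\<forall>v\<in>carrier_vec n. A *\<^sub>v v = 0\<^sub>v n \<longrightarrow> v = 0\<^sub>v n)"
  then have "det A \<noteq> 0" using det_0_iff_vec_prod_zero_field[of A n] by auto
  from det_non_zero_imp_unit[OF _ this, of n "()"] A show "A \<in> carrier (GL n)"
    by (simp add: GL_def units_of_def)
qed

lemma mult_mat_unit_vec:
  fixes A :: "'a::comm_ring_1 mat"
  assumes "A \<in> carrier_mat n m" "i < n" "j < m"
  shows "(A *\<^sub>v unit_vec m j) $ i = A $$ (i, j)"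
  using assms by (simp add: scalar_prod_right_unit[of _ m])

lemma mat_eq_if_vec_eq:
  fixes A B :: "'a::comm_ring_1 mat"
  assumes A: "A \<in> carrier_mat n m" "B \<in> carrier_mat n m"
    and eq: "\<And>v. v \<in> carrier_vec m \<Longrightarrow> A *\<^sub>v v = B *\<^sub>v v"
  shows "A = B"
proof (rule eq_matI)
  fix i j assume "i < dim_row B" "j < dim_col B"
  then show "A $$ (i, j) = B $$ (i, j)"
    using mult_mat_unit_vec[OF A(1), of i j] mult_mat_unit_vec[OF A(2), of i j] A(2) eq by auto
qed (use A in auto)

lemma linear_map_matrix:
  fixes \<psi> :: "'q::field vec \<Rightarrow> 'q vec"
  assumes closed: "\<And>v. v \<in> carrier_vec n \<Longrightarrow> \<psi> v \<in> carrier_vec m"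
    and add: "\<And>v w. v \<in> carrier_vec n \<Longrightarrow> w \<in> carrier_vec n \<Longrightarrow> \<psi> (v + w) = \<psi> v + \<psi> w"
    and smult: "\<And>c v. v \<in> carrier_vec n \<Longrightarrow> \<psi> (c \<cdot>\<^sub>v v) = c \<cdot>\<^sub>v \<psi> v"
  obtains P where "P \<in> carrier_mat m n" "\<And>v. v \<in> carrier_vec n \<Longrightarrow> P *\<^sub>v v = \<psi> v"
proof
  define P where "P = mat m n (\<lambda>(i, j). \<psi> (unit_vec n j) $ i)"
  show P: "P \<in> carrier_mat m n" by (simp add: P_def)
  have unit: "P *\<^sub>v unit_vec n j = \<psi> (unit_vec n j)" if "j < n" for j
  proof (rule eq_vecI)
    fix i assume "i < dim_vec (\<psi> (unit_vec n j))"
    then have "i < m" using closed[of "unit_vec n j"] by simp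
    then show "(P *\<^sub>v unit_vec n j) $ i = \<psi> (unit_vec n j) $ i"
      using mult_mat_unit_vec[OF P, of i j] that by (simp add: P_def)
  qed (use P closed[of "unit_vec n j"] in auto)
  fix v :: "'q vec" assume v: "v \<in> carrier_vec n"
  \<comment> \<open>The truncations of \<open>v\<close>, which grow by one multiple of a unit vector at a time.\<close>
  define part where "part k = vec n (\<lambda>i. if i < k then v $ i else 0)" for k
  have part: "part k \<in> carrier_vec n" for k by (simp add: part_def)
  have "k \<le> n \<Longrightarrow> P *\<^sub>v part k = \<psi> (part k)" for k
  proof (induction k)
    case 0
    have "part 0 = 0 \<cdot>\<^sub>v part 0" by (intro eq_vecI) (simp_all add: part_def)
    then have "\<psi> (part 0) = 0 \<cdot>\<^sub>v \<psi> (part 0)" using smult[OF part, of 0 0] by simp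
    then have "\<psi> (part 0) = 0\<^sub>v m" by (rule trans) (rule zero_smult_vec[OF closed[OF part]])
    moreover have "part 0 = 0\<^sub>v n" by (intro eq_vecI) (simp_all add: part_def)
    ultimately show ?case using P by simp
  next
    case (Suc k)
    have step: "part (Suc k) = part k + v $ k \<cdot>\<^sub>v unit_vec n k"
      using Suc.prems by (intro eq_vecI) (auto simp: part_def less_Suc_eq)
    show ?case using Suc part P unfolding step
      by (simp add: mult_add_distrib_mat_vec[OF P] mult_mat_vec[OF P] add smult unit)
  qed
  moreover have "part n = v" using v by (intro eq_vecI) (auto simp: part_def)
  ultimately show "P *\<^sub>v v = \<psi> v" by force
qed

text \<open>
  Composing one isomorphism with the inverse of the other gives a linear bijection of the space of
  column vectors that commutes with the action of \<open>t\<close>; its matrix conjugates \<open>g\<close> into \<open>h\<close>.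
\<close>

lemma iso_modules_conjugate:
  fixes g h :: "'q::field mat"
  assumes g: "g \<in> carrier (GL n)" and h: "h \<in> carrier (GL n)"
    and isog: "module_isomorphic poly_ring (mat_module n g) T"
    and isoh: "module_isomorphic poly_ring (mat_module n h) T"
  shows "h \<in> conj_class (GL n) g"
proof -
  interpret group "GL n :: 'q mat monoid" by (rule group_GL)
  have gc: "g \<in> carrier_mat n n" and hc: "h \<in> carrier_mat n n"
    using g h GL_carrier_mat by auto
  obtain \<phi> where \<phi>: "bij_betw \<phi> (carrier_vec n) (carrier T)"
    "\<And>x y. x \<in> carrier_vec n \<Longrightarrow> y \<in> carrier_vec n \<Longrightarrow> \<phi> (x + y) = \<phi> x \<oplus>\<^bsub>T\<^esub> \<phi> y"
    "\<And>r x. x \<in> carrier_vec n \<Longrightarrow> \<phi> (poly_act n g r x) = r \<odot>\<^bsub>T\<^esub> \<phi> x"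
    using isog unfolding module_isomorphic_def by auto
  obtain \<theta> where \<theta>: "bij_betw \<theta> (carrier_vec n) (carrier T)"
    "\<And>x y. x \<in> carrier_vec n \<Longrightarrow> y \<in> carrier_vec n \<Longrightarrow> \<theta> (x + y) = \<theta> x \<oplus>\<^bsub>T\<^esub> \<theta> y"
    "\<And>r x. x \<in> carrier_vec n \<Longrightarrow> \<theta> (poly_act n h r x) = r \<odot>\<^bsub>T\<^esub> \<theta> x"
    using isoh unfolding module_isomorphic_def by auto
  define \<psi> where "\<psi> = (\<lambda>v. inv_into (carrier_vec n) \<theta> (\<phi> v))"
  have \<psi>: "\<psi> v \<in> carrier_vec n" "\<theta> (\<psi> v) = \<phi> v" if "v \<in> carrier_vec n" for v
  proof -
    have "\<phi> v \<in> \<theta> ` carrier_vec n" using \<phi>(1) \<theta>(1) that by (auto simp: bij_betw_def)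
    then show "\<psi> v \<in> carrier_vec n" "\<theta> (\<psi> v) = \<phi> v"
      unfolding \<psi>_def by (auto intro: inv_into_into f_inv_into_f)
  qed
  have \<theta>_inj: "x = y" if "\<theta> x = \<theta> y" "x \<in> carrier_vec n" "y \<in> carrier_vec n" for x y
    using \<theta>(1) that by (auto simp: bij_betw_def inj_on_def)
  have add: "\<psi> (x + y) = \<psi> x + \<psi> y" if "x \<in> carrier_vec n" "y \<in> carrier_vec n" for x y
    by (rule \<theta>_inj) (use that \<psi> \<phi>(2) \<theta>(2) in auto)
  have act: "\<psi> (poly_act n g r x) = poly_act n h r (\<psi> x)" if "x \<in> carrier_vec n" for r x
    by (rule \<theta>_inj) (use that \<psi> \<phi>(3) \<theta>(3) gc hc in auto)
  have smult: "\<psi> (c \<cdot>\<^sub>v x) = c \<cdot>\<^sub>v \<psi> x" if "x \<in> carrier_vec n" for c x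
    using act[OF that, of "[:c:]"] that \<psi> gc hc by simp
  obtain P where P: "P \<in> carrier_mat n n" "\<And>v. v \<in> carrier_vec n \<Longrightarrow> P *\<^sub>v v = \<psi> v"
    using linear_map_matrix[of n \<psi> n] \<psi>(1) add smult by metis
  have "v = 0\<^sub>v n" if v: "v \<in> carrier_vec n" "P *\<^sub>v v = 0\<^sub>v n" for v
  proof -
    have "\<psi> v = \<psi> (0\<^sub>v n)" using v P by (metis mult_mat_zero_vec zero_carrier_vec)
    then have "\<phi> v = \<phi> (0\<^sub>v n)" using \<psi>(2) v by (metis zero_carrier_vec)
    then show ?thesis using \<phi>(1) v by (auto simp: bij_betw_def inj_on_def)
  qed
  then have PG: "P \<in> carrier (GL n)" using P by (simp add: carrier_GL_iff_inj)
  have "P * g = h * P"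
  proof (rule mat_eq_if_vec_eq)
    fix v :: "'q vec" assume v: "v \<in> carrier_vec n"
    have "(P * g) *\<^sub>v v = \<psi> (g *\<^sub>v v)" using P gc v assoc_mult_mat_vec[OF P(1) gc v] by simp
    also have "\<dots> = h *\<^sub>v \<psi> v" using act[OF v, of "[:0, 1:]"] gc hc v \<psi>(1)[OF v] by simp
    also have "\<dots> = (h * P) *\<^sub>v v" using P hc v assoc_mult_mat_vec[OF hc P(1) v] by simp
    finally show "(P * g) *\<^sub>v v = (h * P) *\<^sub>v v" .
  qed (use P gc hc in auto)
  then have "P \<otimes>\<^bsub>GL n\<^esub> g = h \<otimes>\<^bsub>GL n\<^esub> P" by simp
  then have "h = P \<otimes>\<^bsub>GL n\<^esub> g \<otimes>\<^bsub>GL n\<^esub> inv\<^bsub>GL n\<^esub> P"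
    using PG g h by (metis inv_solve_right m_closed)
  then show ?thesis unfolding conj_class_def using PG by blast
qed

lemma conjugate_isomorphic_module:
  fixes g :: "'q::field mat"
  assumes g: "g \<in> carrier (GL n)" and h: "h \<in> conj_class (GL n) g"
    and iso: "module_isomorphic poly_ring (mat_module n g) T"
  shows "module_isomorphic poly_ring (mat_module n h) T"
proof -
  interpret group "GL n :: 'q mat monoid" by (rule group_GL)
  obtain P where P: "P \<in> carrier (GL n)" "h = P \<otimes>\<^bsub>GL n\<^esub> g \<otimes>\<^bsub>GL n\<^esub> inv\<^bsub>GL n\<^esub> P"
    using h unfolding conj_class_def by blast
  let ?Q = "inv\<^bsub>GL n\<^esub> P"
  have Q: "?Q \<in> carrier (GL n)" using P by simp
  have hG: "h \<in> carrier (GL n)" unfolding P(2) by (intro m_closed inv_closed P(1) g)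
  have c: "g \<in> carrier_mat n n" "h \<in> carrier_mat n n" "P \<in> carrier_mat n n" "?Q \<in> carrier_mat n n"
    using g hG P(1) Q GL_carrier_mat by auto
  have "?Q \<otimes>\<^bsub>GL n\<^esub> h = g \<otimes>\<^bsub>GL n\<^esub> ?Q"
    unfolding P(2) using P(1) g Q by (simp only: m_assoc[symmetric] m_closed l_inv l_one)
  then have comm: "?Q * h = g * ?Q" by simp
  have QP: "?Q * P = 1\<^sub>m n" "P * ?Q = 1\<^sub>m n" using l_inv[OF P(1)] r_inv[OF P(1)] by simp_all
  have bij: "bij_betw (\<lambda>v. ?Q *\<^sub>v v) (carrier_vec n) (carrier_vec n)"
  proof (rule bij_betwI[where g = "\<lambda>v. P *\<^sub>v v"])
    fix v :: "'q vec" assume v: "v \<in> carrier_vec n"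
    show "P *\<^sub>v (?Q *\<^sub>v v) = v" "?Q *\<^sub>v (P *\<^sub>v v) = v"
      using assoc_mult_mat_vec[OF c(3,4) v] assoc_mult_mat_vec[OF c(4,3) v] QP v by simp_all
  qed (use c in auto)
  have "module_isomorphic poly_ring (mat_module n h) (mat_module n g)"
    unfolding module_isomorphic_def
    by (rule exI[of _ "\<lambda>v. ?Q *\<^sub>v v"])
      (use bij mult_add_distrib_mat_vec[OF c(4)] poly_act_intertwine[OF c(2,1,4) comm] in auto)
  then show ?thesis using iso module_isomorphic_trans by blast
qed

section \<open>Kernels of polynomials in a matrix\<close>

lemma restrict_eq_iff: "restrict f S = restrict g S \<longleftrightarrow> (\<forall>s\<in>S. f s = g s)"
  unfolding restrict_def by meson

text \<open>
  The kernel of a polynomial on a direct sum is the direct sum of its kernels.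
\<close>

lemma card_kernel_type_module:
  fixes g :: "'q::{finite, field} mat"
  assumes g: "g \<in> carrier_mat n n" and rho: "rho \<in> PPhi"
    and iso: "module_isomorphic poly_ring (mat_module n g) (type_module rho)"
  shows "card {v \<in> carrier_vec n. poly_act n g r v = 0\<^sub>v n} =
    (\<Prod>(f, i) | f \<in> Phi \<and> i < length (rho f).
       card {X \<in> carrier (cyclic_module f (rho f ! i)).
         r \<odot>\<^bsub>cyclic_module f (rho f ! i)\<^esub> X = \<zero>\<^bsub>cyclic_module f (rho f ! i)\<^esub>})"
proof -
  let ?S = "{(f, i). f \<in> Phi \<and> i < length (rho f)}"
  let ?M = "\<lambda>(f, i). cyclic_module f (rho f ! i)"
  have fin: "finite ?S" by (rule finite_type_index[OF rho])
  obtain \<phi> where \<phi>: "bij_betw \<phi> (carrier_vec n) (\<Pi>\<^sub>E s\<in>?S. carrier (?M s))"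
    "\<And>r x. x \<in> carrier_vec n \<Longrightarrow> \<phi> (poly_act n g r x) = (\<lambda>s\<in>?S. r \<odot>\<^bsub>?M s\<^esub> \<phi> x s)"
    using iso unfolding module_isomorphic_def type_module_def
    by (auto simp: direct_sum_simps(1)[OF fin] direct_sum_simps(3)[OF fin])
  have zero_smult: "0 \<odot>\<^bsub>?M s\<^esub> X = \<zero>\<^bsub>?M s\<^esub>" if "X \<in> carrier (?M s)" for s X
    using that by (cases s) (auto simp: cyclic_module_simps)
  have \<phi>_in: "\<phi> x \<in> (\<Pi>\<^sub>E s\<in>?S. carrier (?M s))" if "x \<in> carrier_vec n" for x
    using bij_betwE[OF \<phi>(1)] that by blast
  have \<phi>0: "\<phi> (0\<^sub>v n) = (\<lambda>s\<in>?S. \<zero>\<^bsub>?M s\<^esub>)"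
  proof -
    have "\<phi> (0\<^sub>v n) = (\<lambda>s\<in>?S. 0 \<odot>\<^bsub>?M s\<^esub> \<phi> (0\<^sub>v n) s)"
      using \<phi>(2)[of "0\<^sub>v n" 0] by simp
    also have "\<dots> = (\<lambda>s\<in>?S. \<zero>\<^bsub>?M s\<^esub>)"
      by (rule restrict_ext, rule zero_smult) (use \<phi>_in[of "0\<^sub>v n"] in \<open>auto simp: PiE_iff\<close>)
    finally show ?thesis .
  qed
  let ?K = "\<lambda>s. {X \<in> carrier (?M s). r \<odot>\<^bsub>?M s\<^esub> X = \<zero>\<^bsub>?M s\<^esub>}"
  have iff: "poly_act n g r x = 0\<^sub>v n \<longleftrightarrow> \<phi> x \<in> (\<Pi>\<^sub>E s\<in>?S. ?K s)" if x: "x \<in> carrier_vec n" for x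
  proof -
    have "poly_act n g r x = 0\<^sub>v n \<longleftrightarrow> \<phi> (poly_act n g r x) = \<phi> (0\<^sub>v n)"
      using inj_on_eq_iff[OF bij_betw_imp_inj_on[OF \<phi>(1)], of "poly_act n g r x" "0\<^sub>v n"] x g by simp
    also have "\<dots> \<longleftrightarrow> (\<forall>s\<in>?S. r \<odot>\<^bsub>?M s\<^esub> \<phi> x s = \<zero>\<^bsub>?M s\<^esub>)"
      unfolding \<phi>(2)[OF x] \<phi>0 by (rule restrict_eq_iff)
    also have "\<dots> \<longleftrightarrow> \<phi> x \<in> (\<Pi>\<^sub>E s\<in>?S. ?K s)"
      using \<phi>_in[OF x] unfolding PiE_iff by blast
    finally show ?thesis .
  qed
  have "bij_betw \<phi> {v \<in> carrier_vec n. poly_act n g r v = 0\<^sub>v n} (\<Pi>\<^sub>E s\<in>?S. ?K s)"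
    unfolding bij_betw_def
  proof
    show "inj_on \<phi> {v \<in> carrier_vec n. poly_act n g r v = 0\<^sub>v n}"
      using \<phi>(1) by (auto simp: bij_betw_def intro: inj_on_subset)
    show "\<phi> ` {v \<in> carrier_vec n. poly_act n g r v = 0\<^sub>v n} = (\<Pi>\<^sub>E s\<in>?S. ?K s)"
    proof
      show "\<phi> ` {v \<in> carrier_vec n. poly_act n g r v = 0\<^sub>v n} \<subseteq> (\<Pi>\<^sub>E s\<in>?S. ?K s)"
        using iff by blast
      show "(\<Pi>\<^sub>E s\<in>?S. ?K s) \<subseteq> \<phi> ` {v \<in> carrier_vec n. poly_act n g r v = 0\<^sub>v n}"
      proof
        fix u assume u: "u \<in> (\<Pi>\<^sub>E s\<in>?S. ?K s)"
        then have "u \<in> (\<Pi>\<^sub>E s\<in>?S. carrier (?M s))" unfolding PiE_iff by blast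
        then have "u \<in> \<phi> ` carrier_vec n" by (simp only: bij_betw_imp_surj_on[OF \<phi>(1)])
        then obtain x where "x \<in> carrier_vec n" "u = \<phi> x" by blast
        then show "u \<in> \<phi> ` {v \<in> carrier_vec n. poly_act n g r v = 0\<^sub>v n}" using u iff by blast
      qed
    qed
  qed
  then have "card {v \<in> carrier_vec n. poly_act n g r v = 0\<^sub>v n} = card (\<Pi>\<^sub>E s\<in>?S. ?K s)"
    by (rule bij_betw_same_card)
  also have "\<dots> = (\<Prod>s\<in>?S. card (?K s))" by (rule card_PiE[OF fin])
  also have "\<dots> = (\<Prod>(f, i)\<in>?S. card (?K (f, i)))" by (simp add: case_prod_beta)
  finally show ?thesis by simp
qed

lemma kernel_cyclic_module:
  "{X \<in> carrier (cyclic_module f m). r \<odot>\<^bsub>cyclic_module f m\<^esub> X = \<zero>\<^bsub>cyclic_module f m\<^esub>}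
    = residue (f ^ m) ` {p. f ^ m dvd r * p}"
proof -
  have "{X \<in> carrier (cyclic_module f m). r \<odot>\<^bsub>cyclic_module f m\<^esub> X = \<zero>\<^bsub>cyclic_module f m\<^esub>}
    = residue (f ^ m) ` {p. r \<odot>\<^bsub>cyclic_module f m\<^esub> residue (f ^ m) p = \<zero>\<^bsub>cyclic_module f m\<^esub>}"
    unfolding cyclic_module_simps(1) by blast
  then show ?thesis by (simp add: cyclic_module_simps residue_eq_iff)
qed

lemma card_kernel_cyclic_coprime:
  fixes f :: "'q::field poly"
  assumes f: "irreducible f" and r: "\<not> f dvd r"
  shows "card {X \<in> carrier (cyclic_module f m). r \<odot>\<^bsub>cyclic_module f m\<^esub> X = \<zero>\<^bsub>cyclic_module f m\<^esub>} = 1"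
proof -
  have "residue (f ^ m) p = residue (f ^ m) 0" if "f ^ m dvd r * p" for p
    using irreducible_power_dvd_cancel[OF f r that] by (simp add: residue_eq_iff)
  moreover have "f ^ m dvd r * 0" by simp
  ultimately have "residue (f ^ m) ` {p. f ^ m dvd r * p} = {residue (f ^ m) 0}" by blast
  then show ?thesis unfolding kernel_cyclic_module by simp
qed

text \<open>
  The kernel is spanned by the class of \<open>f ^ (m - 1)\<close>.
\<close>

lemma card_kernel_cyclic_linear:
  fixes f :: "'q::{finite, field} poly"
  assumes f: "f = [:a, 1:]" and m: "m > 0"
  shows "card {X \<in> carrier (cyclic_module f m).
    f \<odot>\<^bsub>cyclic_module f m\<^esub> X = \<zero>\<^bsub>cyclic_module f m\<^esub>} = card (UNIV :: 'q set)"
proof -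
  obtain k where k: "m = Suc k" using m by (cases m) auto
  have f0: "f \<noteq> 0" "f ^ k \<noteq> 0" using f by simp_all
  have dvd_iff: "f ^ m dvd f * p \<longleftrightarrow> f ^ k dvd p" for p
    unfolding k power_Suc using f0 by (simp only: dvd_mult_cancel_left) simp
  have "residue (f ^ m) ` {p. f ^ m dvd f * p} = range (\<lambda>c. residue (f ^ m) (smult c (f ^ k)))"
    (is "?L = ?R")
  proof
    have "f ^ k dvd smult c (f ^ k)" for c by (rule dvd_smult) simp
    then show "?R \<subseteq> ?L" unfolding dvd_iff by blast
    show "?L \<subseteq> ?R"
    proof
      fix X assume "X \<in> ?L"
      then obtain p where p: "X = residue (f ^ m) p" "f ^ k dvd p" unfolding dvd_iff by blast
      then obtain u where u: "p = f ^ k * u" by auto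
      have "f dvd u - [:poly u (- a):]"
        using poly_eq_0_iff_dvd[of "u - [:poly u (- a):]" "- a"] by (simp add: f)
      then have "f ^ k * f dvd f ^ k * (u - [:poly u (- a):])" by (rule mult_dvd_mono[OF dvd_refl])
      then have "f ^ m dvd p - smult (poly u (- a)) (f ^ k)"
        unfolding u k power_Suc by (simp add: right_diff_distrib mult.commute)
      then show "X \<in> ?R" using p(1) residue_eq_iff by blast
    qed
  qed
  moreover have "inj (\<lambda>c. residue (f ^ m) (smult c (f ^ k)))"
  proof (rule injI)
    fix c d assume "residue (f ^ m) (smult c (f ^ k)) = residue (f ^ m) (smult d (f ^ k))"
    then have "f ^ k * f dvd f ^ k * [:c - d:]"
      unfolding residue_eq_iff k power_Suc by (simp add: smult_diff_left mult.commute)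
    then have "f dvd [:c - d:]" using f0 by (simp only: dvd_mult_cancel_left) simp
    then show "c = d"
      using dvd_imp_degree_le[of f "[:c - d:]"] by (auto simp: f)
  qed
  ultimately show ?thesis unfolding kernel_cyclic_module by (simp add: card_image)
qed

lemma monic_irreducible_dvd_linear:
  fixes f :: "'q::field poly"
  assumes f: "irreducible f" "lead_coeff f = 1" and dvd: "f dvd [:a, 1:]"
  shows "f = [:a, 1:]"
proof -
  obtain k where k: "[:a, 1:] = f * k" using dvd by auto
  have "degree f > 0"
    using f by (metis degree_0_id gr0I irreducible_def is_unit_iff_degree)
  moreover have "degree [:a, 1:] = degree f + degree k"
    unfolding k by (rule degree_mult_eq) (use k in auto)
  ultimately have "degree k = 0" by simp
  then obtain c where c: "k = [:c:]" by (rule degree_eq_zeroE)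
  have "lead_coeff [:a, 1:] = lead_coeff f * lead_coeff k" unfolding k by (rule lead_coeff_mult)
  then have "c = 1" using f c by simp
  then show ?thesis using k c by simp
qed

text \<open>
  Among the cyclic summands, only those that belong to \<open>t - 1\<close> contain nonzero fixed vectors, and each
  of these contributes one dimension.
\<close>

lemma card_fixed_vectors:
  fixes g :: "'q::{finite, field} mat"
  assumes g: "g \<in> carrier_mat n n" and rho: "rho \<in> PPhi"
    and iso: "module_isomorphic poly_ring (mat_module n g) (type_module rho)"
  shows "card {v \<in> carrier_vec n. g *\<^sub>v v = v} = card (UNIV :: 'q set) ^ length (rho t_minus_1)"
proof -
  let ?S = "{(f, i). f \<in> Phi \<and> i < length (rho f)}"
  let ?K = "\<lambda>(f, i). card {X \<in> carrier (cyclic_module f (rho f ! i)).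
         t_minus_1 \<odot>\<^bsub>cyclic_module f (rho f ! i)\<^esub> X = \<zero>\<^bsub>cyclic_module f (rho f ! i)\<^esub>}"
  have "poly_act n g t_minus_1 v = g *\<^sub>v v - v" if "v \<in> carrier_vec n" for v
    using g that by (simp add: poly_act_pCons) (intro eq_vecI, auto)
  then have "poly_act n g t_minus_1 v = 0\<^sub>v n \<longleftrightarrow> g *\<^sub>v v = v" if "v \<in> carrier_vec n" for v
    using g that by (auto simp: vec_eq_iff)
  then have "card {v \<in> carrier_vec n. g *\<^sub>v v = v} = card {v \<in> carrier_vec n. poly_act n g t_minus_1 v = 0\<^sub>v n}"
    by (intro arg_cong[of _ _ card]) auto
  also have "\<dots> = (\<Prod>s\<in>?S. ?K s)"
    by (rule card_kernel_type_module[OF g rho iso])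
  also have "\<dots> = (\<Prod>s\<in>?S. if fst s = t_minus_1 then card (UNIV :: 'q set) else 1)"
  proof (rule prod.cong[OF refl])
    fix s assume "s \<in> ?S"
    then obtain f i where s: "s = (f, i)" and fi: "f \<in> Phi" "i < length (rho f)" by auto
    show "?K s = (if fst s = t_minus_1 then card (UNIV :: 'q set) else 1)"
    proof (cases "f = t_minus_1")
      case True
      have "rho f ! i \<in> set (rho f)" using fi by simp
      then have "rho f ! i > 0" using rho by (auto simp: PPhi_def is_partition_def intro: gr0I)
      then show ?thesis using card_kernel_cyclic_linear[of t_minus_1 "-1 :: 'q" "rho f ! i"] by (simp add: s True)
    next
      case False
      then have "\<not> f dvd t_minus_1" using monic_irreducible_dvd_linear fi by (auto simp: Phi_def)
      then show ?thesis using card_kernel_cyclic_coprime[of f t_minus_1] fi False by (simp add: s Phi_def)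
    qed
  qed
  also have "\<dots> = card (UNIV :: 'q set) ^ card {s \<in> ?S. fst s = t_minus_1}"
    using finite_type_index[OF rho] by (simp add: prod.If_cases Int_def)
  also have "{s \<in> ?S. fst s = t_minus_1} = Pair t_minus_1 ` {..<length (rho t_minus_1)}"
    using rho by (force simp: PPhi_def)
  also have "card \<dots> = length (rho t_minus_1)" by (simp add: card_image inj_on_def)
  finally show ?thesis .
qed

text \<open>
  The polynomial \<open>t\<close> is excluded from \<open>Phi\<close>, so it has no kernel on the module of a type.
\<close>

lemma J_mat_GL:
  fixes rho :: "'q::{finite, field} poly \<Rightarrow> nat list"
  assumes rho: "rho \<in> PPhi"
  shows "J_mat rho \<in> carrier (GL (pnorm rho))"
proof -
  let ?n = "pnorm rho"
  have J: "J_mat rho \<in> carrier_mat ?n ?n" by (rule J_mat_carrier[OF rho])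
  have "card {v \<in> carrier_vec ?n. poly_act ?n (J_mat rho) [:0, 1:] v = 0\<^sub>v ?n} = 1"
    unfolding card_kernel_type_module[OF J rho J_mat_iso[OF rho]]
  proof (rule prod.neutral, safe)
    fix f i assume f: "f \<in> (Phi :: 'q poly set)"
    then have "\<not> f dvd [:0, 1:]" using monic_irreducible_dvd_linear[of f 0] by (auto simp: Phi_def)
    then show "card {X \<in> carrier (cyclic_module f (rho f ! i)).
         [:0, 1:] \<odot>\<^bsub>cyclic_module f (rho f ! i)\<^esub> X = \<zero>\<^bsub>cyclic_module f (rho f ! i)\<^esub>} = 1"
      using f by (intro card_kernel_cyclic_coprime) (simp_all add: Phi_def)
  qed
  then obtain z where z: "{v \<in> carrier_vec ?n. poly_act ?n (J_mat rho) [:0, 1:] v = 0\<^sub>v ?n} = {z}"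
    by (auto simp: card_1_singleton_iff)
  have "v = 0\<^sub>v ?n" if "v \<in> carrier_vec ?n" "J_mat rho *\<^sub>v v = 0\<^sub>v ?n" for v
  proof -
    have "v \<in> {z}" "0\<^sub>v ?n \<in> {z}" unfolding z[symmetric] using that J by simp_all
    then show ?thesis by simp
  qed
  then show ?thesis using J by (simp add: carrier_GL_iff_inj)
qed

text \<open>
  The definition of a type by modules agrees with the one by canonical forms that is used
  for the affine group.
\<close>

lemma GL_type_iff:
  fixes rho :: "'q::{finite, field} poly \<Rightarrow> nat list"
  shows "GL_type n g rho \<longleftrightarrow> rho \<in> PPhi_of_size n \<and> g \<in> conj_class (GL n) (J_mat rho)"
proof (cases "rho \<in> PPhi_of_size n")
  case True
  interpret group "GL n :: 'q mat monoid" by (rule group_GL)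
  have rho: "rho \<in> PPhi" "pnorm rho = n" using True by (auto simp: PPhi_of_size_def)
  have J: "J_mat rho \<in> carrier (GL n)" using J_mat_GL[OF rho(1)] rho(2) by simp
  have iso: "module_isomorphic poly_ring (mat_module n (J_mat rho)) (type_module rho)"
    using J_mat_iso[OF rho(1)] rho(2) by simp
  show ?thesis
    using True iso_modules_conjugate[OF J _ iso] conjugate_isomorphic_module[OF J _ iso] conj_class_closed[OF J]
    unfolding GL_type_def by blast
qed (simp add: GL_type_def)

section \<open>Modified types\<close>

lemma pnorm_split:
  assumes "finite {f. rho f \<noteq> []}"
  shows "pnorm rho = sum_list (rho t_minus_1) + (\<Sum>f\<in>{f. rho f \<noteq> []} - {t_minus_1}. degree f * sum_list (rho f))"
proof -
  let ?S = "{f. rho f \<noteq> []}"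
  have "pnorm rho = (\<Sum>f\<in>insert t_minus_1 ?S. degree f * sum_list (rho f))"
    unfolding pnorm_def by (rule sum.mono_neutral_left) (use assms in auto)
  also have "\<dots> = degree (t_minus_1 :: 'a poly) * sum_list (rho t_minus_1) +
      (\<Sum>f\<in>insert t_minus_1 ?S - {t_minus_1}. degree f * sum_list (rho f))"
    using assms by (intro sum.remove) auto
  finally show ?thesis by simp
qed

lemma sum_list_decrement:
  "0 \<notin> set xs \<Longrightarrow> sum_list (filter (\<lambda>k. k > 0) (map (\<lambda>k. k - 1) xs)) + length xs = sum_list (xs :: nat list)"
  by (induction xs) auto

lemma modify_simps:
  "modify rho t_minus_1 = filter (\<lambda>k. k > 0) (map (\<lambda>k. k - 1) (rho t_minus_1))"
  "f \<noteq> t_minus_1 \<Longrightarrow> modify rho f = rho f"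
  by (simp_all add: modify_def)

text \<open>
  Each positive part at \<open>t - 1\<close> loses one. In view of \<open>card_fixed_vectors\<close>, the size of the modified
  type is the codimension of the space of fixed vectors.
\<close>

lemma pnorm_modify:
  assumes "rho \<in> PPhi"
  shows "pnorm (modify rho) + length (rho t_minus_1) = pnorm rho"
proof -
  have fin: "finite {f. rho f \<noteq> []}" using assms by (simp add: PPhi_def)
  have sub: "{f. modify rho f \<noteq> []} - {t_minus_1} = {f. rho f \<noteq> []} - {t_minus_1}"
    by (auto simp: modify_simps(2))
  then have fin': "finite {f. modify rho f \<noteq> []}" 
    using fin by (metis finite_Diff2 finite.emptyI finite.insertI)
  have "(\<Sum>f\<in>{f. modify rho f \<noteq> []} - {t_minus_1}. degree f * sum_list (modify rho f)) =
      (\<Sum>f\<in>{f. rho f \<noteq> []} - {t_minus_1}. degree f * sum_list (rho f))"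
    unfolding sub by (rule sum.cong) (auto simp: modify_simps(2))
  moreover have "0 \<notin> set (rho t_minus_1)" using assms by (simp add: PPhi_def is_partition_def)
  ultimately show ?thesis
    using sum_list_decrement[of "rho t_minus_1"]
    by (simp add: pnorm_split[OF fin] pnorm_split[OF fin'] modify_simps(1))
qed

lemma partition_recover:
  fixes xs :: "nat list"
  assumes "is_partition xs"
  shows "xs = map Suc (filter (\<lambda>k. k > 0) (map (\<lambda>k. k - 1) xs)) @
     replicate (length xs - length (filter (\<lambda>k. k > 0) (map (\<lambda>k. k - 1) xs))) 1"
  using assms
proof (induction xs)
  case (Cons x xs)
  let ?d = "\<lambda>xs. filter (\<lambda>k. k > 0) (map (\<lambda>k. k - 1) (xs :: nat list))"
  have x: "x > 0" "\<forall>y\<in>set xs. y \<le> x" and xs: "is_partition xs"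
    using Cons.prems by (auto simp: is_partition_def)
  show ?case
  proof (cases "x = 1")
    case True
    then have "\<forall>y\<in>set xs. y = 1" using x xs by (metis is_partition_def le_neq_implies_less less_one)
    then have "xs = replicate (length xs) 1" "?d xs = []"
      by (auto simp: filter_empty_conv intro: replicate_eqI)
    then show ?thesis using True by simp
  next
    case False
    have "length (?d xs) \<le> length xs" by (metis length_filter_le length_map)
    then show ?thesis using Cons.IH[OF xs] x False by simp
  qed
qed simp

text \<open>
  A modified type forgets only the number of parts equal to 1 at \<open>t - 1\<close>, and this number is determined by
  the size.
\<close>

lemma modify_inj:
  assumes "rho \<in> PPhi_of_size n" "rho' \<in> PPhi_of_size n" and eq: "modify rho = modify rho'"
  shows "rho = rho'"
proof
  fix f
  have P: "rho \<in> PPhi" "rho' \<in> PPhi" "pnorm rho = n" "pnorm rho' = n"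
    using assms by (auto simp: PPhi_of_size_def)
  show "rho f = rho' f"
  proof (cases "f = t_minus_1")
    case True
    have len: "length (rho t_minus_1) = length (rho' t_minus_1)"
      using pnorm_modify[OF P(1)] pnorm_modify[OF P(2)] eq P(3,4) by simp
    have "is_partition (rho t_minus_1)" "is_partition (rho' t_minus_1)"
      using P by (auto simp: PPhi_def)
    from partition_recover[OF this(1)] partition_recover[OF this(2)]
    show ?thesis using fun_cong[OF eq, of t_minus_1] len True by (metis modify_simps(1))
  next
    case False
    then show ?thesis using fun_cong[OF eq, of f] by (simp add: modify_simps(2))
  qed
qed

section \<open>The affine group\<close>

definition affine_mat :: "nat \<Rightarrow> 'q::field mat \<Rightarrow> 'q mat \<Rightarrow> 'q mat" where
  "affine_mat n \<alpha> g = four_block_mat (1\<^sub>m 1) (0\<^sub>m 1 n) \<alpha> g"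

lemma affine_mat_carrier [simp]:
  "g \<in> carrier_mat n n \<Longrightarrow> affine_mat n \<alpha> g \<in> carrier_mat (Suc n) (Suc n)"
  using four_block_carrier_mat[OF one_carrier_mat[of 1], of g n n "0\<^sub>m 1 n" \<alpha>] by (simp add: affine_mat_def)

lemma affine_mat_mult:
  assumes "\<alpha> \<in> carrier_mat n 1" "\<beta> \<in> carrier_mat n 1" "g \<in> carrier_mat n n" "h \<in> carrier_mat n n"
  shows "affine_mat n \<alpha> g * affine_mat n \<beta> h = affine_mat n (\<alpha> + g * \<beta>) (g * h)"
proof -
  have "affine_mat n \<alpha> g * affine_mat n \<beta> h =
    four_block_mat (1\<^sub>m 1 * 1\<^sub>m 1 + 0\<^sub>m 1 n * \<beta>) (1\<^sub>m 1 * 0\<^sub>m 1 n + 0\<^sub>m 1 n * h)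
      (\<alpha> * 1\<^sub>m 1 + g * \<beta>) (\<alpha> * 0\<^sub>m 1 n + g * h)"
    unfolding affine_mat_def by (rule mult_four_block_mat) (use assms in auto)
  also have "1\<^sub>m 1 * 1\<^sub>m 1 + 0\<^sub>m 1 n * \<beta> = 1\<^sub>m 1" using assms by simp
  also have "1\<^sub>m 1 * 0\<^sub>m 1 n + 0\<^sub>m 1 n * h = 0\<^sub>m 1 n" using assms by simp
  also have "\<alpha> * 1\<^sub>m 1 = \<alpha>" using assms by simp
  also have "\<alpha> * 0\<^sub>m 1 n + g * h = g * h" using assms by simp
  finally show ?thesis by (simp add: affine_mat_def)
qed

lemma affine_mat_one: "affine_mat n (0\<^sub>m n 1) (1\<^sub>m n) = 1\<^sub>m (Suc n)"
  unfolding affine_mat_def by (rule eq_matI) auto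

definition linear_part :: "nat \<Rightarrow> 'q mat \<Rightarrow> 'q mat" where
  "linear_part n A = mat n n (\<lambda>(i, j). A $$ (Suc i, Suc j))"

lemma linear_part_affine_mat [simp]:
  assumes "g \<in> carrier_mat n n"
  shows "linear_part n (affine_mat n \<alpha> g) = g"
  using assms by (intro eq_matI) (auto simp: linear_part_def affine_mat_def)

lemma affine_mat_GL:
  assumes \<alpha>: "\<alpha> \<in> carrier_mat n 1" and g: "g \<in> carrier (GL n)"
  shows "affine_mat n \<alpha> g \<in> carrier (GL (Suc n))"
    and "\<exists>\<beta> h. \<beta> \<in> carrier_mat n 1 \<and> h \<in> carrier (GL n) \<and> inv\<^bsub>GL (Suc n)\<^esub> (affine_mat n \<alpha> g) = affine_mat n \<beta> h"
proof -
  interpret G: group "GL n :: 'a mat monoid" by (rule group_GL)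
  interpret G': group "GL (Suc n) :: 'a mat monoid" by (rule group_GL)
  let ?h = "inv\<^bsub>GL n\<^esub> g"
  have gc: "g \<in> carrier_mat n n" and hG: "?h \<in> carrier (GL n)" and hc: "?h \<in> carrier_mat n n"
    using g GL_carrier_mat G.inv_closed by auto
  have gh: "g * ?h = 1\<^sub>m n" "?h * g = 1\<^sub>m n" using G.r_inv[OF g] G.l_inv[OF g] by simp_all
  let ?\<beta> = "- (?h * \<alpha>)"
  have \<beta>: "?\<beta> \<in> carrier_mat n 1" using hc \<alpha> by simp
  have "g * ?\<beta> = - (g * (?h * \<alpha>))" using gc hc \<alpha> by simp
  also have "g * (?h * \<alpha>) = (g * ?h) * \<alpha>" by (rule assoc_mult_mat[symmetric]) (use gc hc \<alpha> in auto)
  finally have g\<beta>: "g * ?\<beta> = - \<alpha>" using gh \<alpha> by simp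
  have neg: "X + - X = 0\<^sub>m n 1" "- X + X = 0\<^sub>m n 1" if "X \<in> carrier_mat n 1" for X :: "'a mat"
    using that by (auto intro!: eq_matI)
  have r: "affine_mat n \<alpha> g * affine_mat n ?\<beta> ?h = 1\<^sub>m (Suc n)"
    unfolding affine_mat_mult[OF \<alpha> \<beta> gc hc] g\<beta> gh neg(1)[OF \<alpha>] by (rule affine_mat_one)
  have l: "affine_mat n ?\<beta> ?h * affine_mat n \<alpha> g = 1\<^sub>m (Suc n)"
    unfolding affine_mat_mult[OF \<beta> \<alpha> hc gc] gh neg(2)[OF mult_carrier_mat[OF hc \<alpha>]] by (rule affine_mat_one)
  show A: "affine_mat n \<alpha> g \<in> carrier (GL (Suc n))"
    unfolding carrier_GL using gc hc l r by (intro conjI bexI[of _ "affine_mat n ?\<beta> ?h"]) simp_all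
  have B: "affine_mat n ?\<beta> ?h \<in> carrier (GL (Suc n))"
    unfolding carrier_GL using gc hc l r by (intro conjI bexI[of _ "affine_mat n \<alpha> g"]) simp_all
  have "inv\<^bsub>GL (Suc n)\<^esub> (affine_mat n \<alpha> g) = affine_mat n ?\<beta> ?h"
    by (rule G'.inv_equality) (use A B l in simp_all)
  then show "\<exists>\<beta> h. \<beta> \<in> carrier_mat n 1 \<and> h \<in> carrier (GL n) \<and>
      inv\<^bsub>GL (Suc n)\<^esub> (affine_mat n \<alpha> g) = affine_mat n \<beta> h"
    using \<beta> hG by blast
qed

lemma carrier_GA_iff:
  "A \<in> carrier (GA (Suc n)) \<longleftrightarrow> (\<exists>\<alpha> g. \<alpha> \<in> carrier_mat n 1 \<and> g \<in> carrier (GL n) \<and> A = affine_mat n \<alpha> g)"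
proof -
  have "A \<in> carrier (GA (Suc n)) \<longleftrightarrow> A \<in> carrier (GL (Suc n)) \<and>
      (\<exists>\<alpha> g. \<alpha> \<in> carrier_mat n 1 \<and> g \<in> carrier (GL n) \<and> A = affine_mat n \<alpha> g)"
    by (simp add: GA_def affine_mat_def)
  then show ?thesis using affine_mat_GL(1) by blast
qed

lemma affine_mat_GA:
  "\<alpha> \<in> carrier_mat n 1 \<Longrightarrow> g \<in> carrier (GL n) \<Longrightarrow> affine_mat n \<alpha> g \<in> carrier (GA (Suc n))"
  unfolding carrier_GA_iff by blast

lemma GA_cases:
  assumes "A \<in> carrier (GA (Suc n))"
  obtains \<alpha> g where "A = affine_mat n \<alpha> g" "\<alpha> \<in> carrier_mat n 1" "g \<in> carrier (GL n)" "g \<in> carrier_mat n n"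
  using assms GL_carrier_mat unfolding carrier_GA_iff by blast

lemma GA_eq: "GA (Suc n) = (GL (Suc n))\<lparr>carrier := carrier (GA (Suc n))\<rparr>"
  by (simp add: GA_def)

lemma subgroup_GA: "subgroup (carrier (GA (Suc n))) (GL (Suc n) :: 'q::field mat monoid)"
proof -
  interpret G: group "GL n :: 'q mat monoid" by (rule group_GL)
  interpret G': group "GL (Suc n) :: 'q mat monoid" by (rule group_GL)
  show ?thesis
  proof (rule G'.subgroupI)
    show "carrier (GA (Suc n)) \<subseteq> carrier (GL (Suc n) :: 'q mat monoid)"
      by (auto simp: GA_def)
    show "carrier (GA (Suc n)) \<noteq> ({} :: 'q mat set)"
      using affine_mat_GA[OF zero_carrier_mat G.one_closed] by blast
    show "inv\<^bsub>GL (Suc n)\<^esub> A \<in> carrier (GA (Suc n))" if A: "A \<in> carrier (GA (Suc n))" for A :: "'q mat"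
      using A
    proof (rule GA_cases)
      fix \<alpha> g assume A': "A = affine_mat n \<alpha> g" "\<alpha> \<in> carrier_mat n 1" "g \<in> carrier (GL n)"
      obtain \<beta> h where "\<beta> \<in> carrier_mat n 1" "h \<in> carrier (GL n)"
        "inv\<^bsub>GL (Suc n)\<^esub> (affine_mat n \<alpha> g) = affine_mat n \<beta> h"
        using affine_mat_GL(2)[OF A'(2,3)] by blast
      then show ?thesis unfolding A'(1) by (simp add: affine_mat_GA)
    qed
    show "A \<otimes>\<^bsub>GL (Suc n)\<^esub> B \<in> carrier (GA (Suc n))"
      if A: "A \<in> carrier (GA (Suc n))" and B: "B \<in> carrier (GA (Suc n))" for A B :: "'q mat"
    proof -
      obtain \<alpha> g where a: "A = affine_mat n \<alpha> g" "\<alpha> \<in> carrier_mat n 1" "g \<in> carrier (GL n)" "g \<in> carrier_mat n n"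
        using A by (rule GA_cases)
      obtain \<beta> h where b: "B = affine_mat n \<beta> h" "\<beta> \<in> carrier_mat n 1" "h \<in> carrier (GL n)" "h \<in> carrier_mat n n"
        using B by (rule GA_cases)
      have "g * h \<in> carrier (GL n)" using G.m_closed[OF a(3) b(3)] by simp
      moreover have "\<alpha> + g * \<beta> \<in> carrier_mat n 1" using a b by simp
      ultimately show ?thesis
        using affine_mat_mult[OF a(2) b(2) a(4) b(4)] by (simp add: a(1) b(1) affine_mat_GA)
    qed
  qed
qed

lemma group_GA: "group (GA (Suc n) :: 'q::field mat monoid)"
  by (subst GA_eq, rule subgroup.subgroup_is_group[OF subgroup_GA group_GL])

lemma GA_simps [simp]: "A \<otimes>\<^bsub>GA n\<^esub> B = A * B" "\<one>\<^bsub>GA n\<^esub> = 1\<^sub>m n"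
  by (simp_all add: GA_def)

lemma inv_GA: "A \<in> carrier (GA (Suc n)) \<Longrightarrow> inv\<^bsub>GA (Suc n)\<^esub> A = inv\<^bsub>GL (Suc n)\<^esub> A"
  by (subst GA_eq, rule group.m_inv_consistent[OF group_GL subgroup_GA])

lemma finite_carrier_GA: "finite (carrier (GA n :: 'q::{finite, field} mat monoid))"
  by (rule finite_subset[OF _ finite_carrier_GL[of n]]) (auto simp: GA_def)

lemma conj_class_hom:
  assumes "group_hom G H f" "a \<in> carrier G" "b \<in> conj_class G a"
  shows "f b \<in> conj_class H (f a)"
proof -
  interpret group_hom G H f by fact
  obtain h where h: "h \<in> carrier G" "b = h \<otimes>\<^bsub>G\<^esub> a \<otimes>\<^bsub>G\<^esub> inv\<^bsub>G\<^esub> h"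
    using assms(3) unfolding conj_class_def by blast
  have "f b = f h \<otimes>\<^bsub>H\<^esub> f a \<otimes>\<^bsub>H\<^esub> inv\<^bsub>H\<^esub> (f h)"
    unfolding h(2) using h(1) assms(2) by (simp only: hom_mult hom_inv G.m_closed G.inv_closed)
  then show ?thesis unfolding conj_class_def using hom_closed[OF h(1)] by blast
qed

text \<open>
  Together with the section \<open>affine_mat n 0\<close> of the next lemma, this homomorphism transports
  conjugacy between the two groups.
\<close>

lemma linear_part_hom: "group_hom (GA (Suc n)) (GL n) (linear_part n :: 'q::field mat \<Rightarrow> 'q mat)"
proof -
  have "linear_part n \<in> hom (GA (Suc n)) (GL n :: 'q mat monoid)"
  proof (rule homI)
    fix A :: "'q mat" assume "A \<in> carrier (GA (Suc n))"
    then show "linear_part n A \<in> carrier (GL n)" by (rule GA_cases) simp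
  next
    fix A B :: "'q mat" assume A: "A \<in> carrier (GA (Suc n))" and B: "B \<in> carrier (GA (Suc n))"
    obtain \<alpha> g where a: "A = affine_mat n \<alpha> g" "\<alpha> \<in> carrier_mat n 1" "g \<in> carrier_mat n n"
      using A by (rule GA_cases)
    obtain \<beta> h where b: "B = affine_mat n \<beta> h" "\<beta> \<in> carrier_mat n 1" "h \<in> carrier_mat n n"
      using B by (rule GA_cases)
    show "linear_part n (A \<otimes>\<^bsub>GA (Suc n)\<^esub> B) = linear_part n A \<otimes>\<^bsub>GL n\<^esub> linear_part n B"
      using a b affine_mat_mult[OF a(2) b(2) a(3) b(3)] linear_part_affine_mat[OF mult_carrier_mat[OF a(3) b(3)]]
      by simp
  qed
  then show ?thesis by (intro group_hom.intro group_hom_axioms.intro group_GA group_GL)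
qed

lemma affine_mat_0_hom: "group_hom (GL n) (GA (Suc n)) (affine_mat n (0\<^sub>m n 1) :: 'q::field mat \<Rightarrow> 'q mat)"
proof -
  have "affine_mat n (0\<^sub>m n 1) \<in> hom (GL n) (GA (Suc n) :: 'q mat monoid)"
  proof (rule homI)
    fix g h :: "'q mat" assume gh: "g \<in> carrier (GL n)" "h \<in> carrier (GL n)"
    then have c: "g \<in> carrier_mat n n" "h \<in> carrier_mat n n" by (auto dest: GL_carrier_mat)
    have "0\<^sub>m n 1 + g * 0\<^sub>m n 1 = 0\<^sub>m n 1" using c by simp
    then show "affine_mat n (0\<^sub>m n 1) (g \<otimes>\<^bsub>GL n\<^esub> h) =
        affine_mat n (0\<^sub>m n 1) g \<otimes>\<^bsub>GA (Suc n)\<^esub> affine_mat n (0\<^sub>m n 1) h"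
      using affine_mat_mult[OF zero_carrier_mat zero_carrier_mat c] by simp
  qed (rule affine_mat_GA[OF zero_carrier_mat])
  then show ?thesis by (intro group_hom.intro group_hom_axioms.intro group_GA group_GL)
qed

lemma affine_mat_mult_vec:
  assumes "\<alpha> \<in> carrier_mat n 1" "g \<in> carrier_mat n n" "c \<in> carrier_vec 1" "v \<in> carrier_vec n"
  shows "affine_mat n \<alpha> g *\<^sub>v (c @\<^sub>v v) = c @\<^sub>v (\<alpha> *\<^sub>v c + g *\<^sub>v v)"
proof -
  have "affine_mat n \<alpha> g *\<^sub>v (c @\<^sub>v v) = (1\<^sub>m 1 *\<^sub>v c + 0\<^sub>m 1 n *\<^sub>v v) @\<^sub>v (\<alpha> *\<^sub>v c + g *\<^sub>v v)"
    unfolding affine_mat_def by (rule four_block_mat_mult_vec) (use assms in auto)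
  also have "1\<^sub>m 1 *\<^sub>v c + 0\<^sub>m 1 n *\<^sub>v v = c"
    using assms by (auto intro!: eq_vecI)
  finally show ?thesis .
qed

section \<open>Fixed vectors of a product\<close>

definition fixed_vecs :: "nat \<Rightarrow> 'q::field mat \<Rightarrow> 'q vec set" where
  "fixed_vecs n A = {v \<in> carrier_vec n. A *\<^sub>v v = v}"

lemma card_fixed_vecs_conj:
  fixes A :: "'q::field mat"
  assumes A: "A \<in> carrier (GL n)" and B: "B \<in> conj_class (GL n) A"
  shows "card (fixed_vecs n B) = card (fixed_vecs n A)"
proof -
  interpret group "GL n :: 'q mat monoid" by (rule group_GL)
  obtain P where P: "P \<in> carrier (GL n)" "B = P \<otimes>\<^bsub>GL n\<^esub> A \<otimes>\<^bsub>GL n\<^esub> inv\<^bsub>GL n\<^esub> P"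
    using B unfolding conj_class_def by blast
  let ?Q = "inv\<^bsub>GL n\<^esub> P"
  have Q: "?Q \<in> carrier (GL n)" using P by simp
  have "B \<in> carrier (GL n)" unfolding P(2) by (intro m_closed inv_closed P(1) A)
  then have c: "A \<in> carrier_mat n n" "B \<in> carrier_mat n n" "P \<in> carrier_mat n n" "?Q \<in> carrier_mat n n"
    using A P(1) Q GL_carrier_mat by auto
  have "B \<otimes>\<^bsub>GL n\<^esub> P = P \<otimes>\<^bsub>GL n\<^esub> A" "?Q \<otimes>\<^bsub>GL n\<^esub> B = A \<otimes>\<^bsub>GL n\<^esub> ?Q"
    unfolding P(2) using P(1) A Q by (simp_all only: m_assoc m_closed l_inv r_one)
      (simp_all only: m_assoc[symmetric] m_closed l_inv l_one)
  then have comm: "B * P = P * A" "?Q * B = A * ?Q" by simp_all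
  have QP: "?Q * P = 1\<^sub>m n" "P * ?Q = 1\<^sub>m n" using l_inv[OF P(1)] r_inv[OF P(1)] by simp_all
  have "bij_betw (\<lambda>v. P *\<^sub>v v) (fixed_vecs n A) (fixed_vecs n B)"
  proof (rule bij_betwI[where g = "\<lambda>v. ?Q *\<^sub>v v"])
    show "(\<lambda>v. P *\<^sub>v v) \<in> fixed_vecs n A \<rightarrow> fixed_vecs n B"
    proof
      fix v assume "v \<in> fixed_vecs n A"
      then have v: "v \<in> carrier_vec n" "A *\<^sub>v v = v" by (auto simp: fixed_vecs_def)
      have "B *\<^sub>v (P *\<^sub>v v) = P *\<^sub>v (A *\<^sub>v v)"
        using comm(1) assoc_mult_mat_vec[OF c(2,3) v(1)] assoc_mult_mat_vec[OF c(3,1) v(1)] by simp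
      then show "P *\<^sub>v v \<in> fixed_vecs n B" using v c by (auto simp: fixed_vecs_def)
    qed
    show "(\<lambda>v. ?Q *\<^sub>v v) \<in> fixed_vecs n B \<rightarrow> fixed_vecs n A"
    proof
      fix v assume "v \<in> fixed_vecs n B"
      then have v: "v \<in> carrier_vec n" "B *\<^sub>v v = v" by (auto simp: fixed_vecs_def)
      have "A *\<^sub>v (?Q *\<^sub>v v) = ?Q *\<^sub>v (B *\<^sub>v v)"
        using comm(2) assoc_mult_mat_vec[OF c(1,4) v(1)] assoc_mult_mat_vec[OF c(4,2) v(1)] by simp
      then show "?Q *\<^sub>v v \<in> fixed_vecs n A" using v c by (auto simp: fixed_vecs_def)
    qed
    show "?Q *\<^sub>v (P *\<^sub>v v) = v" if "v \<in> fixed_vecs n A" for v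
      using that assoc_mult_mat_vec[OF c(4,3), of v] QP by (simp add: fixed_vecs_def)
    show "P *\<^sub>v (?Q *\<^sub>v v) = v" if "v \<in> fixed_vecs n B" for v
      using that assoc_mult_mat_vec[OF c(3,4), of v] QP by (simp add: fixed_vecs_def)
  qed
  then show ?thesis by (simp add: bij_betw_same_card)
qed

lemma card_fixed_vecs_affine_0:
  fixes g :: "'q::{finite, field} mat"
  assumes g: "g \<in> carrier_mat n n"
  shows "card (fixed_vecs (Suc n) (affine_mat n (0\<^sub>m n 1) g)) = card (UNIV :: 'q set) * card (fixed_vecs n g)"
proof -
  let ?A = "affine_mat n (0\<^sub>m n 1) g"
  have mult: "?A *\<^sub>v (c @\<^sub>v v) = c @\<^sub>v (g *\<^sub>v v)" if "c \<in> carrier_vec 1" "v \<in> carrier_vec n" for c v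
  proof -
    have "0\<^sub>m n 1 *\<^sub>v c + g *\<^sub>v v = g *\<^sub>v v" using g that by (auto intro!: eq_vecI)
    then show ?thesis using affine_mat_mult_vec[OF zero_carrier_mat g that] by simp
  qed
  have "fixed_vecs (Suc n) ?A = (\<lambda>(c, v). c @\<^sub>v v) ` (carrier_vec 1 \<times> fixed_vecs n g)"
  proof
    show "(\<lambda>(c, v). c @\<^sub>v v) ` (carrier_vec 1 \<times> fixed_vecs n g) \<subseteq> fixed_vecs (Suc n) ?A"
      using mult by (auto simp: fixed_vecs_def append_carrier_vec[of _ 1 _ n, simplified])
    show "fixed_vecs (Suc n) ?A \<subseteq> (\<lambda>(c, v). c @\<^sub>v v) ` (carrier_vec 1 \<times> fixed_vecs n g)"
    proof
      fix u assume u: "u \<in> fixed_vecs (Suc n) ?A"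
      then have "u \<in> carrier_vec (1 + n)" by (simp add: fixed_vecs_def)
      then have s: "vec_first u 1 @\<^sub>v vec_last u n = u" by simp
      have "vec_first u 1 @\<^sub>v (g *\<^sub>v vec_last u n) = vec_first u 1 @\<^sub>v vec_last u n"
        using mult[of "vec_first u 1" "vec_last u n"] u s by (simp add: fixed_vecs_def)
      then have "g *\<^sub>v vec_last u n = vec_last u n"
        using append_vec_eq[OF vec_first_carrier vec_first_carrier] by blast
      then show "u \<in> (\<lambda>(c, v). c @\<^sub>v v) ` (carrier_vec 1 \<times> fixed_vecs n g)"
        using s by (intro image_eqI[of _ _ "(vec_first u 1, vec_last u n)"]) (simp_all add: fixed_vecs_def)
    qed
  qed
  moreover have "inj_on (\<lambda>(c, v). c @\<^sub>v v) (carrier_vec 1 \<times> fixed_vecs n g)"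
    by (auto simp: inj_on_def append_vec_eq[of _ 1])
  ultimately show ?thesis
    by (simp add: card_image card_cartesian_product card_carrier_vec)
qed

text \<open>
  This is \<open>dim U + dim W \<le> n + dim (U \<inter> W)\<close> in terms of cardinalities: the nonempty fibres of the map
  \<open>(x, y) \<mapsto> x - y\<close> from \<open>U \<times> W\<close> to the whole space inject into \<open>U \<inter> W\<close>.
\<close>

lemma card_mult_le_card_Int:
  fixes U W :: "'q::{finite, field} vec set"
  assumes U: "U \<subseteq> carrier_vec n" "\<And>x y. x \<in> U \<Longrightarrow> y \<in> U \<Longrightarrow> x - y \<in> U"
    and W: "W \<subseteq> carrier_vec n" "\<And>x y. x \<in> W \<Longrightarrow> y \<in> W \<Longrightarrow> x - y \<in> W"
  shows "card U * card W \<le> card (UNIV :: 'q set) ^ n * card (U \<inter> W)"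
proof -
  let ?V = "carrier_vec n :: 'q vec set"
  have fin: "finite U" "finite W" using U(1) W(1) finite_carrier_vec finite_subset by blast+
  let ?fib = "\<lambda>z. {p \<in> U \<times> W. fst p - snd p = z}"
  have fib: "card (?fib z) \<le> card (U \<inter> W)" for z
  proof (cases "?fib z = {}")
    case False
    then obtain x0 y0 where p0: "x0 \<in> U" "y0 \<in> W" "x0 - y0 = z" by auto
    have same: "x - x0 = y - y0" if "x \<in> U" "y \<in> W" "x - y = z" for x y
    proof (rule eq_vecI)
      have d: "x \<in> ?V" "y \<in> ?V" "x0 \<in> ?V" "y0 \<in> ?V" using that p0 U(1) W(1) by auto
      then show "dim_vec (x - x0) = dim_vec (y - y0)" by auto
      fix i assume "i < dim_vec (y - y0)"
      then have i: "i < n" using d by auto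
      have "(x - y) $ i = (x0 - y0) $ i" using that p0 by simp
      then have "x $ i - y $ i = x0 $ i - y0 $ i" using d i by simp
      then show "(x - x0) $ i = (y - y0) $ i" using d i by (simp add: algebra_simps)
    qed
    show ?thesis
    proof (rule card_inj_on_le)
      show "(\<lambda>p. fst p - x0) ` ?fib z \<subseteq> U \<inter> W"
        using p0 U(2) W(2) same by (auto, metis)
      show "inj_on (\<lambda>p. fst p - x0) (?fib z)"
      proof (rule inj_onI)
        fix p p' assume p: "p \<in> ?fib z" "p' \<in> ?fib z" and eq: "fst p - x0 = fst p' - x0"
        have cancel: "x = x'" if "x \<in> ?V" "x' \<in> ?V" "c \<in> ?V" "x - c = x' - c" for x x' c
          using that by (auto simp: vec_eq_iff)
        have mem: "fst p \<in> U" "fst p' \<in> U" "snd p \<in> W" "snd p' \<in> W" using p by auto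
        have "fst p = fst p'"
          by (rule cancel[OF subsetD[OF U(1) mem(1)] subsetD[OF U(1) mem(2)] subsetD[OF U(1) p0(1)] eq])
        moreover have "snd p - y0 = snd p' - y0" using same p eq by auto
        then have "snd p = snd p'"
          by (rule cancel[OF subsetD[OF W(1) mem(3)] subsetD[OF W(1) mem(4)] subsetD[OF W(1) p0(2)]])
        ultimately show "p = p'" by (rule prod_eqI)
      qed
    qed (use fin in simp)
  next
    case True
    show ?thesis unfolding True by simp
  qed
  have "card U * card W = card (U \<times> W)" by (simp add: card_cartesian_product)
  also have "\<dots> = (\<Sum>z\<in>?V. card (?fib z))"
  proof -
    have "(\<Sum>z\<in>?V. \<Sum>p\<in>?fib z. 1) = (\<Sum>p\<in>U \<times> W. 1 :: nat)"
      by (rule sum.group) (use fin finite_carrier_vec subsetD[OF U(1)] subsetD[OF W(1)] in auto)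
    then show ?thesis by simp
  qed
  also have "\<dots> \<le> (\<Sum>z\<in>?V. card (U \<inter> W))" by (rule sum_mono) (rule fib)
  finally show ?thesis by (simp add: card_carrier_vec)
qed

text \<open>
  The hypothesis says that the codimensions of the spaces of fixed vectors add up. One has
  \<open>fixed_vecs A \<inter> fixed_vecs B \<subseteq> fixed_vecs (A B)\<close> in any case; under the hypothesis, the smaller space is at
  least as large as the larger one.
\<close>

lemma fixed_vecs_mult_subset:
  fixes A B :: "'q::{finite, field} mat"
  assumes A: "A \<in> carrier_mat n n" and B: "B \<in> carrier_mat n n"
    and card: "card (fixed_vecs n A) * card (fixed_vecs n B) =
      card (UNIV :: 'q set) ^ n * card (fixed_vecs n (A * B))"
  shows "fixed_vecs n (A * B) \<subseteq> fixed_vecs n A \<inter> fixed_vecs n B"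
proof -
  have sub: "fixed_vecs n A \<inter> fixed_vecs n B \<subseteq> fixed_vecs n (A * B)"
    using assoc_mult_mat_vec[OF A B] by (auto simp: fixed_vecs_def)
  have diff: "x - y \<in> fixed_vecs n C" if "C \<in> carrier_mat n n" "x \<in> fixed_vecs n C" "y \<in> fixed_vecs n C" for C x y
    using that mult_minus_distrib_mat_vec[OF that(1), of x y] by (auto simp: fixed_vecs_def)
  have "card (fixed_vecs n A) * card (fixed_vecs n B) \<le>
      card (UNIV :: 'q set) ^ n * card (fixed_vecs n A \<inter> fixed_vecs n B)"
    by (rule card_mult_le_card_Int) (use diff[OF A] diff[OF B] in \<open>auto simp: fixed_vecs_def\<close>)
  then have "card (fixed_vecs n (A * B)) \<le> card (fixed_vecs n A \<inter> fixed_vecs n B)"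
    unfolding card by (simp add: card_gt_0_iff)
  moreover have "finite (fixed_vecs n (A * B))"
    by (rule finite_subset[OF _ finite_carrier_vec[of n]]) (auto simp: fixed_vecs_def)
  ultimately show ?thesis using card_seteq[OF _ sub] by simp
qed

section \<open>Comparison of the structure constants\<close>

definition K_set :: "('q::field poly \<Rightarrow> nat list) \<Rightarrow> nat \<Rightarrow> 'q mat set" where
  "K_set lam n = {g \<in> carrier (GL n). GL_modified_type n g lam}"

definition P_set :: "('q::field poly \<Rightarrow> nat list) \<Rightarrow> nat \<Rightarrow> 'q mat set" where
  "P_set lam n = {A \<in> carrier (GA n). GA_modified_type n A (lam, 0)}"

lemma J_affine_0: "J_affine (rho, 0) = affine_mat (pnorm rho) (0\<^sub>m (pnorm rho) 1) (J_mat rho)"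
proof -
  have "epsilon rho 0 = 0\<^sub>m (pnorm rho) 1" by (rule eq_matI) (auto simp: epsilon_def)
  then show ?thesis by (simp add: J_affine_def affine_mat_def)
qed

text \<open>
  Both sets are single conjugacy classes, with corresponding representatives, since the type is determined
  by the modified type and the size.
\<close>

lemma K_set_P_set_class:
  fixes rho :: "'q::{finite, field} poly \<Rightarrow> nat list"
  assumes rho: "rho \<in> PPhi_of_size n" "modify rho = lam"
  shows "K_set lam n = conj_class (GL n) (J_mat rho)"
    and "P_set lam (Suc n) = conj_class (GA (Suc n)) (affine_mat n (0\<^sub>m n 1) (J_mat rho))"
proof -
  have n: "rho \<in> PPhi" "pnorm rho = n" using rho by (auto simp: PPhi_of_size_def)
  have J: "J_mat rho \<in> carrier (GL n)" using J_mat_GL[OF n(1)] n(2) by simp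
  then have JA: "affine_mat n (0\<^sub>m n 1) (J_mat rho) \<in> carrier (GA (Suc n))"
    by (rule affine_mat_GA[OF zero_carrier_mat])
  have uniq: "rho' = rho" if "rho' \<in> PPhi_of_size n" "lam = modify rho'" for rho'
    using modify_inj[OF that(1) rho(1)] that(2) rho(2) by simp
  have "GL_modified_type n g lam \<longleftrightarrow> g \<in> conj_class (GL n) (J_mat rho)" for g
    unfolding GL_modified_type_def GL_type_iff using uniq rho by metis
  then show "K_set lam n = conj_class (GL n) (J_mat rho)"
    unfolding K_set_def using group.conj_class_closed[OF group_GL J] by auto
  have "GA_modified_type (Suc n) A (lam, 0) \<longleftrightarrow>
      A \<in> carrier (GA (Suc n)) \<and> A \<in> conj_class (GA (Suc n)) (J_affine (rho, 0))" for A
  proof -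
    have "GA_modified_type (Suc n) A (lam, 0) \<longleftrightarrow>
      (\<exists>rho'. (A \<in> carrier (GA (Suc n)) \<and> rho' \<in> PPhi_of_size n \<and>
         A \<in> conj_class (GA (Suc n)) (J_affine (rho', 0))) \<and> lam = modify rho')"
      by (simp add: GA_modified_type_def GA_type_def)
    then show ?thesis using uniq rho by metis
  qed
  then show "P_set lam (Suc n) = conj_class (GA (Suc n)) (affine_mat n (0\<^sub>m n 1) (J_mat rho))"
    unfolding P_set_def J_affine_0 n(2) using group.conj_class_closed[OF group_GA JA] by blast
qed

text \<open>
  Hence \<open>K_sum lam n\<close> and \<open>P_sum (lam, 0) (Suc n)\<close> are nonzero for the same \<open>n\<close>.
\<close>

lemma K_set_P_set_nonempty:
  fixes lam :: "'q::{finite, field} poly \<Rightarrow> nat list"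
  shows "K_set lam n \<noteq> {} \<longleftrightarrow> (\<exists>rho\<in>PPhi_of_size n. modify rho = lam)"
    and "P_set lam (Suc n) \<noteq> {} \<longleftrightarrow> (\<exists>rho\<in>PPhi_of_size n. modify rho = lam)"
proof -
  have J: "J_mat rho \<in> carrier (GL n)" if "rho \<in> PPhi_of_size n" for rho :: "'q poly \<Rightarrow> nat list"
    using J_mat_GL[of rho] that by (auto simp: PPhi_of_size_def)
  then have JA: "affine_mat n (0\<^sub>m n 1) (J_mat rho) \<in> carrier (GA (Suc n))"
    if "rho \<in> PPhi_of_size n" for rho :: "'q poly \<Rightarrow> nat list"
    using that by (intro affine_mat_GA zero_carrier_mat)
  show "K_set lam n \<noteq> {} \<longleftrightarrow> (\<exists>rho\<in>PPhi_of_size n. modify rho = lam)"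
  proof
    assume "K_set lam n \<noteq> {}"
    then show "\<exists>rho\<in>PPhi_of_size n. modify rho = lam"
      unfolding K_set_def GL_modified_type_def GL_type_def by blast
  next
    assume "\<exists>rho\<in>PPhi_of_size n. modify rho = lam"
    then show "K_set lam n \<noteq> {}"
      using K_set_P_set_class(1) group.conj_class_self[OF group_GL J] by blast
  qed
  show "P_set lam (Suc n) \<noteq> {} \<longleftrightarrow> (\<exists>rho\<in>PPhi_of_size n. modify rho = lam)"
  proof
    assume "P_set lam (Suc n) \<noteq> {}"
    then show "\<exists>rho\<in>PPhi_of_size n. modify rho = lam"
      unfolding P_set_def GA_modified_type_def GA_type_def by auto
  next
    assume "\<exists>rho\<in>PPhi_of_size n. modify rho = lam"
    then show "P_set lam (Suc n) \<noteq> {}"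
      using K_set_P_set_class(2) group.conj_class_self[OF group_GA JA] by blast
  qed
qed

lemma set_sum_eq_0_iff: "set_sum S = (\<lambda>_. 0) \<longleftrightarrow> S = {}"
  by (auto simp: set_sum_def fun_eq_iff split: if_splits)

lemma K_sum_eq: "K_sum lam n = set_sum (K_set lam n)"
  by (simp add: K_sum_def K_set_def)

lemma P_sum_eq: "P_sum (lam, 0) n = set_sum (P_set lam n)"
  by (simp add: P_sum_def P_set_def)

lemma P_set_0: "P_set lam 0 = ({} :: 'q::field mat set)"
proof -
  have "A = four_block_mat (1\<^sub>m 1) (0\<^sub>m 1 0) \<alpha> g \<Longrightarrow> A \<notin> carrier_mat 0 0" for A \<alpha> g :: "'q mat"
    by auto
  then have "carrier (GA 0) = ({} :: 'q mat set)" by (auto simp: GA_def dest!: GL_carrier_mat)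
  then show ?thesis by (simp add: P_set_def)
qed

lemma (in group) conj_class_conj_closed:
  assumes "a \<in> carrier G" "g \<in> conj_class G a" "h \<in> carrier G"
  shows "h \<otimes> g \<otimes> inv h \<in> conj_class G a"
  using assms conj_class_eq[OF assms(1,2)] unfolding conj_class_def by blast

text \<open>
  The heart of the proof. A factorisation of \<open>J_mat k\<close>, where \<open>k\<close> is the type with modified type \<open>nu\<close>, is
  mapped to a factorisation of \<open>diag(1, J_mat k)\<close>. The inverse map takes linear parts; that it is an inverse
  means that, in a factorisation of \<open>diag(1, J_mat k)\<close>, the translation parts of both factors vanish, which
  holds because the factors fix the first unit vector.
\<close>

lemma p_coeff_eq_a_coeff:
  fixes lam mu nu :: "'q::{finite, field} poly \<Rightarrow> nat list"
  assumes norm: "pnorm lam + pnorm mu = pnorm nu"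
    and "\<exists>rho\<in>PPhi_of_size n. modify rho = lam"
    and "\<exists>rho\<in>PPhi_of_size n. modify rho = mu"
    and "\<exists>rho\<in>PPhi_of_size n. modify rho = nu"
  shows "p_coeff (lam, 0) (mu, 0) (nu, 0) (Suc n) = a_coeff lam mu nu n"
proof -
  interpret GL: group "GL n :: 'q mat monoid" by (rule group_GL)
  interpret GA: group "GA (Suc n) :: 'q mat monoid" by (rule group_GA)
  obtain l m k where l: "l \<in> PPhi_of_size n" "modify l = lam" and m: "m \<in> PPhi_of_size n" "modify m = mu"
    and k: "k \<in> PPhi_of_size n" "modify k = nu" using assms by blast
  let ?d = "affine_mat n (0\<^sub>m n 1) :: 'q mat \<Rightarrow> 'q mat"
  have J: "J_mat rho \<in> carrier (GL n)" "?d (J_mat rho) \<in> carrier (GA (Suc n))"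
    if "rho \<in> PPhi_of_size n" for rho :: "'q poly \<Rightarrow> nat list"
    using J_mat_GL[of rho] that affine_mat_GA[OF zero_carrier_mat, of "J_mat rho" n] by (auto simp: PPhi_of_size_def)
  have size: "pnorm (modify rho) + length (rho t_minus_1) = n" if "rho \<in> PPhi_of_size n"
    for rho :: "'q poly \<Rightarrow> nat list"
    using pnorm_modify[of rho] that by (simp add: PPhi_of_size_def)
  let ?q = "card (UNIV :: 'q set)"
  have fix_J: "card (fixed_vecs (Suc n) (?d (J_mat rho))) = ?q ^ Suc (length (rho t_minus_1))"
    if "rho \<in> PPhi_of_size n" for rho :: "'q poly \<Rightarrow> nat list"
  proof -
    have rho: "rho \<in> PPhi" "pnorm rho = n" using that by (auto simp: PPhi_of_size_def)
    show ?thesis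
      using card_fixed_vecs_affine_0[OF GL_carrier_mat[OF J(1)[OF that]]]
        card_fixed_vectors[OF J_mat_carrier[OF rho(1)] rho(1) J_mat_iso[OF rho(1)]] rho(2)
      by (simp add: fixed_vecs_def)
  qed
  have fix_class: "card (fixed_vecs (Suc n) A) = ?q ^ Suc (length (rho t_minus_1))"
    if "rho \<in> PPhi_of_size n" "A \<in> conj_class (GA (Suc n)) (?d (J_mat rho))"
    for rho :: "'q poly \<Rightarrow> nat list" and A
  proof -
    have "A \<in> conj_class (GL (Suc n)) (?d (J_mat rho))"
      using that(2) subgroup.subset[OF subgroup_GA] unfolding conj_class_def by (fastforce simp: inv_GA)
    then have "card (fixed_vecs (Suc n) A) = card (fixed_vecs (Suc n) (?d (J_mat rho)))"
      using card_fixed_vecs_conj J(2)[OF that(1)] subgroup.subset[OF subgroup_GA] by blast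
    then show ?thesis using fix_J[OF that(1)] by simp
  qed
  let ?C = "?d (J_mat k)"
  have KG: "g \<in> carrier (GL n)" if "g \<in> K_set rho n" for g :: "'q mat" and rho
    using that by (simp add: K_set_def)
  have GLc: "g \<in> carrier_mat n n" if "g \<in> K_set rho n" for g :: "'q mat" and rho
    using KG[OF that] by (rule GL_carrier_mat)
  have lift: "?d g \<in> P_set (modify rho) (Suc n)" if "rho \<in> PPhi_of_size n" "g \<in> K_set (modify rho) n"
    for rho :: "'q poly \<Rightarrow> nat list" and g
    using conj_class_hom[OF affine_mat_0_hom J(1)[OF that(1)]] that(2) K_set_P_set_class[OF that(1) refl] by blast
  have lower: "linear_part n A \<in> K_set (modify rho) n"
    if "rho \<in> PPhi_of_size n" "A \<in> P_set (modify rho) (Suc n)" for rho :: "'q poly \<Rightarrow> nat list" and A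
    using conj_class_hom[OF linear_part_hom J(2)[OF that(1)]] that(2) K_set_P_set_class[OF that(1) refl]
      GL_carrier_mat[OF J(1)[OF that(1)]] by simp
  have fixes_e0: "A = ?d (linear_part n A)"
    if A: "A \<in> carrier (GA (Suc n))" and e: "unit_vec 1 0 @\<^sub>v 0\<^sub>v n \<in> fixed_vecs (Suc n) A" for A
  proof -
    obtain \<alpha> g where A': "A = affine_mat n \<alpha> g" "\<alpha> \<in> carrier_mat n 1" "g \<in> carrier_mat n n"
      using A by (rule GA_cases)
    have "unit_vec 1 0 @\<^sub>v (\<alpha> *\<^sub>v unit_vec 1 0 + g *\<^sub>v 0\<^sub>v n) = unit_vec 1 0 @\<^sub>v 0\<^sub>v n"
      using e affine_mat_mult_vec[OF A'(2,3), of "unit_vec 1 0" "0\<^sub>v n"] by (simp add: fixed_vecs_def A'(1))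
    then have "\<alpha> *\<^sub>v unit_vec 1 0 + g *\<^sub>v 0\<^sub>v n = 0\<^sub>v n"
      using append_vec_eq[OF unit_vec_carrier unit_vec_carrier] by blast
    then have z: "\<alpha> *\<^sub>v unit_vec 1 0 = 0\<^sub>v n" using A' by simp
    have "\<alpha> = 0\<^sub>m n 1"
    proof (rule eq_matI)
      fix i j assume "i < dim_row (0\<^sub>m n 1)" "j < dim_col (0\<^sub>m n 1)"
      then show "\<alpha> $$ (i, j) = 0\<^sub>m n 1 $$ (i, j)"
        using mult_mat_unit_vec[OF A'(2), of i 0] z by simp
    qed (use A' in auto)
    then show ?thesis using A' by simp
  qed
  have e0: "unit_vec 1 0 @\<^sub>v 0\<^sub>v n \<in> fixed_vecs (Suc n) ?C"
  proof -
    have c: "J_mat k \<in> carrier_mat n n" using J(1)[OF k(1)] by (rule GL_carrier_mat)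
    have "?C *\<^sub>v (unit_vec 1 0 @\<^sub>v 0\<^sub>v n) = unit_vec 1 0 @\<^sub>v (0\<^sub>m n 1 *\<^sub>v unit_vec 1 0 + J_mat k *\<^sub>v 0\<^sub>v n)"
      by (rule affine_mat_mult_vec) (use c in auto)
    also have "0\<^sub>m n 1 *\<^sub>v unit_vec 1 0 + J_mat k *\<^sub>v 0\<^sub>v n = 0\<^sub>v n" using c by (auto intro!: eq_vecI)
    finally show ?thesis
      using append_carrier_vec[of "unit_vec 1 0 :: 'q vec" 1 "0\<^sub>v n" n] by (simp add: fixed_vecs_def)
  qed
  have P_GA: "P_set rho (Suc n) \<subseteq> carrier (GA (Suc n))" for rho :: "'q poly \<Rightarrow> nat list"
    by (auto simp: P_set_def)
  \<comment> \<open>The codimensions of the spaces of fixed vectors add up because the sizes of the modified types do.\<close>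
  have split: "A = ?d (linear_part n A) \<and> B = ?d (linear_part n B)"
    if A: "A \<in> P_set lam (Suc n)" and B: "B \<in> P_set mu (Suc n)" and AB: "A * B = ?C" for A B
  proof -
    have AG: "A \<in> carrier (GA (Suc n))" "B \<in> carrier (GA (Suc n))" using A B P_GA by auto
    then have c: "A \<in> carrier_mat (Suc n) (Suc n)" "B \<in> carrier_mat (Suc n) (Suc n)"
      using subgroup.subset[OF subgroup_GA] GL_carrier_mat by blast+
    have "card (fixed_vecs (Suc n) A) * card (fixed_vecs (Suc n) B) =
        ?q ^ Suc (length (l t_minus_1)) * ?q ^ Suc (length (m t_minus_1))"
      using fix_class[OF l(1), of A] fix_class[OF m(1), of B] A B
        K_set_P_set_class(2)[OF l] K_set_P_set_class(2)[OF m] by simp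
    also have "\<dots> = ?q ^ Suc n * ?q ^ Suc (length (k t_minus_1))"
    proof -
      have "Suc (length (l t_minus_1)) + Suc (length (m t_minus_1)) = Suc n + Suc (length (k t_minus_1))"
        using size[OF l(1)] size[OF m(1)] size[OF k(1)] norm l(2) m(2) k(2) by simp
      then show ?thesis by (simp only: power_add[symmetric])
    qed
    also have "\<dots> = ?q ^ Suc n * card (fixed_vecs (Suc n) (A * B))"
      unfolding AB fix_J[OF k(1)] ..
    finally have "fixed_vecs (Suc n) (A * B) \<subseteq> fixed_vecs (Suc n) A \<inter> fixed_vecs (Suc n) B"
      by (rule fixed_vecs_mult_subset[OF c])
    then show ?thesis using e0 fixes_e0[OF AG(1)] fixes_e0[OF AG(2)] unfolding AB by blast
  qed
  have bij: "bij_betw (\<lambda>(g, h). (?d g, ?d h))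
      {(g, h). g \<in> K_set lam n \<and> h \<in> K_set mu n \<and> g \<otimes>\<^bsub>GL n\<^esub> h = J_mat k}
      {(A, B). A \<in> P_set lam (Suc n) \<and> B \<in> P_set mu (Suc n) \<and> A \<otimes>\<^bsub>GA (Suc n)\<^esub> B = ?C}"
    (is "bij_betw _ ?X ?Y")
  proof (rule bij_betwI[where g = "\<lambda>(A, B). (linear_part n A, linear_part n B)"])
    show "(\<lambda>(g, h). (?d g, ?d h)) \<in> ?X \<rightarrow> ?Y"
    proof
      fix x assume "x \<in> ?X"
      then obtain g h where x: "x = (g, h)" "g \<in> K_set lam n" "h \<in> K_set mu n" "g * h = J_mat k" by auto
      have "?d g * ?d h = ?C"
        using group_hom.hom_mult[OF affine_mat_0_hom KG[OF x(2)] KG[OF x(3)]] x(4) by simp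
      then show "(case x of (g, h) \<Rightarrow> (?d g, ?d h)) \<in> ?Y"
        using lift[OF l(1)] lift[OF m(1)] x l(2) m(2) by simp
    qed
    show "(\<lambda>(A, B). (linear_part n A, linear_part n B)) \<in> ?Y \<rightarrow> ?X"
    proof
      fix y assume "y \<in> ?Y"
      then obtain A B where y: "y = (A, B)" "A \<in> P_set lam (Suc n)" "B \<in> P_set mu (Suc n)" "A * B = ?C" by auto
      interpret lp: group_hom "GA (Suc n)" "GL n" "linear_part n :: 'q mat \<Rightarrow> 'q mat" by (rule linear_part_hom)
      have "linear_part n A * linear_part n B = linear_part n (A * B)"
        using lp.hom_mult[OF subsetD[OF P_GA y(2)] subsetD[OF P_GA y(3)]] by simp
      also have "\<dots> = J_mat k" unfolding y(4) using GL_carrier_mat[OF J(1)[OF k(1)]] by simp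
      finally show "(case y of (A, B) \<Rightarrow> (linear_part n A, linear_part n B)) \<in> ?X"
        using lower[OF l(1)] lower[OF m(1)] y l(2) m(2) by simp
    qed
    show "(case (case x of (g, h) \<Rightarrow> (?d g, ?d h)) of (A, B) \<Rightarrow> (linear_part n A, linear_part n B)) = x"
      if "x \<in> ?X" for x using that GLc by auto
    show "(case (case y of (A, B) \<Rightarrow> (linear_part n A, linear_part n B)) of (g, h) \<Rightarrow> (?d g, ?d h)) = y"
      if "y \<in> ?Y" for y using that split by (auto simp del: linear_part_affine_mat)
  qed
  have "p_coeff (lam, 0) (mu, 0) (nu, 0) (Suc n) = int (card ?Y)"
    unfolding p_coeff_def P_sum_eq K_set_P_set_class(2)[OF k]
  proof (rule GA.class_coeff_mult_eq_card[OF finite_carrier_GA P_GA P_GA J(2)[OF k(1)]])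
    fix A h :: "'q mat" assume h: "h \<in> carrier (GA (Suc n))"
    show "h \<otimes>\<^bsub>GA (Suc n)\<^esub> A \<otimes>\<^bsub>GA (Suc n)\<^esub> inv\<^bsub>GA (Suc n)\<^esub> h \<in> P_set lam (Suc n)"
      if "A \<in> P_set lam (Suc n)"
      using GA.conj_class_conj_closed[OF J(2)[OF l(1)] _ h] that unfolding K_set_P_set_class(2)[OF l] by blast
    show "h \<otimes>\<^bsub>GA (Suc n)\<^esub> A \<otimes>\<^bsub>GA (Suc n)\<^esub> inv\<^bsub>GA (Suc n)\<^esub> h \<in> P_set mu (Suc n)"
      if "A \<in> P_set mu (Suc n)"
      using GA.conj_class_conj_closed[OF J(2)[OF m(1)] _ h] that unfolding K_set_P_set_class(2)[OF m] by blast
  qed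
  also have "card ?Y = card ?X" using bij_betw_same_card[OF bij] by simp
  also have "int (card ?X) = a_coeff lam mu nu n"
    unfolding a_coeff_def K_sum_eq K_set_P_set_class(1)[OF k]
  proof (rule GL.class_coeff_mult_eq_card[OF finite_carrier_GL _ _ J(1)[OF k(1)], symmetric])
    fix g h :: "'q mat" assume h: "h \<in> carrier (GL n)"
    show "h \<otimes>\<^bsub>GL n\<^esub> g \<otimes>\<^bsub>GL n\<^esub> inv\<^bsub>GL n\<^esub> h \<in> K_set lam n" if "g \<in> K_set lam n"
      using GL.conj_class_conj_closed[OF J(1)[OF l(1)] _ h] that unfolding K_set_P_set_class(1)[OF l] by blast
    show "h \<otimes>\<^bsub>GL n\<^esub> g \<otimes>\<^bsub>GL n\<^esub> inv\<^bsub>GL n\<^esub> h \<in> K_set mu n" if "g \<in> K_set mu n"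
      using GL.conj_class_conj_closed[OF J(1)[OF m(1)] _ h] that unfolding K_set_P_set_class(1)[OF m] by blast
  qed (auto simp: K_set_def)
  finally show ?thesis .
qed

lemma all_nat_shift:
  assumes "P 0" "\<And>n. P (Suc n) \<longleftrightarrow> Q n"
  shows "(\<forall>n. P n) \<longleftrightarrow> (\<forall>n. Q n)"
  using assms
  by (metis not0_implies_Suc)

theorem theorem4p2:
  fixes lam mu nu :: "'q::{finite, field} poly \<Rightarrow> nat list"
  assumes "lam \<in> PPhi" and "mu \<in> PPhi" and "nu \<in> PPhi"
    and "pnorm lam + pnorm mu = pnorm nu"
  shows "p_const (lam, 0) (mu, 0) (nu, 0) = a_const lam mu nu"
proof -
  have "(\<forall>n. P_sum (lam, 0) n \<noteq> (\<lambda>_. 0) \<and> P_sum (mu, 0) n \<noteq> (\<lambda>_. 0) \<and> P_sum (nu, 0) n \<noteq> (\<lambda>_. 0)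
             \<longrightarrow> p_coeff (lam, 0) (mu, 0) (nu, 0) n = c) \<longleftrightarrow>
        (\<forall>n. K_sum lam n \<noteq> (\<lambda>_. 0) \<and> K_sum mu n \<noteq> (\<lambda>_. 0) \<and> K_sum nu n \<noteq> (\<lambda>_. 0)
             \<longrightarrow> a_coeff lam mu nu n = c)" (is "(\<forall>n. ?P n) \<longleftrightarrow> (\<forall>n. ?K n)") for c
  proof (rule all_nat_shift)
    \<comment> \<open>The shift by one is the size of the additional first block; there is no affine group of size 0.\<close>
    show "?P 0" by (simp add: P_sum_eq set_sum_eq_0_iff P_set_0)
    fix n
    have "p_coeff (lam, 0) (mu, 0) (nu, 0) (Suc n) = a_coeff lam mu nu n"
      if "(\<exists>rho\<in>PPhi_of_size n. modify rho = lam) \<and> (\<exists>rho\<in>PPhi_of_size n. modify rho = mu)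
        \<and> (\<exists>rho\<in>PPhi_of_size n. modify rho = nu)"
      using that by (intro p_coeff_eq_a_coeff[OF assms(4)]) (elim conjE, assumption)+
    then show "?P (Suc n) \<longleftrightarrow> ?K n"
      unfolding P_sum_eq K_sum_eq set_sum_eq_0_iff K_set_P_set_nonempty
      by (intro imp_cong[OF refl]) (simp only:)
  qed
  then show ?thesis by (simp only: p_const_def a_const_def)
qed

end
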